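(* Let $S$ be a set of abstract vector variables, $x\in S$, and $Y=\{y_1,\dots,y_N\}\subset S\setminus\{x\}$ finite. The operator $\mathcal H^Y_{x,q}$ is invertible on the localization $R_{\mathbb B}(\{x\}\cup Y)_{\Omega_{x;Y}}$. Its inverse, relative to $\mathcal Y_{x;Y}\oplus\mathcal X_{x;Y}$, is $$\mathcal G^Y_{x,q}=\begin{pmatrix}G^{\mathrm{gr},Y}_{x,q}&0\\-G^{\mathrm{gr},Y}_{x,q}\,\mathcal N^Y_{x,q}\,G^{\mathrm{gr},Y}_{x,q}&G^{\mathrm{gr},Y}_{x,q}\end{pmatrix}.$$ The finite inverses are compatible under enlargement of $Y$. Consequently, if $\Omega_x$ is the multiplicative set generated by all finite diagonal factors (all $\lambda_{p,a,\beta}$ for all finite $Y\subset S\setminus\{x\}$), they induce a direct-limit inverse $\mathcal G_{x,q}$ of $$\mathcal H_{x,q}:=\partial^{\mathrm R}_{x,q}\mathcal C_x+\mathcal C_x\partial^{\mathrm R}_{x,q}$$ on $R_{\mathbb B}(S)_{\Omega_x}$.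
   Context: **Radial algebra.** For a set $S$ of abstract vector variables, $R(S)$ is the associative unital $\mathbb R$-algebra generated by $S$ subject to $[\{u,v\},w]=0$ for all $u,v,w\in S$, where $\{a,b\}=ab+ba$, $[a,b]=ab-ba$. The wedge is the antisymmetrized product $u_1\wedge\cdots\wedge u_p=\frac1{p!}\sum_{\pi}\operatorname{sgn}(\pi)u_{\pi(1)}\cdots u_{\pi(p)}$ (empty wedge $=1$). **Coefficients.** $q,Q$ are algebraically independent indeterminates, $\mathbb B=\mathbb R[q,q^{-1},Q,(1-q)^{-1}]$, $R_{\mathbb B}(S)=\mathbb B\otimes_{\mathbb R}R(S)$. For integers $n,a$: $[n]_q=\frac{1-q^n}{1-q}$, $q^{m+a}:=Qq^a$, $[m+a]_q:=\frac{1-Qq^a}{1-q}$ ($m$ is only a formal symbol). For a multiplicative set $\Omega$ of central coefficients, $\mathcal M_\Omega=\Omega^{-1}\mathcal M$. **Scalars.** $r=x^2$, $s_i=\{x,y_i\}$, $c_{ij}=\{y_i,y_j\}=c_{ji}$ are central and $\mathcal A_x(Y)=\mathbb B[r,s_1,\dots,s_N,c_{ij}:1\le i\le j\le N]$ is a polynomial algebra. For $I=\{i_1<\cdots<i_p\}\subset\{1,\dots,N\}$, $y_I=y_{i_1}\wedge\cdots\wedge y_{i_p}$, $y_\varnothing=1$. It is known that $R_{\mathbb B}(\{x\}\cup Y)=\mathcal Y_{x;Y}\oplus\mathcal X_{x;Y}$ with $\mathcal Y_{x;Y}=\bigoplus_I y_I\mathcal A_x(Y)$, $\mathcal X_{x;Y}=\bigoplus_I(x\wedge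 y_I)\mathcal A_x(Y)$, free over $\mathcal A_x(Y)$ on the elements $y_I,\ x\wedge y_I$. **Jackson operators.** For a scalar variable $u$ and parameter $P$: $\delta^{(u)}_Pf=\frac{f(u)-f(Pu)}{(1-P)u}$, $T^{(u)}_Pf(u)=f(Pu)$, $M_u$ is multiplication by $u$. For $A\in\mathcal A_x(Y)$, $$\partial^{\mathrm{sc},Y}_{x,q}A=(1+q)\,x\,\delta^{(r)}_{q^2}A+2\sum_{i=1}^N y_i\,T^{(r)}_{q^2}\delta^{(s_i)}_qA,\qquad E^{\mathrm{sc},Y}_{x,q}=(1+q)M_r\delta^{(r)}_{q^2}+T^{(r)}_{q^2}\sum_{i=1}^NM_{s_i}\delta^{(s_i)}_q .$$ **Right $q$-vector derivatives.** $\partial^{Y,\mathrm R}_{x,q}$ is the $\mathbb B$-linear operator on $R_{\mathbb B}(\{x\}\cup Y)$ with, for $p=|I|$ and $A,B\in\mathcal A_x(Y)$, $$\partial^{Y,\mathrm R}_{x,q}(y_IA)=y_I\,\partial^{\mathrm{sc},Y}_{x,q}(A),\qquad \partial^{Y,\mathrm R}_{x,q}((x\wedge y_I)B)=(-1)^p[m-p]_q\,y_IB+q^{m-p}(x\wedge y_I)\,\partial^{\mathrm{sc},Y}_{x,q}(B).$$ These are compatible under $Y\subset Z$ and define $\partial^{\mathrm R}_{x,q}$ on $R_{\mathbb B}(S)$, restricting to $\partial^{Y,\mathrm R}_{x,q}$ on each $R_{\mathbb B}(\{x\}\cup Y)$. **Exterior creation and anticommutator.** $\mathcal C^Y_x(y_IA)=(x\wedge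 y_I)A$, $\mathcal C^Y_x((x\wedge y_I)B)=0$, extended additively; these are compatible under enlargement of $Y$ and define $\mathcal C_x$ on $R_{\mathbb B}(S)$. $\mathcal H^Y_{x,q}:=\partial^{Y,\mathrm R}_{x,q}\mathcal C^Y_x+\mathcal C^Y_x\partial^{Y,\mathrm R}_{x,q}$. All operators are $\mathbb B$-linear and are extended to localizations at subsets of $\mathbb B$. **Off-diagonal part.** $\mathcal N^Y_{x,q}:\mathcal Y_{x;Y}\to\mathcal X_{x;Y}$ is given, for $p=|I|$, by $$\mathcal N^Y_{x,q}(y_IA)=q^{m-p}(x\wedge y_I)\,\partial^{\mathrm{sc},Y}_{x,q}(A)+\mathcal C^Y_x\bigl(y_I\,\partial^{\mathrm{sc},Y}_{x,q}(A)\bigr)-(-1)^pq^{m-p}\,y_I\,E^{\mathrm{sc},Y}_{x,q}A,$$ which lies in $\mathcal X_{x;Y}$. **Diagonal factors and graded Green operator.** For $0\le p\le N$, $a\ge0$, $\beta\in\mathbb Z_{\ge0}^N$, $$\lambda_{p,a,\beta}=[m-p]_q+q^{m-p}\Bigl([2a]_q+q^{2a}\sum_{i=1}^N[\beta_i]_q\Bigr)\in\mathbb B,\qquad \mu_{p,a,\beta}=(-1)^p\lambda_{p,a,\beta}.$$ $\Omega_{x;Y}\subset\mathbb B$ is the multiplicative set generated by all nonzero formal factors $\lambda_{p,a,\beta}$. $G^{\mathrm{gr},Y}_{x,q}$ is defined on both sectors by $$G^{\mathrm{gr},Y}_{x,q}(y_Ir^as^\beta P(c))=\mu_{|I|,a,\beta}^{-1}\,y_Ir^as^\beta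 P(c),\qquad G^{\mathrm{gr},Y}_{x,q}((x\wedge y_I)r^as^\beta P(c))=\mu_{|I|,a,\beta}^{-1}(x\wedge y_I)r^as^\beta P(c),$$ for $P(c)\in\mathbb B[c_{ij}]$, $s^\beta=\prod_is_i^{\beta_i}$. Block matrices act on column vectors with components in $\mathcal Y_{x;Y}$, $\mathcal X_{x;Y}$ (in this order). *)

theory Defs
  imports
    "HOL-Library.Poly_Mapping"
    "HOL-Library.Uprod"
    "HOL-Computational_Algebra.Polynomial"
    "HOL-Computational_Algebra.Fraction_Field"
    "HOL-Combinatorics.Permutations"
begin

section \<open>The radial algebra\<close>

text \<open>Words under concatenation, written additively so that the library's monoid algebra
  \<open>'v vword \<Rightarrow>\<^sub>0 'k\<close> is the free associative unital algebra on \<open>'v\<close>.\<close>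

datatype 'v vword = VWord "'v list"

instantiation vword :: (type) monoid_add
begin

definition zero_vword :: "'v vword" where
  "zero_vword = VWord []"

fun plus_vword :: "'v vword \<Rightarrow> 'v vword \<Rightarrow> 'v vword" where
  "plus_vword (VWord us) (VWord vs) = VWord (us @ vs)"

instance
proof
  fix a b c :: "'v vword"
  show "a + b + c = a + (b + c)" by (cases a; cases b; cases c) simp
  show "0 + a = a" by (cases a) (simp add: zero_vword_def)
  show "a + 0 = a" by (cases a) (simp add: zero_vword_def)
qed

end

type_synonym ('v, 'k) freealg = "'v vword \<Rightarrow>\<^sub>0 'k"

definition fgen :: "'v \<Rightarrow> ('v, 'k::comm_ring_1) freealg" where
  "fgen v = Poly_Mapping.single (VWord [v]) 1"

definition anticomm :: "'a::ring_1 \<Rightarrow> 'a \<Rightarrow> 'a" where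
  "anticomm a b = a * b + b * a"

definition comm :: "'a::ring_1 \<Rightarrow> 'a \<Rightarrow> 'a" where
  "comm a b = a * b - b * a"

inductive_set radial_ideal :: "('v, 'k::comm_ring_1) freealg set" where
  zero: "0 \<in> radial_ideal"
| gen: "a * comm (anticomm (fgen u) (fgen v)) (fgen w) * b \<in> radial_ideal"
| add: "p \<in> radial_ideal \<Longrightarrow> p' \<in> radial_ideal \<Longrightarrow> p + p' \<in> radial_ideal"

lemma radial_ideal_mult:
  assumes "p \<in> radial_ideal"
  shows "a * p * b \<in> radial_ideal"
  using assms
proof induction
  case zero
  then show ?case by (simp add: radial_ideal.zero)
next
  case (gen a' u v w b')
  have "a * (a' * comm (anticomm (fgen u) (fgen v)) (fgen w) * b') * b =
        (a * a') * comm (anticomm (fgen u) (fgen v)) (fgen w) * (b' * b)"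
    by (simp add: mult.assoc)
  then show ?case by (simp only: radial_ideal.gen)
next
  case (add p p')
  then show ?case by (simp add: distrib_left distrib_right radial_ideal.add)
qed

lemma radial_ideal_left: "p \<in> radial_ideal \<Longrightarrow> a * p \<in> radial_ideal"
  using radial_ideal_mult[of p a 1] by simp

lemma radial_ideal_right: "p \<in> radial_ideal \<Longrightarrow> p * b \<in> radial_ideal"
  using radial_ideal_mult[of p 1 b] by simp

lemma radial_ideal_uminus: "p \<in> radial_ideal \<Longrightarrow> - p \<in> radial_ideal"
  using radial_ideal_left[of p "- 1"] by simp

lemma radial_ideal_diff:
  "p \<in> radial_ideal \<Longrightarrow> p' \<in> radial_ideal \<Longrightarrow> p - p' \<in> radial_ideal"
  using radial_ideal.add[OF _ radial_ideal_uminus, of p p'] by simp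

lemma vword_add_eq_0_iff: "a + b = 0 \<longleftrightarrow> a = 0 \<and> b = (0 :: 'v vword)"
  by (cases a; cases b) (auto simp: zero_vword_def)

lemma lookup_freealg_mult_0:
  fixes p p' :: "('v, 'k::comm_ring_1) freealg"
  shows "Poly_Mapping.lookup (p * p') 0 = Poly_Mapping.lookup p 0 * Poly_Mapping.lookup p' 0"
proof -
  have "Poly_Mapping.lookup (p * p') 0 =
      (\<Sum>(a, b). Poly_Mapping.lookup p a * Poly_Mapping.lookup p' b when (0 :: 'v vword) = a + b)"
    by (simp add: times_poly_mapping.rep_eq prod_fun_unfold_prod)
  also have "\<dots> = (\<Sum>ab :: 'v vword \<times> 'v vword. (Poly_Mapping.lookup p 0 * Poly_Mapping.lookup p' 0 when ab = (0, 0)))"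
  proof (rule arg_cong[where f = Sum_any], rule ext)
    fix ab :: "'v vword \<times> 'v vword"
    obtain a b where "ab = (a, b)" by (cases ab)
    moreover have "(0 = a + b) \<longleftrightarrow> (a = 0 \<and> b = 0)"
      using vword_add_eq_0_iff[of a b] by (simp only: eq_commute[of 0])
    ultimately show "(case ab of (a, b) \<Rightarrow> Poly_Mapping.lookup p a * Poly_Mapping.lookup p' b when 0 = a + b) =
        (Poly_Mapping.lookup p 0 * Poly_Mapping.lookup p' 0 when ab = (0, 0))"
      by (cases "a = 0 \<and> b = 0") simp_all
  qed
  finally show ?thesis by simp
qed

lemma radial_ideal_lookup_0: "p \<in> radial_ideal \<Longrightarrow> Poly_Mapping.lookup p 0 = 0"
  by (induction rule: radial_ideal.induct)
     (simp_all add: lookup_freealg_mult_0 comm_def lookup_minus lookup_add mult.commute)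

definition radial_rel :: "('v, 'k::comm_ring_1) freealg \<Rightarrow> ('v, 'k) freealg \<Rightarrow> bool" where
  "radial_rel p p' \<longleftrightarrow> p - p' \<in> radial_ideal"

lemma radial_rel_trans:
  assumes "radial_rel a b" "radial_rel b c"
  shows "radial_rel a c"
proof -
  have "(a - b) + (b - c) \<in> radial_ideal"
    using assms unfolding radial_rel_def by (rule radial_ideal.add)
  then show ?thesis by (simp add: radial_rel_def)
qed

quotient_type (overloaded) ('v, 'k) radial = "('v, 'k::comm_ring_1) freealg" / radial_rel
proof (rule equivpI)
  show "reflp radial_rel"
    by (auto simp: reflp_def radial_rel_def intro: radial_ideal.zero)
  show "symp radial_rel"
    by (auto simp: symp_def radial_rel_def dest: radial_ideal_uminus)
  show "transp radial_rel"
    by (auto simp: transp_def intro: radial_rel_trans)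
qed

instantiation radial :: (type, comm_ring_1) ring_1
begin

lift_definition zero_radial :: "('v, 'k::comm_ring_1) radial" is 0 .
lift_definition one_radial :: "('v, 'k::comm_ring_1) radial" is 1 .

lift_definition plus_radial :: "('v, 'k::comm_ring_1) radial \<Rightarrow> ('v, 'k) radial \<Rightarrow> ('v, 'k) radial"
  is "(+)"
  unfolding radial_rel_def by (simp add: add_diff_add radial_ideal.add)

lift_definition uminus_radial :: "('v, 'k::comm_ring_1) radial \<Rightarrow> ('v, 'k) radial" is uminus
  unfolding radial_rel_def by (simp only: minus_diff_minus radial_ideal_uminus)

lift_definition minus_radial :: "('v, 'k::comm_ring_1) radial \<Rightarrow> ('v, 'k) radial \<Rightarrow> ('v, 'k) radial"
  is "(-)"
proof -
  fix a b c d :: "('v, 'k) freealg"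
  assume "radial_rel a b" "radial_rel c d"
  moreover have "(a - c) - (b - d) = (a - b) - (c - d)" by simp
  ultimately show "radial_rel (a - c) (b - d)"
    unfolding radial_rel_def by (simp only: radial_ideal_diff)
qed

lift_definition times_radial :: "('v, 'k::comm_ring_1) radial \<Rightarrow> ('v, 'k) radial \<Rightarrow> ('v, 'k) radial"
  is "(*)"
proof -
  fix a b c d :: "('v, 'k) freealg"
  assume "radial_rel a b" "radial_rel c d"
  moreover have "a * c - b * d = (a - b) * c + b * (c - d)" by (simp add: algebra_simps)
  ultimately show "radial_rel (a * c) (b * d)"
    unfolding radial_rel_def
    by (simp only: radial_ideal.add radial_ideal_left radial_ideal_right)
qed

instance
proof
  fix a b c :: "('v, 'k::comm_ring_1) radial"
  show "a + b + c = a + (b + c)" by transfer (simp add: radial_rel_def add.assoc radial_ideal.zero)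
  show "a + b = b + a" by transfer (simp add: radial_rel_def add.commute radial_ideal.zero)
  show "0 + a = a" by transfer (simp add: radial_rel_def radial_ideal.zero)
  show "- a + a = 0" by transfer (simp add: radial_rel_def radial_ideal.zero)
  show "a - b = a + - b" by transfer (simp add: radial_rel_def radial_ideal.zero)
  show "a * b * c = a * (b * c)" by transfer (simp add: radial_rel_def mult.assoc radial_ideal.zero)
  show "1 * a = a" by transfer (simp add: radial_rel_def radial_ideal.zero)
  show "a * 1 = a" by transfer (simp add: radial_rel_def radial_ideal.zero)
  show "(a + b) * c = a * c + b * c"
    by transfer (simp add: radial_rel_def distrib_right radial_ideal.zero)
  show "a * (b + c) = a * b + a * c"
    by transfer (simp add: radial_rel_def distrib_left radial_ideal.zero)
  show "(0 :: ('v, 'k::comm_ring_1) radial) \<noteq> 1"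
    by transfer (auto simp: radial_rel_def lookup_minus dest: radial_ideal_lookup_0)
qed

end

lift_definition rgen :: "'v \<Rightarrow> ('v, 'k::comm_ring_1) radial" is fgen .

lift_definition cst :: "'k \<Rightarrow> ('v, 'k::comm_ring_1) radial" is "Poly_Mapping.single 0" .

lemma radial_relation: "comm (anticomm (rgen u) (rgen v)) (rgen w) = 0"
  unfolding comm_def anticomm_def
  by transfer (use radial_ideal.gen[of 1 _ _ _ 1] in \<open>simp add: radial_rel_def comm_def anticomm_def\<close>)

lemma anticomm_commute: "anticomm a b = anticomm b a"
  by (simp add: anticomm_def add.commute)

text \<open>\<open>subalg K V\<close> is the \<open>K\<close>-subalgebra generated by the vector variables in \<open>V\<close>. Setting the
  variables outside \<open>V\<close> to zero respects the defining relations, so the radial algebra presented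
  by \<open>V\<close> alone embeds into the one presented by all of \<open>'v\<close>, with image \<open>subalg UNIV V\<close>.\<close>

inductive_set subalg :: "'k set \<Rightarrow> 'v set \<Rightarrow> ('v, 'k::comm_ring_1) radial set"
  for K :: "'k set" and V :: "'v set" where
  cst: "c \<in> K \<Longrightarrow> cst c \<in> subalg K V"
| gen: "v \<in> V \<Longrightarrow> rgen v \<in> subalg K V"
| add: "a \<in> subalg K V \<Longrightarrow> b \<in> subalg K V \<Longrightarrow> a + b \<in> subalg K V"
| mult: "a \<in> subalg K V \<Longrightarrow> b \<in> subalg K V \<Longrightarrow> a * b \<in> subalg K V"


section \<open>Coefficients\<close>

text \<open>All coefficients live in \<open>\<real>(q,Q)\<close>, the fraction field of \<open>\<real>[q][Q]\<close>; the inner polynomial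
  variable is \<open>q\<close>, the outer one is \<open>Q\<close>.\<close>

type_synonym qfield = "real poly poly fract"

definition qq :: qfield where "qq = Fract [:[:0, 1:]:] 1"
definition QQ :: qfield where "QQ = Fract [:0, 1:] 1"
definition rconst :: "real \<Rightarrow> qfield" where "rconst c = Fract [:[:c:]:] 1"

inductive_set BB :: "qfield set" where
  real: "rconst c \<in> BB"
| q: "qq \<in> BB"
| q_inv: "inverse qq \<in> BB"
| Q: "QQ \<in> BB"
| one_minus_q_inv: "inverse (1 - qq) \<in> BB"
| add: "a \<in> BB \<Longrightarrow> b \<in> BB \<Longrightarrow> a + b \<in> BB"
| mult: "a \<in> BB \<Longrightarrow> b \<in> BB \<Longrightarrow> a * b \<in> BB"

text \<open>\<open>qint n\<close> is \<open>[n]\<^sub>q\<close>; \<open>qmpow a\<close> and \<open>qmint a\<close> are \<open>q\<close> to the power \<open>m + a\<close> and the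
  \<open>q\<close>-integer of \<open>m + a\<close>, where \<open>Q\<close> stands for \<open>q\<close> to the formal power \<open>m\<close>.\<close>

definition qint :: "int \<Rightarrow> qfield" where
  "qint n = (1 - qq powi n) / (1 - qq)"

definition qmpow :: "int \<Rightarrow> qfield" where
  "qmpow a = QQ * qq powi a"

definition qmint :: "int \<Rightarrow> qfield" where
  "qmint a = (1 - QQ * qq powi a) / (1 - qq)"

type_synonym 'v ralg = "('v, qfield) radial"

text \<open>\<open>RB V\<close> is the coefficient ring \<open>BB\<close> tensored with the real radial algebra on \<open>V\<close>. The latter is
  free over \<open>\<real>\<close>, so the tensor product is a torsion-free \<open>BB\<close>-module, realised as the
  \<open>BB\<close>-subalgebra generated by \<open>V\<close> after extension of scalars to the fraction field. Its
  localization at a set \<open>\<Omega>\<close> of nonzero elements of \<open>BB\<close> is then the set of fractions formed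
  inside the same algebra.\<close>

definition RB :: "'v set \<Rightarrow> 'v ralg set" where
  "RB V = subalg BB V"

definition localize :: "qfield set \<Rightarrow> 'v ralg set \<Rightarrow> 'v ralg set" where
  "localize \<Omega> M = {cst (inverse \<omega>) * z |\<omega> z. \<omega> \<in> \<Omega> \<and> z \<in> M}"

inductive_set mult_set :: "qfield set \<Rightarrow> qfield set" for F :: "qfield set" where
  one: "1 \<in> mult_set F"
| gen: "c \<in> F \<Longrightarrow> c \<in> mult_set F"
| mult: "a \<in> mult_set F \<Longrightarrow> b \<in> mult_set F \<Longrightarrow> a * b \<in> mult_set F"


section \<open>Wedge products and scalars\<close>

definition wedge :: "'v list \<Rightarrow> 'v ralg" where
  "wedge us = cst (inverse (of_nat (fact (length us)))) *
     (\<Sum>\<pi> | \<pi> permutes {..<length us}.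
        of_int (sign \<pi>) * prod_list (map (\<lambda>i. rgen (us ! \<pi> i)) [0..<length us]))"

text \<open>The scalar variables \<open>r\<close>, \<open>s\<^sub>i\<close> and \<open>c\<^sub>i\<^sub>j = c\<^sub>j\<^sub>i\<close>, indexed by the vector variables themselves.
  Jackson operators act on formal polynomials in them; \<open>scal x\<close> evaluates such a polynomial in
  the radial algebra.\<close>

datatype 'v svar = R_var | S_var 'v | C_var "'v uprod"

type_synonym 'v spoly = "('v svar \<Rightarrow>\<^sub>0 nat) \<Rightarrow>\<^sub>0 qfield"

definition svars :: "'v set \<Rightarrow> 'v svar set" where
  "svars Y = {R_var} \<union> S_var ` Y \<union> {C_var (Upair u v) |u v. u \<in> Y \<and> v \<in> Y}"

definition spolys :: "qfield set \<Rightarrow> 'v set \<Rightarrow> 'v spoly set" where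
  "spolys K Y = {A. \<forall>m \<in> Poly_Mapping.keys A. Poly_Mapping.lookup A m \<in> K \<and> Poly_Mapping.keys m \<subseteq> svars Y}"

definition pvar :: "'v svar \<Rightarrow> 'v spoly" where
  "pvar u = Poly_Mapping.single (Poly_Mapping.single u 1) 1"

definition pconst :: "qfield \<Rightarrow> 'v spoly" where
  "pconst c = Poly_Mapping.single 0 c"

definition anticomm_gen :: "('v, 'v ralg) commute" where
  "anticomm_gen = Abs_commute (\<lambda>u v. anticomm (rgen u) (rgen v))"

lemma apply_anticomm_gen [simp]: "apply_commute anticomm_gen u v = anticomm (rgen u) (rgen v)"
  unfolding anticomm_gen_def by (subst Abs_commute_inverse) (auto simp: anticomm_commute)

fun sval :: "'v \<Rightarrow> 'v svar \<Rightarrow> 'v ralg" where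
  "sval x R_var = rgen x ^ 2"
| "sval x (S_var v) = anticomm (rgen x) (rgen v)"
| "sval x (C_var p) = case_uprod anticomm_gen p"

text \<open>In \<open>scal\<close> the fold is a product of central elements, hence independent of the order.\<close>

definition scal :: "'v \<Rightarrow> 'v spoly \<Rightarrow> 'v ralg" where
  "scal x A = (\<Sum>m \<in> Poly_Mapping.keys A. cst (Poly_Mapping.lookup A m) *
     Finite_Set.fold (\<lambda>u z. sval x u ^ Poly_Mapping.lookup m u * z) 1 (Poly_Mapping.keys m))"


section \<open>Jackson operators\<close>

text \<open>\<open>qsubst u P f\<close> is \<open>f\<close> with \<open>P u\<close> substituted for the variable \<open>u\<close>.\<close>

definition qsubst :: "'v svar \<Rightarrow> qfield \<Rightarrow> 'v spoly \<Rightarrow> 'v spoly" where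
  "qsubst u P f = Poly_Mapping.mapp (\<lambda>m c. P ^ Poly_Mapping.lookup m u * c) f"

definition jackson :: "'v svar \<Rightarrow> qfield \<Rightarrow> 'v spoly \<Rightarrow> 'v spoly" where
  "jackson u P f = (THE g. pconst (1 - P) * pvar u * g = f - qsubst u P f)"

definition dsc :: "'v \<Rightarrow> 'v list \<Rightarrow> 'v spoly \<Rightarrow> 'v ralg" where
  "dsc x ys A = cst (1 + qq) * rgen x * scal x (jackson R_var (qq ^ 2) A)
     + 2 * (\<Sum>v \<in> set ys. rgen v * scal x (qsubst R_var (qq ^ 2) (jackson (S_var v) qq A)))"

definition Esc :: "'v list \<Rightarrow> 'v spoly \<Rightarrow> 'v spoly" where
  "Esc ys A = pconst (1 + qq) * pvar R_var * jackson R_var (qq ^ 2) A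
     + qsubst R_var (qq ^ 2) (\<Sum>v \<in> set ys. pvar (S_var v) * jackson (S_var v) qq A)"


section \<open>Operators on the two sectors\<close>

text \<open>A finite \<open>Y = {y\<^sub>1, \<dots>, y\<^sub>N}\<close> is given by a distinct list; index sets \<open>I\<close> are subsets of
  \<open>{..<N}\<close>.\<close>

definition enumerates :: "'v set \<Rightarrow> 'v \<Rightarrow> 'v list \<Rightarrow> bool" where
  "enumerates S x ys \<longleftrightarrow> distinct ys \<and> set ys \<subseteq> S - {x}"

definition yw :: "'v list \<Rightarrow> nat set \<Rightarrow> 'v ralg" where
  "yw ys I = wedge (nths ys I)"

definition xw :: "'v \<Rightarrow> 'v list \<Rightarrow> nat set \<Rightarrow> 'v ralg" where
  "xw x ys I = wedge (x # nths ys I)"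

definition isets :: "'v list \<Rightarrow> nat set set" where
  "isets ys = Pow {..<length ys}"

definition sectorY :: "'v \<Rightarrow> 'v list \<Rightarrow> 'v ralg set" where
  "sectorY x ys = {\<Sum>I \<in> isets ys. yw ys I * scal x (A I) |A. \<forall>I. A I \<in> spolys BB (set ys)}"

definition sectorX :: "'v \<Rightarrow> 'v list \<Rightarrow> 'v ralg set" where
  "sectorX x ys = {\<Sum>I \<in> isets ys. xw x ys I * scal x (B I) |B. \<forall>I. B I \<in> spolys BB (set ys)}"

text \<open>The coordinates of \<open>z\<close> in the free basis \<open>y\<^sub>I\<close>, \<open>x \<and> y\<^sub>I\<close>. They are taken over the fraction
  field, so that every operator below is given at once on all localizations; on elements of
  \<open>RB\<close> they have coefficients in \<open>BB\<close>.\<close>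

definition coords :: "'v \<Rightarrow> 'v list \<Rightarrow> 'v ralg \<Rightarrow> (nat set \<Rightarrow> 'v spoly) \<times> (nat set \<Rightarrow> 'v spoly)" where
  "coords x ys z = (THE (A, B).
     (\<forall>I. A I \<in> spolys UNIV (set ys) \<and> B I \<in> spolys UNIV (set ys)) \<and>
     (\<forall>I. I \<notin> isets ys \<longrightarrow> A I = 0 \<and> B I = 0) \<and>
     z = (\<Sum>I \<in> isets ys. yw ys I * scal x (A I) + xw x ys I * scal x (B I)))"

text \<open>The additive map with \<open>y\<^sub>I A \<mapsto> f I A\<close> and \<open>(x \<and> y\<^sub>I) B \<mapsto> g I B\<close>.\<close>

definition sector_op ::
  "'v \<Rightarrow> 'v list \<Rightarrow> (nat set \<Rightarrow> 'v spoly \<Rightarrow> 'v ralg) \<Rightarrow> (nat set \<Rightarrow> 'v spoly \<Rightarrow> 'v ralg) \<Rightarrow>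
   'v ralg \<Rightarrow> 'v ralg" where
  "sector_op x ys f g z =
     (case coords x ys z of (A, B) \<Rightarrow> \<Sum>I \<in> isets ys. f I (A I) + g I (B I))"

definition projY :: "'v \<Rightarrow> 'v list \<Rightarrow> 'v ralg \<Rightarrow> 'v ralg" where
  "projY x ys = sector_op x ys (\<lambda>I A. yw ys I * scal x A) (\<lambda>I B. 0)"

definition projX :: "'v \<Rightarrow> 'v list \<Rightarrow> 'v ralg \<Rightarrow> 'v ralg" where
  "projX x ys = sector_op x ys (\<lambda>I A. 0) (\<lambda>I B. xw x ys I * scal x B)"

definition vder :: "'v \<Rightarrow> 'v list \<Rightarrow> 'v ralg \<Rightarrow> 'v ralg" where
  "vder x ys = sector_op x ys
     (\<lambda>I A. yw ys I * dsc x ys A)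
     (\<lambda>I B. cst ((- 1) ^ card I * qmint (- int (card I))) * yw ys I * scal x B
          + cst (qmpow (- int (card I))) * xw x ys I * dsc x ys B)"

definition creation :: "'v \<Rightarrow> 'v list \<Rightarrow> 'v ralg \<Rightarrow> 'v ralg" where
  "creation x ys = sector_op x ys (\<lambda>I A. xw x ys I * scal x A) (\<lambda>I B. 0)"

definition Hop :: "'v \<Rightarrow> 'v list \<Rightarrow> 'v ralg \<Rightarrow> 'v ralg" where
  "Hop x ys z = vder x ys (creation x ys z) + creation x ys (vder x ys z)"

text \<open>\<open>Nop\<close> is only meaningful on the \<open>\<Y>\<close>-sector; it is extended by zero.\<close>

definition Nop :: "'v \<Rightarrow> 'v list \<Rightarrow> 'v ralg \<Rightarrow> 'v ralg" where
  "Nop x ys = sector_op x ys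
     (\<lambda>I A. cst (qmpow (- int (card I))) * xw x ys I * dsc x ys A
          + creation x ys (yw ys I * dsc x ys A)
          - cst ((- 1) ^ card I * qmpow (- int (card I))) * yw ys I * scal x (Esc ys A))
     (\<lambda>I B. 0)"


section \<open>The Green operator\<close>

definition lam :: "'v list \<Rightarrow> nat \<Rightarrow> nat \<Rightarrow> ('v \<Rightarrow> nat) \<Rightarrow> qfield" where
  "lam ys p a \<beta> = qmint (- int p) +
     qmpow (- int p) * (qint (2 * int a) + qq ^ (2 * a) * (\<Sum>v \<in> set ys. qint (int (\<beta> v))))"

definition mu :: "'v list \<Rightarrow> nat \<Rightarrow> nat \<Rightarrow> ('v \<Rightarrow> nat) \<Rightarrow> qfield" where
  "mu ys p a \<beta> = (- 1) ^ p * lam ys p a \<beta>"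

definition lam_factors :: "'v list \<Rightarrow> qfield set" where
  "lam_factors ys = {lam ys p a \<beta> |p a \<beta>. p \<le> length ys \<and> lam ys p a \<beta> \<noteq> 0}"

definition Omega :: "'v list \<Rightarrow> qfield set" where
  "Omega ys = mult_set (lam_factors ys)"

definition Omega_lim :: "'v set \<Rightarrow> 'v \<Rightarrow> qfield set" where
  "Omega_lim S x = mult_set (\<Union>ys \<in> {ys. enumerates S x ys}. lam_factors ys)"

definition green_poly :: "'v list \<Rightarrow> nat \<Rightarrow> 'v spoly \<Rightarrow> 'v spoly" where
  "green_poly ys p A = Poly_Mapping.mapp
     (\<lambda>m c. inverse (mu ys p (Poly_Mapping.lookup m R_var) (\<lambda>v. Poly_Mapping.lookup m (S_var v))) * c) A"

definition Ggr :: "'v \<Rightarrow> 'v list \<Rightarrow> 'v ralg \<Rightarrow> 'v ralg" where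
  "Ggr x ys = sector_op x ys
     (\<lambda>I A. yw ys I * scal x (green_poly ys (card I) A))
     (\<lambda>I B. xw x ys I * scal x (green_poly ys (card I) B))"

text \<open>The block matrix with rows \<open>(a, b)\<close> and \<open>(c, d)\<close>, acting on the column of the \<open>\<Y>\<close>- and
  \<open>\<X>\<close>-components.\<close>

definition block_op ::
  "'v \<Rightarrow> 'v list \<Rightarrow> ('v ralg \<Rightarrow> 'v ralg) \<Rightarrow> ('v ralg \<Rightarrow> 'v ralg) \<Rightarrow>
   ('v ralg \<Rightarrow> 'v ralg) \<Rightarrow> ('v ralg \<Rightarrow> 'v ralg) \<Rightarrow> 'v ralg \<Rightarrow> 'v ralg" where
  "block_op x ys a b c d z =
     (let u = projY x ys z; v = projX x ys z in (a u + b v) + (c u + d v))"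

definition Gop :: "'v \<Rightarrow> 'v list \<Rightarrow> 'v ralg \<Rightarrow> 'v ralg" where
  "Gop x ys = block_op x ys
     (Ggr x ys)                                      (\<lambda>_. 0)
     (\<lambda>u. - Ggr x ys (Nop x ys (Ggr x ys u)))        (Ggr x ys)"

definition Rloc :: "'v \<Rightarrow> 'v list \<Rightarrow> 'v ralg set" where
  "Rloc x ys = localize (Omega ys) (RB (insert x (set ys)))"

definition Yloc :: "'v \<Rightarrow> 'v list \<Rightarrow> 'v ralg set" where
  "Yloc x ys = localize (Omega ys) (sectorY x ys)"

definition Xloc :: "'v \<Rightarrow> 'v list \<Rightarrow> 'v ralg set" where
  "Xloc x ys = localize (Omega ys) (sectorX x ys)"


section \<open>Direct limit over finite sets of variables\<close>

text \<open>The operator that agrees with \<open>T ys\<close> on \<open>D ys\<close> for every finite \<open>Y\<close>.\<close>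

definition limit_op ::
  "'v set \<Rightarrow> 'v \<Rightarrow> ('v list \<Rightarrow> 'v ralg set) \<Rightarrow> ('v list \<Rightarrow> 'v ralg \<Rightarrow> 'v ralg) \<Rightarrow>
   'v ralg \<Rightarrow> 'v ralg" where
  "limit_op S x D T z = (THE w. \<exists>ys. enumerates S x ys \<and> z \<in> D ys \<and> w = T ys z)"

definition vder_lim :: "'v set \<Rightarrow> 'v \<Rightarrow> 'v ralg \<Rightarrow> 'v ralg" where
  "vder_lim S x = limit_op S x (\<lambda>ys. subalg UNIV (insert x (set ys))) (vder x)"

definition creation_lim :: "'v set \<Rightarrow> 'v \<Rightarrow> 'v ralg \<Rightarrow> 'v ralg" where
  "creation_lim S x = limit_op S x (\<lambda>ys. subalg UNIV (insert x (set ys))) (creation x)"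

definition Hop_lim :: "'v set \<Rightarrow> 'v \<Rightarrow> 'v ralg \<Rightarrow> 'v ralg" where
  "Hop_lim S x z = vder_lim S x (creation_lim S x z) + creation_lim S x (vder_lim S x z)"

definition Gop_lim :: "'v set \<Rightarrow> 'v \<Rightarrow> 'v ralg \<Rightarrow> 'v ralg" where
  "Gop_lim S x = limit_op S x (Rloc x) (Gop x)"

definition Rloc_lim :: "'v set \<Rightarrow> 'v \<Rightarrow> 'v ralg set" where
  "Rloc_lim S x = localize (Omega_lim S x) (RB S)"

definition inverse_on :: "'a set \<Rightarrow> ('a \<Rightarrow> 'a) \<Rightarrow> ('a \<Rightarrow> 'a) \<Rightarrow> bool" where
  "inverse_on M H G \<longleftrightarrow> H ` M \<subseteq> M \<and> G ` M \<subseteq> M \<and> (\<forall>z \<in> M. H (G z) = z \<and> G (H z) = z)"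

end

theory Submission
  imports Defs
begin

text \<open>Left multiplication by a vector splits into an exterior multiplication and a contraction, half the
  sum and half the difference of left and signed right multiplication. The exterior multiplications
  anticommute, so iterating them gives the antisymmetrized product, and products of wedges reduce to
  wedges. Independence of the wedges over the scalars comes from a representation: a vector \<open>v\<close> acts on
  alternating functions of lists of vectors by inserting \<open>v\<close> and adding half the exterior product with
  the covector of the generic symmetric form.

  On a basis element the component of \<open>(x \<and> y\<^sub>I) \<partial>A\<close> along \<open>y\<^sub>I\<close> is the contraction of \<open>x\<close> against the
  vectors in \<open>\<partial>A\<close>, which is the Euler operator \<open>Esc\<close> up to sign. Hence \<open>Hop\<close> is the sum of a diagonal
  operator with eigenvalues \<open>mu\<close> on monomials and of \<open>Nop\<close>, which maps \<open>\<Y>\<close> into \<open>\<X>\<close> and squares to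
  zero. No eigenvalue vanishes, because its numerator has constant term \<open>1\<close> in \<open>Q\<close>, so the operator is
  inverted as a triangular block matrix. All operators are determined by their values on wedges of
  arbitrary lists times scalars, which do not involve the enumeration; this gives compatibility and the
  limit.\<close>

text \<open>No grading of the radial algebra is constructed: \<open>ext\<close> and
  \<open>ctr\<close> depend only on a parity, which is passed along as the length of a list. The
  obstacle is independence. The defining relations yield a spanning set only, while every operator
  is given through coordinates that are a definite description, so no operator can be evaluated
  before the wedges are known to be independent. The representation therefore has the formal
  polynomials themselves as values: an evaluated scalar then acts as multiplication by the
  polynomial that it came from. It descends to the quotient only on alternating functions, because
  two insertions need not anticommute on other functions. Signs of reorderings are never computed.
  It is enough that a wedge and its product with \<open>x\<close> change by the same sign, for an
  operator that is odd in both together then takes the same form on every ordering. Spans are formed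
  over an arbitrary ring between \<open>BB\<close> and the field. The whole field is where the
  operators live, and the localized ring is where they are shown to be inverse to each
  other.\<close>

lemma poly_mapping_add_induct [case_names single add]:
  fixes p :: "'a \<Rightarrow>\<^sub>0 'b::comm_monoid_add"
  assumes single: "\<And>w c. P (Poly_Mapping.single w c)"
    and add: "\<And>p p'. P p \<Longrightarrow> P p' \<Longrightarrow> P (p + p')"
  shows "P p"
proof (induction p rule: update_induct)
  case const
  then show ?case using single[of undefined 0] by simp
next
  case (update f a b)
  have "Poly_Mapping.update a b f = f + Poly_Mapping.single a b"
    using update by (intro poly_mapping_eqI)
      (auto simp: lookup_update lookup_add lookup_single when_def in_keys_iff)
  then show ?case using add update single by simp
qed

lemma single_VWord_Cons:
  "Poly_Mapping.single (VWord (v # us)) c = fgen v * Poly_Mapping.single (VWord us) (c::'k::comm_ring_1)"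
  by (simp add: fgen_def mult_single)

lemma single_VWord_Nil: "Poly_Mapping.single (VWord []) c = Poly_Mapping.single 0 c"
  by (simp add: zero_vword_def)

section \<open>The radial algebra\<close>

lemma cst_0 [simp]: "cst 0 = 0"
  by transfer (simp add: radial_rel_def radial_ideal.zero)

lemma cst_1 [simp]: "cst 1 = 1"
  by transfer (simp add: radial_rel_def radial_ideal.zero)

lemma cst_add: "cst (a + b) = cst a + cst b"
  by transfer (simp add: radial_rel_def radial_ideal.zero single_add)

lemma cst_mult: "cst (a * b) = cst a * cst b"
  by transfer (simp add: radial_rel_def radial_ideal.zero mult_single)

lemma cst_uminus: "cst (- a) = - cst a"
  by transfer (simp add: radial_rel_def radial_ideal.zero single_uminus)

lemma cst_of_nat: "cst (of_nat n) = of_nat n"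
  by (induction n) (simp_all add: cst_add)

lemma cst_numeral: "cst (numeral n) = numeral n"
  using cst_of_nat[of "numeral n"] by simp

lemma cst_neg1_power: "cst ((- 1) ^ n) = (- 1) ^ n"
  by (induction n) (simp_all add: cst_uminus)

lemma cst_central: "cst c * a = a * cst c"
proof transfer
  fix c :: "'k::comm_ring_1" and a :: "('v, 'k) freealg"
  have "Poly_Mapping.single 0 c * a = a * Poly_Mapping.single 0 c"
    by (induction a rule: poly_mapping_add_induct)
       (simp_all add: mult_single mult.commute distrib_left distrib_right)
  then show "radial_rel (Poly_Mapping.single 0 c * a) (a * Poly_Mapping.single 0 c)"
    by (simp add: radial_rel_def radial_ideal.zero)
qed

lemma radial_induct [case_names cst gen add mult]:
  fixes z :: "('v, 'k::comm_ring_1) radial"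
  assumes "\<And>c. P (cst c)" "\<And>v. P (rgen v)"
    and "\<And>a b. P a \<Longrightarrow> P b \<Longrightarrow> P (a + b)" "\<And>a b. P a \<Longrightarrow> P b \<Longrightarrow> P (a * b)"
  shows "P z"
proof -
  have "P (abs_radial p)" for p
  proof (induction p rule: poly_mapping_add_induct)
    case (single w c)
    obtain us where "w = VWord us" by (cases w)
    moreover have "P (abs_radial (Poly_Mapping.single (VWord us) c))"
    proof (induction us)
      case Nil
      then show ?case using assms(1)[of c] by (simp add: single_VWord_Nil cst.abs_eq)
    next
      case (Cons v us)
      then show ?case using assms(4)[OF assms(2)[of v] Cons]
        by (simp add: single_VWord_Cons times_radial.abs_eq rgen.abs_eq)
    qed
    ultimately show ?case by simp
  next
    case (add p p')
    then show ?case using assms(3) by (simp flip: plus_radial.abs_eq)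
  qed
  then show ?thesis by (metis Quotient_radial Quotient_abs_rep)
qed

section \<open>Central elements\<close>

definition central :: "'a::ring_1 \<Rightarrow> bool" where
  "central a \<longleftrightarrow> (\<forall>b. a * b = b * a)"

lemma centralD: "central a \<Longrightarrow> b * a = a * b"
  by (simp add: central_def)

lemma central_left_commute: "central a \<Longrightarrow> b * (a * c) = a * (b * c)"
  by (metis central_def mult.assoc)

lemma central_cst [simp]: "central (cst c)"
  by (simp add: central_def cst_central)

lemma central_0 [simp]: "central 0" and central_1 [simp]: "central 1"
  by (simp_all add: central_def)

lemma central_add: "central a \<Longrightarrow> central b \<Longrightarrow> central (a + b)"
  by (simp add: central_def distrib_left distrib_right)

lemma central_mult: "central a \<Longrightarrow> central b \<Longrightarrow> central (a * b)"
  unfolding central_def by (metis mult.assoc)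

lemma central_power: "central a \<Longrightarrow> central (a ^ n)"
  by (induction n) (simp_all add: central_mult)

lemma central_sum: "(\<And>i. i \<in> I \<Longrightarrow> central (f i)) \<Longrightarrow> central (sum f I)"
  by (induction I rule: infinite_finite_induct) (simp_all add: central_add)

text \<open>The relations give this against generators only; what commutes with a fixed element is a
  subalgebra, so induction over the algebra reaches the rest.\<close>

lemma central_anticomm [simp]: "central (anticomm (rgen u) (rgen v))"
  unfolding central_def
proof
  fix a
  show "anticomm (rgen u) (rgen v) * a = a * anticomm (rgen u) (rgen v)"
  proof (induction a rule: radial_induct)
    case (cst c)
    show ?case by (simp add: cst_central)
  next
    case (gen w)
    show ?case using radial_relation[of u v w] by (simp add: comm_def)
  next
    case (add a b)
    then show ?case by (simp add: distrib_left distrib_right)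
  next
    case (mult a b)
    then show ?case by (metis mult.assoc)
  qed
qed

lemmas anticomm_commutes = central_anticomm[unfolded central_def anticomm_def, rule_format]

text \<open>Left exterior multiplication and twice the contraction by \<open>v\<close>, on elements of parity \<open>n\<close>.\<close>

definition ext :: "nat \<Rightarrow> 'v \<Rightarrow> 'v ralg \<Rightarrow> 'v ralg" where
  "ext n v a = cst (1 / 2) * (rgen v * a + (- 1) ^ n * a * rgen v)"

definition ctr :: "nat \<Rightarrow> 'v \<Rightarrow> 'v ralg \<Rightarrow> 'v ralg" where
  "ctr n v a = rgen v * a - (- 1) ^ n * a * rgen v"

lemma cst_half_twice: "cst (1 / 2) * a + cst (1 / 2) * a = (a :: 'v ralg)"
proof -
  have "cst (1 / 2) * a + cst (1 / 2) * a = cst (1/2 + 1/2 :: qfield) * a"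
    by (simp only: cst_add distrib_right)
  also have "(1/2 + 1/2 :: qfield) = 1"
    by (simp add: field_simps)
  finally show ?thesis by simp
qed

lemma half_eqI: "a + a = b \<Longrightarrow> cst (1 / 2) * b = (a :: 'v ralg)"
  by (metis cst_half_twice distrib_left)

lemma double_cancel: "a + a = b + b \<Longrightarrow> a = (b :: 'v ralg)"
  by (metis half_eqI)

lemma neg1_power_cases:
  obtains "(- 1) ^ n = (1 :: 'a::ring_1)" "even n" | "(- 1) ^ n = (- 1 :: 'a)" "odd n"
  by (cases "even n") auto

lemma ext_add: "ext n v (a + b) = ext n v a + ext n v b"
  by (simp add: ext_def algebra_simps)

lemma ext_0 [simp]: "ext n v 0 = 0"
  by (simp add: ext_def)

lemma ext_minus: "ext n v (- a) = - ext n v a"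
  using ext_add[of n v a "- a"] by (simp add: eq_neg_iff_add_eq_0 add.commute)

lemma ext_sum: "ext n v (sum f I) = (\<Sum>i\<in>I. ext n v (f i))"
  by (induction I rule: infinite_finite_induct) (simp_all add: ext_add)

lemma ext_central: "central s \<Longrightarrow> ext n v (s * a) = s * ext n v a"
  by (cases n rule: neg1_power_cases)
     (simp_all add: ext_def distrib_left right_diff_distrib mult.assoc central_left_commute[of s])

lemma left_mult_ext_ctr: "rgen v * a = ext n v a + cst (1 / 2) * ctr n v a"
  using cst_half_twice[of "rgen v * a"] by (simp add: ext_def ctr_def algebra_simps)

lemma right_mult_ext_ctr: "a * rgen v = (- 1) ^ n * (ext n v a - cst (1 / 2) * ctr n v a)"
  using cst_half_twice[of "a * rgen v"]
  by (cases n rule: neg1_power_cases) (simp_all add: ext_def ctr_def algebra_simps)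

text \<open>The sign changes between the parities \<open>n\<close> and \<open>Suc n\<close>, so in
  the sum of both orders the terms with \<open>a\<close> in the middle cancel. What remains is a
  quarter of the commutator of \<open>a\<close> with the anticommutator of \<open>u\<close> and
  \<open>v\<close>, which is central.\<close>

lemma ext_ext: "ext (Suc n) u (ext n v a) = - ext (Suc n) v (ext n u a)"
proof -
  have E: "ext (Suc n) u (ext n v a) = cst (1/2) * (cst (1/2) *
      (rgen u * (rgen v * a + (- 1) ^ n * a * rgen v) - (- 1) ^ n * (rgen v * a + (- 1) ^ n * a * rgen v) * rgen u))" for u v
    unfolding ext_def[of n v a] ext_central[OF central_cst] by (simp add: ext_def)
  have "ext (Suc n) u (ext n v a) + ext (Suc n) v (ext n u a) =
      cst (1/2) * (cst (1/2) * ((rgen u * rgen v + rgen v * rgen u) * a - a * (rgen u * rgen v + rgen v * rgen u)))"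
    unfolding E by (cases n rule: neg1_power_cases[where 'a = "'a ralg"]) (simp_all add: algebra_simps)
  also have "\<dots> = 0"
    by (simp only: anticomm_commutes[of u v a] diff_self mult_zero_right)
  finally show ?thesis by (simp only: eq_neg_iff_add_eq_0)
qed

lemma ext_self: "ext (Suc n) v (ext n v a) = 0"
  using iffD1[OF eq_neg_iff_add_eq_0 ext_ext[of n v v a]] by - (rule double_cancel, simp)

lemma ctr_central:
  assumes "central s"
  shows "ctr n v (s * a) = s * ctr n v a"
proof -
  have "rgen v * (s * a) = s * (rgen v * a)" "(- 1) ^ n * (s * a) * rgen v = s * ((- 1) ^ n * a * rgen v)"
    by (simp_all only: mult.assoc central_left_commute[OF assms])
  then show ?thesis by (simp only: ctr_def right_diff_distrib)
qed

text \<open>Contraction is an antiderivation. Since \<open>ctr\<close> is twice the contraction, the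
  pairing of the two vectors enters as the full anticommutator and not as half of it.\<close>

lemma ctr_ext: "ctr (Suc n) v (ext n u a) = anticomm (rgen u) (rgen v) * a - ext (Suc n) u (ctr n v a)"
proof -
  have E1: "ctr (Suc n) v (ext n u a) = cst (1/2) *
      (rgen v * (rgen u * a + (- 1) ^ n * a * rgen u) + (- 1) ^ n * (rgen u * a + (- 1) ^ n * a * rgen u) * rgen v)"
    unfolding ext_def[of n u a] ctr_central[OF central_cst] by (simp add: ctr_def)
  have E2: "ext (Suc n) u (ctr n v a) = cst (1/2) *
      (rgen u * (rgen v * a - (- 1) ^ n * a * rgen v) - (- 1) ^ n * (rgen v * a - (- 1) ^ n * a * rgen v) * rgen u)"
    by (simp add: ext_def ctr_def)
  define X :: "'a ralg" where "X = rgen u * rgen v + rgen v * rgen u"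
  have "ctr (Suc n) v (ext n u a) + ext (Suc n) u (ctr n v a) = cst (1/2) * (X * a + a * X)"
    unfolding E1 E2 X_def
    by (cases n rule: neg1_power_cases[where 'a = "'a ralg"]) (simp_all add: algebra_simps)
  also have "a * X = X * a"
    unfolding X_def by (rule anticomm_commutes[symmetric])
  also have "cst (1/2) * (X * a + X * a) = X * a"
    by (rule half_eqI) simp
  finally show ?thesis by (simp add: eq_diff_eq X_def anticomm_def)
qed

lemma ext_Suc_Suc [simp]: "ext (Suc (Suc n)) = ext n"
  by (simp add: fun_eq_iff ext_def)

text \<open>The wedge as iterated exterior multiplication. It is identified with the antisymmetrized
  product in \<open>wedge_eq_wdg\<close>; this recursive form is the one in which all later
  computations are done.\<close>

primrec wdg :: "'v list \<Rightarrow> 'v ralg" where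
  "wdg [] = 1"
| "wdg (v # us) = ext (length us) v (wdg us)"

lemma wdg_Cons_Cons_swap: "wdg (u # v # us) = - wdg (v # u # us)"
  using ext_ext[of "length us" u v] by simp

lemma wdg_middle_even: "even (length as) \<Longrightarrow> wdg (as @ v # bs) = wdg (v # as @ bs)"
  and wdg_middle_odd: "odd (length as) \<Longrightarrow> wdg (as @ v # bs) = - wdg (v # as @ bs)"
proof (induction as)
  case (Cons t as)
  {
    case 1
    then have "wdg ((t # as) @ v # bs) = - wdg (t # v # as @ bs)"
      using Cons.IH by (simp add: ext_minus)
    then show ?case by (simp only: wdg_Cons_Cons_swap[of t v] append_Cons minus_minus)
  next
    case 2
    then have "wdg ((t # as) @ v # bs) = wdg (t # v # as @ bs)"
      using Cons.IH by simp
    then show ?case by (simp only: wdg_Cons_Cons_swap[of t v] append_Cons)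
  }
qed simp_all

lemma wdg_middle: "wdg (as @ v # bs) = (- 1) ^ length as * wdg (v # as @ bs)"
  by (cases "even (length as)") (simp_all add: wdg_middle_even wdg_middle_odd del: wdg.simps)

lemma wdg_Cons_middle: "wdg (w # as @ v # bs) = (- 1) ^ length as * wdg (w # v # as @ bs)"
  using wdg_middle[of "w # as" v bs] wdg_Cons_Cons_swap[of w v "as @ bs"]
  by (simp del: wdg.simps)

lemma wdg_exchange: "b < length us \<Longrightarrow> wdg (us ! b # us[b := u]) = - wdg (u # us)"
proof -
  assume b: "b < length us"
  define as bs w where "as = take b us" and "bs = drop (Suc b) us" and "w = us ! b"
  have us: "us = as @ w # bs" and upd: "us[b := u] = as @ u # bs"
    unfolding as_def bs_def w_def using b by (simp_all add: id_take_nth_drop upd_conv_take_nth_drop)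
  have "wdg (us ! b # us[b := u]) = (- 1) ^ length as * wdg (w # u # as @ bs)"
    unfolding upd w_def[symmetric] wdg_Cons_middle ..
  also have "\<dots> = - ((- 1) ^ length as * wdg (u # w # as @ bs))"
    unfolding wdg_Cons_Cons_swap[of w u "as @ bs"] by simp
  also have "(- 1) ^ length as * wdg (u # w # as @ bs) = wdg (u # us)"
    by (subst us) (simp only: wdg_Cons_middle)
  finally show ?thesis .
qed

lemma wdg_not_distinct: "\<not> distinct us \<Longrightarrow> wdg us = 0"
proof (induction us)
  case (Cons v us)
  show ?case
  proof (cases "v \<in> set us")
    case True
    then obtain as bs where "us = as @ v # bs" by (auto dest: split_list)
    then show ?thesis by (simp only: wdg_Cons_middle) (simp add: ext_self)
  next
    case False
    then show ?thesis using Cons by simp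
  qed
qed simp

text \<open>The two alternatives record that the sign is shared by the wedge and its product with
  any \<open>x\<close>, so that a reordering affects the two sectors in the same way.\<close>

lemma wdg_perm:
  assumes "mset us = mset vs"
  obtains "wdg us = wdg vs" "\<And>x. wdg (x # us) = wdg (x # vs)"
  | "wdg us = - wdg vs" "\<And>x. wdg (x # us) = - wdg (x # vs)"
proof -
  have "wdg us = wdg vs \<or> wdg us = - wdg vs"
    using assms
  proof (induction vs arbitrary: us)
    case (Cons v vs)
    then have "v \<in> set us" by (metis list.set_intros(1) mset_eq_setD)
    then obtain as bs where us: "us = as @ v # bs" by (auto dest: split_list)
    then have m: "mset (as @ bs) = mset vs" using Cons.prems by simp
    have len: "length (as @ bs) = length vs" using mset_eq_length[OF m] .
    have "wdg (v # as @ bs) = wdg (v # vs) \<or> wdg (v # as @ bs) = - wdg (v # vs)"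
      using Cons.IH[OF m] by (auto simp only: wdg.simps len ext_minus)
    then show ?case
      unfolding us by (cases "even (length as)") (auto simp: wdg_middle_even wdg_middle_odd simp del: wdg.simps)
  qed simp
  moreover have "length us = length vs" using assms by (metis mset_eq_length)
  ultimately show ?thesis using that by (auto simp: ext_minus)
qed

text \<open>Contracting with \<open>w\<close> and then multiplying by \<open>u\<close> is an even
  derivation of the exterior algebra which sends a vector \<open>t\<close> to its pairing with
  \<open>w\<close> times \<open>u\<close>; the sum is its Leibniz rule.\<close>

lemma ext_ctr_wdg:
  "ext (Suc (length us)) u (ctr (length us) w (wdg us)) =
     (\<Sum>k<length us. anticomm (rgen (us ! k)) (rgen w) * wdg (us[k := u]))"
proof (induction us)
  case Nil
  then show ?case by (simp add: ctr_def)
next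
  case (Cons t ts)
  define n W where "n = length ts" "W = wdg ts"
  have "ext (Suc (Suc n)) u (ctr (Suc n) w (ext n t W)) =
      ext (Suc (Suc n)) u (anticomm (rgen t) (rgen w) * W) - ext (Suc (Suc n)) u (ext (Suc n) t (ctr n w W))"
    unfolding ctr_ext diff_conv_add_uminus ext_add ext_minus ..
  also have "ext (Suc (Suc n)) u (anticomm (rgen t) (rgen w) * W) =
      anticomm (rgen t) (rgen w) * wdg (u # ts)"
    by (simp add: ext_central n_W_def)
  also have "ext (Suc (Suc n)) u (ext (Suc n) t (ctr n w W)) =
      - ext (Suc (Suc n)) t (ext (Suc n) u (ctr n w W))"
    by (rule ext_ext)
  also have "ext (Suc n) u (ctr n w W) =
      (\<Sum>k<n. anticomm (rgen (ts ! k)) (rgen w) * wdg (ts[k := u]))"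
    using Cons by (simp add: n_W_def)
  also have "ext (Suc (Suc n)) t \<dots> =
      (\<Sum>k<n. anticomm (rgen (ts ! k)) (rgen w) * wdg (t # ts[k := u]))"
    by (simp add: ext_sum ext_central n_W_def)
  finally show ?case
    by (simp only: n_W_def length_Cons wdg.simps sum.lessThan_Suc_shift)
       (simp add: anticomm_commute)
qed

text \<open>In the inductive step the sum of pairings produced by \<open>ext_ctr_wdg\<close> occurs
  twice with opposite signs. The identity is what removes the contractions from the antisymmetrized
  product.\<close>

lemma ctr_wdg_exchange:
  "ctr (length us) u (wdg us) = (\<Sum>b<length us. ctr (length us) (us ! b) (wdg (us[b := u])))"
proof (induction us)
  case Nil
  then show ?case by (simp add: ctr_def)
next
  case (Cons w ws)
  define n W where "n = length ws" "W = wdg ws"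
  have *: "ctr (Suc n) (ws ! k) (wdg (w # ws[k := u])) =
      anticomm (rgen (ws ! k)) (rgen w) * wdg (ws[k := u])
      - ext (Suc n) w (ctr n (ws ! k) (wdg (ws[k := u])))" for k
    by (simp add: ctr_ext n_W_def anticomm_commute)
  have "(\<Sum>b<Suc n. ctr (Suc n) ((w # ws) ! b) (wdg ((w # ws)[b := u]))) =
      ctr (Suc n) w (wdg (u # ws)) + (\<Sum>k<n. ctr (Suc n) (ws ! k) (wdg (w # ws[k := u])))"
    by (simp add: sum.lessThan_Suc_shift del: sum.lessThan_Suc)
  also have "ctr (Suc n) w (wdg (u # ws)) = anticomm (rgen u) (rgen w) * W - ext (Suc n) u (ctr n w W)"
    by (simp add: ctr_ext n_W_def)
  also have "ext (Suc n) u (ctr n w W) = (\<Sum>k<n. anticomm (rgen (ws ! k)) (rgen w) * wdg (ws[k := u]))"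
    by (simp add: n_W_def ext_ctr_wdg)
  also have "(\<Sum>k<n. ctr (Suc n) (ws ! k) (wdg (w # ws[k := u]))) =
      (\<Sum>k<n. anticomm (rgen (ws ! k)) (rgen w) * wdg (ws[k := u])) - ext (Suc n) w (ctr n u W)"
    by (simp only: * sum_subtractf Cons[folded n_W_def] ext_sum)
  finally show ?case
    by (simp add: n_W_def ctr_ext anticomm_commute[of "rgen u"])
qed

lemma ctr_wdg:
  "ctr (length us) v (wdg us) =
     (\<Sum>k<length us. (- 1) ^ k * (anticomm (rgen (us ! k)) (rgen v) * wdg (take k us @ drop (Suc k) us)))"
proof (induction us)
  case Nil
  then show ?case by (simp add: ctr_def)
next
  case (Cons t ts)
  define n where "n = length ts"
  have *: "ext (Suc n) t ((- 1) ^ k * (anticomm (rgen (ts ! k)) (rgen v) * wdg (take k ts @ drop (Suc k) ts))) =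
      (- 1) ^ k * (anticomm (rgen (ts ! k)) (rgen v) * wdg (t # take k ts @ drop (Suc k) ts))"
    if "k < n" for k
  proof -
    \<comment> \<open>Deleting an entry leaves length \<open>n'\<close>, two below
      \<open>Suc n\<close>; \<open>ext\<close> sees its parity only modulo two, so it still prepends
      \<open>t\<close> to the wedge.\<close>
    obtain n' where n': "n = Suc n'" using \<open>k < n\<close> by (cases n) simp_all
    then have "length (take k ts @ drop (Suc k) ts) = n'" "Suc n = Suc (Suc n')"
      using \<open>k < n\<close> by (auto simp: n_def)
    then show ?thesis
      by (cases k rule: neg1_power_cases[where 'a = "'a ralg"]) (simp_all add: ext_minus ext_central)
  qed
  have "ext (Suc n) t (ctr n v (wdg ts)) =
      (\<Sum>k<n. (- 1) ^ k * (anticomm (rgen (ts ! k)) (rgen v) * wdg (t # take k ts @ drop (Suc k) ts)))"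
    unfolding Cons[folded n_def] ext_sum by (rule sum.cong[OF refl], rule *) simp
  then show ?case
    by (simp add: sum.lessThan_Suc_shift ctr_ext n_def[symmetric] sum_negf del: sum.lessThan_Suc)
qed

section \<open>Comparison with the antisymmetrized product\<close>

definition antisymmetrize :: "'v list \<Rightarrow> 'v ralg" where
  "antisymmetrize us = (\<Sum>\<pi> | \<pi> permutes {..<length us}.
        of_int (sign \<pi>) * prod_list (map (\<lambda>i. rgen (us ! \<pi> i)) [0..<length us]))"

text \<open>Splitting a permutation by the image of the last position.\<close>

lemma antisymmetrize_snoc:
  "antisymmetrize (us @ [u]) = antisymmetrize us * rgen u - (\<Sum>b<length us. antisymmetrize (us[b := u]) * rgen (us ! b))"
proof -
  define n where "n = length us"
  define F where "F \<pi> = (of_int (sign \<pi>) * prod_list (map (\<lambda>i. rgen ((us @ [u]) ! \<pi> i)) [0..<Suc n]) :: 'a ralg)" for \<pi>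
  have "antisymmetrize (us @ [u]) = sum F {\<pi>. \<pi> permutes insert n {..<n}}"
    by (simp add: antisymmetrize_def F_def n_def lessThan_Suc)
  also have "\<dots> = (\<Sum>b\<in>insert n {..<n}. \<Sum>q | q permutes {..<n}. F (transpose n b \<circ> q))"
    by (rule sum_over_permutations_insert) auto
  also have "\<dots> = (\<Sum>q | q permutes {..<n}. F q) + (\<Sum>b<n. \<Sum>q | q permutes {..<n}. F (transpose n b \<circ> q))"
    by simp
  also have "(\<Sum>q | q permutes {..<n}. F q) = antisymmetrize us * rgen u"
    unfolding antisymmetrize_def sum_distrib_right n_def[symmetric]
  proof (rule sum.cong[OF refl])
    fix q assume "q \<in> {q. q permutes {..<n}}"
    then have q: "q permutes {..<n}" by simp
    have "q n = n" using q by (simp add: permutes_not_in)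
    then have 1: "F q = of_int (sign q) * (prod_list (map (\<lambda>i. rgen ((us @ [u]) ! q i)) [0..<n]) * rgen u)"
      by (simp add: F_def n_def)
    have "q i < n" if "i < n" for i using permutes_in_image[OF q, of i] that by simp
    then have 2: "map (\<lambda>i. rgen ((us @ [u]) ! q i)) [0..<n] = map (\<lambda>i. rgen (us ! q i)) [0..<n]"
      by (intro map_cong) (auto simp: nth_append n_def)
    show "F q = of_int (sign q) * prod_list (map (\<lambda>i. rgen (us ! q i)) [0..<n]) * rgen u"
      by (simp only: 1 2 mult.assoc)
  qed
  also have "(\<Sum>b<n. \<Sum>q | q permutes {..<n}. F (transpose n b \<circ> q)) =
      (\<Sum>b<n. - (antisymmetrize (us[b := u]) * rgen (us ! b)))"
    unfolding antisymmetrize_def sum_distrib_right n_def[symmetric] length_list_update sum_negf[symmetric]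
  proof (intro sum.cong[OF refl])
    fix b q assume b: "b \<in> {..<n}" and "q \<in> {q. q permutes {..<n}}"
    then have q: "q permutes {..<n}" by simp
    have "q n = n" using q by (simp add: permutes_not_in)
    then have 1: "(us @ [u]) ! ((transpose n b \<circ> q) n) = us ! b"
      using b by (simp add: nth_append n_def)
    have 2: "(us @ [u]) ! ((transpose n b \<circ> q) i) = us[b := u] ! q i" if "i < n" for i
      using permutes_in_image[OF q, of i] that b
      by (auto simp: nth_append n_def transpose_def nth_list_update)
    have "permutation q" using q by (auto simp: permutation_permutes)
    then have 3: "sign (transpose n b \<circ> q) = - sign q"
      using b by (simp add: sign_compose permutation_swap_id sign_swap_id)
    have 4: "map (\<lambda>i. rgen ((us @ [u]) ! ((transpose n b \<circ> q) i))) [0..<n] = map (\<lambda>i. rgen (us[b := u] ! q i)) [0..<n]"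
      by (rule map_cong) (use 2 in auto)
    have "F (transpose n b \<circ> q) = of_int (- sign q) * (prod_list (map (\<lambda>i. rgen (us[b := u] ! q i)) [0..<n]) * rgen (us ! b))"
      unfolding F_def 3 4[symmetric] using 1 by simp
    then show "F (transpose n b \<circ> q) = - (of_int (sign q) * prod_list (map (\<lambda>i. rgen (us[b := u] ! q i)) [0..<n]) * rgen (us ! b))"
      by (simp add: mult.assoc)
  qed
  finally show ?thesis by (simp add: n_def sum_negf)
qed

text \<open>By \<open>antisymmetrize_snoc\<close> only products of a shorter wedge with a vector on
  the right occur. Their exterior parts are all the same wedge up to sign, and their contraction
  parts cancel by \<open>ctr_wdg_exchange\<close>.\<close>

lemma antisymmetrize_eq_wdg: "antisymmetrize us = of_nat (fact (length us)) * wdg us"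
proof (induction "length us" arbitrary: us)
  case 0
  then show ?case by (simp add: antisymmetrize_def)
next
  case (Suc n)
  then obtain vs u where us: "us = vs @ [u]" and n: "n = length vs"
    by (metis append_butlast_last_id length_append_singleton length_0_conv nat.distinct(1) nat.inject)
  have IH: "antisymmetrize ws = of_nat (fact n) * wdg ws" if "length ws = n" for ws :: "'a list"
    using Suc(1)[of ws] that by simp
  \<comment> \<open>Up to the factor \<open>(- 1) ^ n\<close> this is the product of
    \<open>wdg b\<close> with the vector \<open>a\<close> on the right.\<close>
  define R where "R a b = ext n a (wdg b) - cst (1 / 2) * ctr n a (wdg b)" for a and b :: "'a list"
  have "antisymmetrize us = of_nat (fact n) * (wdg vs * rgen u - (\<Sum>b<n. wdg (vs[b := u]) * rgen (vs ! b)))"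
    unfolding us antisymmetrize_snoc n[symmetric]
    by (simp add: IH n[symmetric] right_diff_distrib sum_distrib_left mult.assoc)
  also have "\<dots> = of_nat (fact n) * ((- 1) ^ n * (R u vs - (\<Sum>b<n. R (vs ! b) (vs[b := u]))))"
    by (simp add: right_mult_ext_ctr[where n = n] R_def right_diff_distrib sum_distrib_left)
  also have "R u vs - (\<Sum>b<n. R (vs ! b) (vs[b := u])) =
      wdg (u # vs) - (\<Sum>b<n. wdg (vs ! b # vs[b := u]))
      - cst (1 / 2) * (ctr n u (wdg vs) - (\<Sum>b<n. ctr n (vs ! b) (wdg (vs[b := u]))))"
    by (simp add: R_def n[symmetric] sum_subtractf sum_distrib_left right_diff_distrib algebra_simps)
  also have "(\<Sum>b<n. wdg (vs ! b # vs[b := u])) = (\<Sum>b<n. - wdg (u # vs))"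
    by (rule sum.cong[OF refl], rule wdg_exchange) (simp add: n)
  \<comment> \<open>Together with the first term there are \<open>Suc n\<close> copies of
    \<open>wdg (u # vs)\<close>, and the sign moves \<open>u\<close> back to the end.\<close>
  also have "(- 1) ^ n * (wdg (u # vs) - (\<Sum>b<n. - wdg (u # vs))
      - cst (1 / 2) * (ctr n u (wdg vs) - (\<Sum>b<n. ctr n (vs ! b) (wdg (vs[b := u]))))) =
      of_nat (Suc n) * wdg us"
    using ctr_wdg_exchange[of vs u] wdg_middle[of vs u "[]"]
    by (cases n rule: neg1_power_cases[where 'a = "'a ralg"])
       (simp_all add: us n[symmetric] distrib_right algebra_simps del: wdg.simps)
  finally show ?case
    by (simp only: Suc(2)[symmetric] mult.assoc[symmetric] fact_Suc of_nat_mult mult.commute[of "Suc n"] of_nat_id)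
qed

lemma wedge_eq_wdg: "wedge us = wdg us"
proof -
  have "cst (inverse (of_nat (fact (length us)))) * (of_nat (fact (length us)) :: 'a ralg) =
      cst (inverse (of_nat (fact (length us))) * of_nat (fact (length us)))"
    by (simp only: cst_mult cst_of_nat)
  also have "\<dots> = 1" by simp
  finally show ?thesis
    unfolding wedge_def antisymmetrize_def[symmetric] antisymmetrize_eq_wdg mult.assoc[symmetric] by simp
qed

section \<open>Coefficients\<close>

text \<open>Subrings of the field that contain \<open>BB\<close>; negatives come from
  \<open>- 1\<close> in \<open>BB\<close>. The instances are \<open>BB\<close>, its localizations
  and the whole field, so that each argument about spans is carried out once.\<close>

definition coeff_ring :: "qfield set \<Rightarrow> bool" where
  "coeff_ring K \<longleftrightarrow> BB \<subseteq> K \<and> (\<forall>a\<in>K. \<forall>b\<in>K. a + b \<in> K \<and> a * b \<in> K)"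

lemma coeff_ring_BB: "coeff_ring BB" and coeff_ring_UNIV: "coeff_ring UNIV"
  by (auto simp: coeff_ring_def BB.add BB.mult)

lemma coeff_ring_of_BB: "coeff_ring K \<Longrightarrow> c \<in> BB \<Longrightarrow> c \<in> K"
  and coeff_ring_add: "coeff_ring K \<Longrightarrow> a \<in> K \<Longrightarrow> b \<in> K \<Longrightarrow> a + b \<in> K"
  and coeff_ring_mult: "coeff_ring K \<Longrightarrow> a \<in> K \<Longrightarrow> b \<in> K \<Longrightarrow> a * b \<in> K"
  by (auto simp: coeff_ring_def)

lemma BB_0: "0 \<in> BB" and BB_1: "1 \<in> BB" and BB_neg1: "- 1 \<in> BB" and BB_half: "1 / 2 \<in> BB"
proof -
  have "rconst 0 = 0" and 1: "rconst 1 = 1" and "rconst (- 1) = - 1"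
    by (simp_all add: rconst_def Zero_fract_def One_fract_def one_pCons)
  moreover have "rconst (1 / 2) + rconst (1 / 2) = rconst 1"
    by (simp add: rconst_def)
  then have "rconst (1 / 2) = 1 / 2" unfolding 1 by (simp add: field_simps)
  ultimately show "0 \<in> BB" "1 \<in> BB" "- 1 \<in> BB" "1 / 2 \<in> BB"
    using BB.real by metis+
qed

lemma coeff_ring_0: "coeff_ring K \<Longrightarrow> 0 \<in> K" and coeff_ring_1: "coeff_ring K \<Longrightarrow> 1 \<in> K"
  by (auto simp: coeff_ring_def BB_0 BB_1)

lemma coeff_ring_sum: "coeff_ring K \<Longrightarrow> (\<And>i. i \<in> I \<Longrightarrow> f i \<in> K) \<Longrightarrow> sum f I \<in> K"
  by (induction I rule: infinite_finite_induct) (auto simp: coeff_ring_0 coeff_ring_add)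

lemma coeff_ring_power: "coeff_ring K \<Longrightarrow> a \<in> K \<Longrightarrow> a ^ n \<in> K"
  by (induction n) (auto simp: coeff_ring_1 coeff_ring_mult)

text \<open>As finite sums these quotients lie in every coefficient ring containing
  \<open>P\<close>, without an inverse of \<open>1 - P\<close>; for \<open>P = qq ^ 2\<close> no
  such inverse is among the generators of \<open>BB\<close>.\<close>

lemma geometric_quotient: "P \<noteq> 1 \<Longrightarrow> (1 - P ^ n) / (1 - P) = (\<Sum>i<n. P ^ i)" for P :: qfield
  by (simp add: one_diff_power_eq)

lemma BB_q_power: "qq ^ n \<in> BB"
  by (rule coeff_ring_power[OF coeff_ring_BB BB.q])

lemma Fract_power: "Fract p 1 ^ n = Fract (p ^ n) 1"
  by (induction n) (simp_all add: One_fract_def)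

lemma qq_power_eq: "qq ^ n = Fract [:[:0, 1:] ^ n:] 1"
  by (simp add: qq_def Fract_power poly_const_pow)

lemma qq_neq_0 [simp]: "qq \<noteq> 0"
  by (simp add: qq_def Zero_fract_def eq_fract)

lemma qq_power_neq_1: "n > 0 \<Longrightarrow> qq ^ n \<noteq> 1"
proof
  assume "n > 0" "qq ^ n = 1"
  then have "([:0, 1:] :: real poly) ^ n = 1"
    by (simp add: qq_power_eq One_fract_def eq_fract one_pCons)
  then have "poly (([:0, 1:] :: real poly) ^ n) 0 = 1" by simp
  with \<open>n > 0\<close> show False by (simp add: power_0_left)
qed

lemma qq_neq_1 [simp]: "qq \<noteq> 1" and qq2_neq_1 [simp]: "qq ^ 2 \<noteq> 1"
  using qq_power_neq_1[of 1] qq_power_neq_1[of 2] by simp_all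

lemma BB_geometric: "(1 - qq ^ n) / (1 - qq) \<in> BB" "(1 - (qq ^ 2) ^ n) / (1 - qq ^ 2) \<in> BB"
  using geometric_quotient[of qq n] geometric_quotient[of "qq ^ 2" n]
  by (simp_all add: coeff_ring_sum coeff_ring_BB BB_q_power flip: power_mult)

lemma qint_of_nat: "qint (int n) = (1 - qq ^ n) / (1 - qq)"
  by (simp add: qint_def power_int_of_nat)

lemma BB_qint: "qint (int n) \<in> BB"
  by (simp add: qint_of_nat BB_geometric)

lemma BB_q_powi: "qq powi (- int p) \<in> BB"
  by (simp add: power_int_minus power_int_of_nat coeff_ring_power[OF coeff_ring_BB BB.q_inv] flip: power_inverse)

lemma BB_qmpow: "qmpow (- int p) \<in> BB"
  by (simp add: qmpow_def BB.mult BB.Q BB_q_powi)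

lemma BB_qmint: "qmint (- int p) \<in> BB"
proof -
  have "qmint (- int p) = (1 + (- 1) * (QQ * qq powi (- int p))) * inverse (1 - qq)"
    by (simp add: qmint_def field_simps)
  then show ?thesis
    by (simp only: BB.add BB.mult BB_1 BB_neg1 BB.Q BB_q_powi BB.one_minus_q_inv)
qed

lemma BB_sign: "(- 1) ^ p \<in> BB"
  by (rule coeff_ring_power[OF coeff_ring_BB BB_neg1])

lemma BB_lam: "lam ys p a \<beta> \<in> BB"
  unfolding lam_def using BB_qint[of "2 * a"]
  by (auto intro!: BB.add BB.mult BB_qmint BB_qmpow BB_q_power coeff_ring_sum[OF coeff_ring_BB] BB_qint)

text \<open>The numerator of \<open>lam\<close> has constant term \<open>1\<close> as a polynomial in \<open>Q\<close>, so no diagonal factor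
  vanishes.\<close>

lemma lam_neq_0: "lam ys p a \<beta> \<noteq> 0"
proof
  assume "lam ys p a \<beta> = 0"
  \<comment> \<open>Chosen so that \<open>(1 - qq) * lam\<close> becomes
    \<open>1 - QQ * qq powi (- int p) * D\<close>, with \<open>D\<close> free of
    \<open>QQ\<close>.\<close>
  define D where "D = 1 - (1 - qq ^ (2 * a)) - qq ^ (2 * a) * (\<Sum>v\<in>set ys. (1 - qq ^ \<beta> v))"
  have q: "qint (2 * int a) = (1 - qq ^ (2 * a)) / (1 - qq)"
    using qint_of_nat[of "2 * a"] by simp
  have "0 = (1 - qq) * lam ys p a \<beta>" using \<open>lam ys p a \<beta> = 0\<close> by simp
  also have "\<dots> = 1 - QQ * qq powi (- int p) * D"
  proof -
    have "d * (X / d + Y * (U / d + V * (S / d))) = X + Y * (U + V * S)" if "d \<noteq> 0" for d X Y U V S :: qfield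
      using that by (simp add: divide_simps)
    then have *: "(1 - qq) * (X / (1 - qq) + Y * (U / (1 - qq) + V * (S / (1 - qq)))) = X + Y * (U + V * S)" for X Y U V S
      by simp
    show ?thesis
      unfolding lam_def q qint_of_nat qmint_def qmpow_def D_def sum_divide_distrib[symmetric] *
      by (simp add: algebra_simps)
  qed
  finally have "qq ^ p = QQ * D"
    by (simp add: power_int_minus power_int_of_nat field_simps)
  moreover have "\<exists>d. D = Fract [:d:] 1"
  proof -
    \<comment> \<open>The image of the polynomials in \<open>qq\<close> alone. Once \<open>D\<close>
      lies in it, the two sides of \<open>qq ^ p = QQ * D\<close> have different constant terms in
      \<open>QQ\<close>.\<close>
    define J :: "qfield set" where "J = range (\<lambda>d. Fract [:d:] 1)"
    have one: "1 \<in> J" by (auto simp: J_def One_fract_def one_pCons intro!: image_eqI[of _ _ 1])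
    have zero: "0 \<in> J" by (auto simp: J_def Zero_fract_def intro!: image_eqI[of _ _ 0])
    have q: "qq ^ n \<in> J" for n by (auto simp: J_def qq_power_eq)
    have diff: "u - v \<in> J" if uv: "u \<in> J" "v \<in> J" for u v
    proof -
      from uv obtain c d where "u = Fract [:c:] 1" "v = Fract [:d:] 1" by (auto simp: J_def)
      then have "u - v = Fract [:c - d:] 1" by simp
      then show ?thesis by (auto simp: J_def)
    qed
    have mult: "u * v \<in> J" if uv: "u \<in> J" "v \<in> J" for u v
    proof -
      from uv obtain c d where "u = Fract [:c:] 1" "v = Fract [:d:] 1" by (auto simp: J_def)
      then have "u * v = Fract [:c * d:] 1" by (simp add: mult.commute)
      then show ?thesis by (auto simp: J_def)
    qed
    have add: "u + v \<in> J" if "u \<in> J" "v \<in> J" for u v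
      using diff[OF that(1) diff[OF zero that(2)]] by simp
    have "(\<Sum>v\<in>V. (1 - qq ^ \<beta> v)) \<in> J" for V
      by (induction V rule: infinite_finite_induct) (auto intro!: add diff one q zero)
    then have "D \<in> J" unfolding D_def by (intro diff mult one q)
    then show ?thesis by (auto simp: J_def)
  qed
  ultimately obtain d where "Fract [:[:0, 1:] ^ p:] 1 = Fract [:0, 1:] 1 * Fract [:d:] (1 :: real poly poly)"
    by (auto simp: qq_power_eq QQ_def)
  then have "([:0, 1:] :: real poly) ^ p = 0"
    by (simp add: eq_fract)
  then show False by simp
qed

lemma mu_neq_0: "mu ys p a \<beta> \<noteq> 0"
  by (simp add: mu_def lam_neq_0)

section \<open>Polynomials in the scalar variables\<close>

lemma poly_mapping_sum_single:
  "p = (\<Sum>m\<in>Poly_Mapping.keys p. Poly_Mapping.single m (Poly_Mapping.lookup p m))"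
  by (rule poly_mapping_eqI) (auto simp: lookup_sum lookup_single when_def in_keys_iff)

lemma spolysI:
  assumes "\<And>m. Poly_Mapping.lookup A m \<noteq> 0 \<Longrightarrow> Poly_Mapping.lookup A m \<in> K \<and> Poly_Mapping.keys m \<subseteq> svars Y"
  shows "A \<in> spolys K Y"
  using assms by (auto simp: spolys_def in_keys_iff)

lemma spolysD:
  assumes "A \<in> spolys K Y" "Poly_Mapping.lookup A m \<noteq> 0"
  shows "Poly_Mapping.lookup A m \<in> K" "Poly_Mapping.keys m \<subseteq> svars Y"
  using assms by (auto simp: spolys_def in_keys_iff)

lemma spolys_lookup: "coeff_ring K \<Longrightarrow> A \<in> spolys K Y \<Longrightarrow> Poly_Mapping.lookup A m \<in> K"
  by (cases "Poly_Mapping.lookup A m = 0") (auto simp: coeff_ring_0 spolysD)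

lemma svars_mono: "Y \<subseteq> Z \<Longrightarrow> svars Y \<subseteq> svars Z"
  unfolding svars_def by blast

lemma spolys_mono: "K \<subseteq> L \<Longrightarrow> Y \<subseteq> Z \<Longrightarrow> spolys K Y \<subseteq> spolys L Z"
  using svars_mono[of Y Z] by (fastforce simp: spolys_def)

lemma spolys_0 [simp]: "0 \<in> spolys K Y"
  by (simp add: spolys_def)

lemma spolys_add:
  assumes "coeff_ring K" "A \<in> spolys K Y" "B \<in> spolys K Y"
  shows "A + B \<in> spolys K Y"
proof (rule spolysI)
  fix m assume "Poly_Mapping.lookup (A + B) m \<noteq> 0"
  then have "Poly_Mapping.lookup A m \<noteq> 0 \<or> Poly_Mapping.lookup B m \<noteq> 0"
    by (auto simp: lookup_add)
  then have "Poly_Mapping.keys m \<subseteq> svars Y" using assms(2,3) by (auto dest: spolysD(2))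
  then show "Poly_Mapping.lookup (A + B) m \<in> K \<and> Poly_Mapping.keys m \<subseteq> svars Y"
    using assms by (simp add: lookup_add coeff_ring_add spolys_lookup)
qed

lemma spolys_sum: "coeff_ring K \<Longrightarrow> (\<And>i. i \<in> I \<Longrightarrow> f i \<in> spolys K Y) \<Longrightarrow> sum f I \<in> spolys K Y"
  by (induction I rule: infinite_finite_induct) (auto simp: spolys_add)

lemma spolys_single: "c \<in> K \<Longrightarrow> Poly_Mapping.keys m \<subseteq> svars Y \<Longrightarrow> Poly_Mapping.single m c \<in> spolys K Y"
  by (rule spolysI) (auto simp: lookup_single when_def split: if_splits)

lemma spolys_mult:
  assumes "coeff_ring K" "A \<in> spolys K Y" "B \<in> spolys K Y"
  shows "A * B \<in> spolys K Y"
proof -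
  have "A * B = (\<Sum>m\<in>Poly_Mapping.keys A. \<Sum>n\<in>Poly_Mapping.keys B.
      Poly_Mapping.single (m + n) (Poly_Mapping.lookup A m * Poly_Mapping.lookup B n))"
    by (subst (1) poly_mapping_sum_single[of A], subst (1) poly_mapping_sum_single[of B])
       (simp add: sum_product mult_single)
  moreover have "Poly_Mapping.keys (m + n) \<subseteq> svars Y"
    if "m \<in> Poly_Mapping.keys A" "n \<in> Poly_Mapping.keys B" for m n
    using that assms(2,3) keys_add[of m n] by (fastforce simp: spolys_def)
  ultimately show ?thesis
    using assms by (auto intro!: spolys_sum spolys_single coeff_ring_mult spolys_lookup)
qed

lemma spolys_pconst: "c \<in> K \<Longrightarrow> pconst c \<in> spolys K Y"
  by (simp add: pconst_def spolys_single)

lemma spolys_pvar: "coeff_ring K \<Longrightarrow> u \<in> svars Y \<Longrightarrow> pvar u \<in> spolys K Y"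
  by (simp add: pvar_def spolys_single coeff_ring_1)

lemma lookup_single_mult:
  fixes g :: "('a::cancel_comm_monoid_add) \<Rightarrow>\<^sub>0 ('b::comm_ring_1)"
  shows "Poly_Mapping.lookup (Poly_Mapping.single m c * g) (m + k) = c * Poly_Mapping.lookup g k"
  by (induction g rule: poly_mapping_add_induct)
     (auto simp: mult_single lookup_single distrib_left lookup_add when_def)

lemma lookup_single_mult_eq_0:
  fixes g :: "('a::cancel_comm_monoid_add) \<Rightarrow>\<^sub>0 ('b::comm_ring_1)"
  assumes "\<And>k. l \<noteq> m + k"
  shows "Poly_Mapping.lookup (Poly_Mapping.single m c * g) l = 0"
  by (induction g rule: poly_mapping_add_induct)
     (use assms in \<open>auto simp: mult_single lookup_single distrib_left lookup_add when_def\<close>)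

lemma lookup_pconst_mult: "Poly_Mapping.lookup (pconst c * g) k = c * Poly_Mapping.lookup g k"
  using lookup_single_mult[of 0 c g k] by (simp add: pconst_def)

lemma pconst_uminus_1: "pconst (- 1) * A = - A"
  by (rule poly_mapping_eqI) (simp add: lookup_pconst_mult)

lemma spolys_uminus: "coeff_ring K \<Longrightarrow> A \<in> spolys K Y \<Longrightarrow> - A \<in> spolys K Y"
  using spolys_mult[of K "pconst (- 1)" Y A] spolys_pconst[OF coeff_ring_of_BB[OF _ BB_neg1], of K Y]
  by (simp add: pconst_uminus_1)

lemma lookup_qsubst:
  "Poly_Mapping.lookup (qsubst u P f) m = P ^ Poly_Mapping.lookup m u * Poly_Mapping.lookup f m"
  by (auto simp: qsubst_def lookup_mapp when_def in_keys_iff)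

lemma qsubst_add: "qsubst u P (f + g) = qsubst u P f + qsubst u P g"
  by (rule poly_mapping_eqI) (simp add: lookup_qsubst lookup_add distrib_left)

lemma split_pvar: "Poly_Mapping.lookup l u \<noteq> 0 \<Longrightarrow> \<exists>k. l = Poly_Mapping.single u (1::nat) + k"
  by (rule exI[of _ "l - Poly_Mapping.single u 1"], rule poly_mapping_eqI)
     (auto simp: lookup_add lookup_minus lookup_single when_def)

text \<open>Multiplication by \<open>u\<close> shifts exponents by one, so the coefficient at
  \<open>k\<close> comes from the monomial with one more \<open>u\<close>, hence \<open>Suc\<close>.
  Comparing coefficients gives existence and uniqueness together, which resolves the definite
  description.\<close>

lemma
  assumes "P \<noteq> 1"
  shows jackson_eq: "pconst (1 - P) * pvar u * jackson u P f = f - qsubst u P f"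
    and lookup_jackson: "Poly_Mapping.lookup (jackson u P f) k =
      (1 - P ^ Suc (Poly_Mapping.lookup k u)) / (1 - P) * Poly_Mapping.lookup f (k + Poly_Mapping.single u 1)"
proof -
  let ?e = "Poly_Mapping.single u (1::nat)"
  define h where "h k = (1 - P ^ Suc (Poly_Mapping.lookup k u)) / (1 - P) * Poly_Mapping.lookup f (k + ?e)" for k
  have "finite {k. h k \<noteq> 0}"
  proof (rule finite_subset)
    show "{k. h k \<noteq> 0} \<subseteq> (\<lambda>k. k + ?e) -` Poly_Mapping.keys f" by (auto simp: h_def in_keys_iff)
    show "finite ((\<lambda>k. k + ?e) -` Poly_Mapping.keys f)" by (rule finite_vimageI) (auto simp: inj_def)
  qed
  then have h: "Poly_Mapping.lookup (Abs_poly_mapping h) = h" by simp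
  have pv: "pconst (1 - P) * pvar u = Poly_Mapping.single ?e (1 - P)"
    by (simp add: pconst_def pvar_def mult_single)
  have hk: "(1 - P) * h k = (1 - P ^ Suc (Poly_Mapping.lookup k u)) * Poly_Mapping.lookup f (k + ?e)" for k
    using assms by (simp add: h_def)
  have ex: "pconst (1 - P) * pvar u * g = f - qsubst u P f \<longleftrightarrow> g = Abs_poly_mapping h" for g
  proof
    assume g: "g = Abs_poly_mapping h"
    show "pconst (1 - P) * pvar u * g = f - qsubst u P f"
    proof (rule poly_mapping_eqI)
      fix l
      show "Poly_Mapping.lookup (pconst (1 - P) * pvar u * g) l = Poly_Mapping.lookup (f - qsubst u P f) l"
      \<comment> \<open>A monomial without \<open>u\<close> is no multiple of \<open>u\<close> on
        the left, and on the right its factor is \<open>1 - P ^ 0\<close>.\<close>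
      proof (cases "Poly_Mapping.lookup l u = 0")
        case True
        then have "l \<noteq> ?e + k" for k by (auto simp: lookup_add)
        with True show ?thesis
          unfolding pv by (simp add: lookup_single_mult_eq_0 lookup_minus lookup_qsubst)
      next
        case False
        then obtain k where k: "l = ?e + k" using split_pvar[OF False] by blast
        show ?thesis
          unfolding pv k lookup_single_mult g h hk
          by (simp add: lookup_minus lookup_qsubst lookup_add left_diff_distrib add.commute)
      qed
    qed
  next
    assume g: "pconst (1 - P) * pvar u * g = f - qsubst u P f"
    show "g = Abs_poly_mapping h"
    proof (rule poly_mapping_eqI)
      fix k
      have "(1 - P) * Poly_Mapping.lookup g k = Poly_Mapping.lookup (f - qsubst u P f) (?e + k)"
        unfolding g[symmetric] pv lookup_single_mult ..
      also have "\<dots> = (1 - P) * h k"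
        unfolding hk by (simp add: lookup_minus lookup_qsubst lookup_add left_diff_distrib add.commute)
      finally show "Poly_Mapping.lookup g k = Poly_Mapping.lookup (Abs_poly_mapping h) k"
        using assms by (simp add: h)
    qed
  qed
  have "jackson u P f = Abs_poly_mapping h"
    unfolding jackson_def ex by (rule the_eq_trivial)
  then show "pconst (1 - P) * pvar u * jackson u P f = f - qsubst u P f"
    "Poly_Mapping.lookup (jackson u P f) k =
      (1 - P ^ Suc (Poly_Mapping.lookup k u)) / (1 - P) * Poly_Mapping.lookup f (k + ?e)"
    by (simp_all only: ex h) (simp add: h_def)
qed

lemma jackson_add: "P \<noteq> 1 \<Longrightarrow> jackson u P (f + g) = jackson u P f + jackson u P g"
  by (rule poly_mapping_eqI) (simp add: lookup_jackson lookup_add distrib_left)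

text \<open>Restoring the variable after the Jackson derivative makes the operator diagonal on
  monomials. Going through \<open>jackson_eq\<close> treats exponent zero together with the
  others.\<close>

lemma lookup_pvar_jackson:
  assumes "P \<noteq> 1"
  shows "Poly_Mapping.lookup (pvar u * jackson u P f) l =
    (1 - P ^ Poly_Mapping.lookup l u) / (1 - P) * Poly_Mapping.lookup f l"
proof -
  have "(1 - P) * Poly_Mapping.lookup (pvar u * jackson u P f) l =
      Poly_Mapping.lookup (pconst (1 - P) * pvar u * jackson u P f) l"
    by (simp add: mult.assoc lookup_pconst_mult)
  also have "\<dots> = (1 - P ^ Poly_Mapping.lookup l u) * Poly_Mapping.lookup f l"
    by (simp only: jackson_eq[OF assms] lookup_minus lookup_qsubst) (simp add: left_diff_distrib)
  finally show ?thesis using assms by (simp add: field_simps)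
qed

lemma spolys_qsubst:
  assumes "coeff_ring K" "P \<in> K" "A \<in> spolys K Y"
  shows "qsubst u P A \<in> spolys K Y"
proof (rule spolysI)
  fix m assume "Poly_Mapping.lookup (qsubst u P A) m \<noteq> 0"
  then have "Poly_Mapping.lookup A m \<noteq> 0" by (auto simp: lookup_qsubst)
  then show "Poly_Mapping.lookup (qsubst u P A) m \<in> K \<and> Poly_Mapping.keys m \<subseteq> svars Y"
    using assms by (simp add: lookup_qsubst coeff_ring_mult coeff_ring_power spolysD)
qed

lemma spolys_jackson:
  assumes "coeff_ring K" "P \<noteq> 1" "P \<in> K" "A \<in> spolys K Y"
  shows "jackson u P A \<in> spolys K Y"
proof (rule spolysI)
  fix m assume "Poly_Mapping.lookup (jackson u P A) m \<noteq> 0"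
  then have nz: "Poly_Mapping.lookup A (m + Poly_Mapping.single u 1) \<noteq> 0"
    using assms(2) by (auto simp: lookup_jackson)
  have "Poly_Mapping.keys m \<subseteq> Poly_Mapping.keys (m + Poly_Mapping.single u 1)"
    by (auto simp: in_keys_iff lookup_add)
  moreover have "(1 - P ^ Suc n) / (1 - P) \<in> K" for n
    unfolding geometric_quotient[OF assms(2)] using assms by (intro coeff_ring_sum coeff_ring_power)
  ultimately show "Poly_Mapping.lookup (jackson u P A) m \<in> K \<and> Poly_Mapping.keys m \<subseteq> svars Y"
    unfolding lookup_jackson[OF assms(2)]
    using assms(1) spolysD[OF assms(4) nz] by (blast intro: coeff_ring_mult)
qed

text \<open>This is why surplus variables contribute nothing when the set of variables is
  enlarged.\<close>

lemma jackson_eq_0: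
  assumes "P \<noteq> 1" "A \<in> spolys K Y" "u \<notin> svars Y"
  shows "jackson u P A = 0"
proof (rule poly_mapping_eqI)
  fix k
  have "u \<in> Poly_Mapping.keys (k + Poly_Mapping.single u (1::nat))"
    by (simp add: in_keys_iff lookup_add)
  then have "Poly_Mapping.lookup A (k + Poly_Mapping.single u 1) = 0"
    using assms(2,3) spolysD(2) by blast
  then show "Poly_Mapping.lookup (jackson u P A) k = Poly_Mapping.lookup 0 k"
    using assms(1) by (simp add: lookup_jackson)
qed

lemma qq_in_coeff_ring: "coeff_ring K \<Longrightarrow> qq \<in> K" "coeff_ring K \<Longrightarrow> qq ^ 2 \<in> K"
  by (auto intro: coeff_ring_of_BB BB.q BB_q_power)

lemma spolys_Esc:
  assumes "coeff_ring K" "A \<in> spolys K (set ys)"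
  shows "Esc ys A \<in> spolys K (set ys)"
  unfolding Esc_def using assms
  by (intro spolys_add spolys_mult spolys_qsubst spolys_sum spolys_jackson spolys_pconst spolys_pvar)
     (auto simp: svars_def coeff_ring_add coeff_ring_1 qq_in_coeff_ring)

text \<open>Each summand is diagonal on monomials. The factor \<open>1 + qq\<close> turns the
  integer of base \<open>qq ^ 2\<close> belonging to \<open>a\<close> into
  \<open>qint (2 * int a)\<close>, and the substitution contributes \<open>qq ^ (2 * a)\<close>;
  this is the bracket in \<open>lam\<close>.\<close>

lemma lookup_Esc:
  "Poly_Mapping.lookup (Esc ys A) l =
     (qint (2 * int (Poly_Mapping.lookup l R_var)) + qq ^ (2 * Poly_Mapping.lookup l R_var)
       * (\<Sum>v\<in>set ys. qint (int (Poly_Mapping.lookup l (S_var v))))) * Poly_Mapping.lookup A l"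
proof -
  define a where "a = Poly_Mapping.lookup l R_var"
  have "1 - qq ^ 2 = (1 + qq) * (1 - qq)" by (simp add: power2_eq_square algebra_simps)
  moreover have "1 + qq \<noteq> 0" using \<open>1 - qq ^ 2 = (1 + qq) * (1 - qq)\<close> qq2_neq_1 by auto
  ultimately have "(1 + qq) * ((1 - (qq ^ 2) ^ a) / (1 - qq ^ 2)) = (1 - qq ^ (2 * a)) / (1 - qq)"
    by (simp add: power_mult)
  also have "\<dots> = qint (2 * int a)" using qint_of_nat[of "2 * a"] by simp
  finally have 1: "(1 + qq) * ((1 - (qq ^ 2) ^ a) / (1 - qq ^ 2)) = qint (2 * int a)" .
  have "Poly_Mapping.lookup (Esc ys A) l =
     (1 + qq) * ((1 - (qq ^ 2) ^ a) / (1 - qq ^ 2) * Poly_Mapping.lookup A l)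
     + (qq ^ 2) ^ a * (\<Sum>v\<in>set ys. qint (int (Poly_Mapping.lookup l (S_var v))) * Poly_Mapping.lookup A l)"
    by (simp add: Esc_def lookup_add mult.assoc lookup_pconst_mult lookup_pvar_jackson lookup_qsubst
        lookup_sum qint_of_nat a_def)
  also have "\<dots> = qint (2 * int a) * Poly_Mapping.lookup A l + qq ^ (2 * a)
       * (\<Sum>v\<in>set ys. qint (int (Poly_Mapping.lookup l (S_var v)))) * Poly_Mapping.lookup A l"
    by (simp only: mult.assoc[symmetric] 1 sum_distrib_right[symmetric] power_mult)
  finally show ?thesis by (simp only: a_def distrib_right)
qed

text \<open>The diagonal part of \<open>Hop\<close>.\<close>

definition diag_poly :: "'v list \<Rightarrow> nat \<Rightarrow> 'v spoly \<Rightarrow> 'v spoly" where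
  "diag_poly ys p A = pconst ((- 1) ^ p * qmint (- int p)) * A + pconst ((- 1) ^ p * qmpow (- int p)) * Esc ys A"

lemma lookup_diag_poly:
  "Poly_Mapping.lookup (diag_poly ys p A) l =
     mu ys p (Poly_Mapping.lookup l R_var) (\<lambda>v. Poly_Mapping.lookup l (S_var v)) * Poly_Mapping.lookup A l"
  unfolding diag_poly_def lookup_add lookup_pconst_mult lookup_Esc mu_def lam_def
  by (simp add: algebra_simps)

lemma lookup_green_poly:
  "Poly_Mapping.lookup (green_poly ys p A) l =
     inverse (mu ys p (Poly_Mapping.lookup l R_var) (\<lambda>v. Poly_Mapping.lookup l (S_var v))) * Poly_Mapping.lookup A l"
  by (auto simp: green_poly_def lookup_mapp when_def in_keys_iff)

lemma diag_green_poly: "diag_poly ys p (green_poly ys p A) = A"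
  and green_diag_poly: "green_poly ys p (diag_poly ys p A) = A"
  by (rule poly_mapping_eqI, simp add: lookup_diag_poly lookup_green_poly mu_neq_0)+

lemma green_poly_0: "green_poly ys p 0 = 0"
  by (rule poly_mapping_eqI) (simp add: lookup_green_poly)

lemma green_poly_add: "green_poly ys p (A + B) = green_poly ys p A + green_poly ys p B"
  by (rule poly_mapping_eqI) (simp add: lookup_green_poly lookup_add distrib_left)

lemma spolys_diag_poly:
  "coeff_ring K \<Longrightarrow> A \<in> spolys K (set ys) \<Longrightarrow> diag_poly ys p A \<in> spolys K (set ys)"
  unfolding diag_poly_def
  by (intro spolys_add spolys_mult spolys_pconst spolys_Esc)
     (auto intro!: coeff_ring_of_BB[of K] BB.mult BB_sign BB_qmint BB_qmpow)

section \<open>Evaluation of scalar polynomials\<close>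

lemma central_sval [simp]: "central (sval x u)"
proof (cases u)
  case R_var
  have "rgen x ^ 2 = cst (1 / 2) * anticomm (rgen x) (rgen x :: 'a ralg)"
    by (rule half_eqI[symmetric]) (simp add: anticomm_def power2_eq_square)
  then show ?thesis using R_var by (simp add: central_mult)
next
  case (C_var p)
  then show ?thesis by (cases p) simp
qed simp

definition mval :: "'v \<Rightarrow> ('v svar \<Rightarrow>\<^sub>0 nat) \<Rightarrow> 'v ralg" where
  "mval x m = Finite_Set.fold (\<lambda>u z. sval x u ^ Poly_Mapping.lookup m u * z) 1 (Poly_Mapping.keys m)"

lemma comp_fun_commute_sval: "comp_fun_commute (\<lambda>u z. sval x u ^ n u * z)"
  by standard (auto simp: fun_eq_iff central_left_commute central_power)

lemma fold_sval_insert: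
  assumes "finite F" "u \<notin> F"
  shows "Finite_Set.fold (\<lambda>u z. sval x u ^ n u * z) 1 (insert u F) =
    sval x u ^ n u * Finite_Set.fold (\<lambda>u z. sval x u ^ n u * z) 1 F"
  using comp_fun_commute_on.fold_insert[OF comp_fun_commute_sval[unfolded comp_fun_commute_def']] assms by simp

text \<open>Exponent zero gives the factor 1, so several monomials can be folded over one common set
  of variables, as \<open>mval_add\<close> needs.\<close>

lemma mval_superset:
  assumes "finite F" "Poly_Mapping.keys m \<subseteq> F"
  shows "mval x m = Finite_Set.fold (\<lambda>u z. sval x u ^ Poly_Mapping.lookup m u * z) 1 F"
proof -
  have "finite D \<Longrightarrow> D \<inter> Poly_Mapping.keys m = {} \<Longrightarrow>
      Finite_Set.fold (\<lambda>u z. sval x u ^ Poly_Mapping.lookup m u * z) 1 (Poly_Mapping.keys m \<union> D) = mval x m" for D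
    by (induction D rule: finite_induct) (auto simp: mval_def fold_sval_insert in_keys_iff)
  then have "Finite_Set.fold (\<lambda>u z. sval x u ^ Poly_Mapping.lookup m u * z) 1
      (Poly_Mapping.keys m \<union> (F - Poly_Mapping.keys m)) = mval x m"
    by this (use assms in auto)
  moreover have "Poly_Mapping.keys m \<union> (F - Poly_Mapping.keys m) = F" using assms by blast
  ultimately show ?thesis by simp
qed

lemma central_mval [simp]: "central (mval x m)"
proof -
  have "finite F \<Longrightarrow> central (Finite_Set.fold (\<lambda>u z. sval x u ^ Poly_Mapping.lookup m u * z) 1 F)" for F
    by (induction F rule: finite_induct) (auto simp: fold_sval_insert central_mult central_power)
  then show ?thesis by (simp add: mval_def)
qed

lemma mval_add: "mval x (m + n) = mval x m * mval x n"
proof -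
  define f where "f m F = Finite_Set.fold (\<lambda>u z. sval x u ^ Poly_Mapping.lookup m u * z) 1 F" for m F
  have "finite F \<Longrightarrow> f (m + n) F = f m F * f n F" for F
  proof (induction F rule: finite_induct)
    case (insert u F)
    have c: "central (sval x u ^ Poly_Mapping.lookup n u)" by (simp add: central_power)
    have "f k (insert u F) = sval x u ^ Poly_Mapping.lookup k u * f k F" for k
      unfolding f_def by (rule fold_sval_insert) (use insert in auto)
    then show ?case
      using insert by (simp add: lookup_add power_add mult.assoc central_left_commute[OF c])
  qed (simp add: f_def)
  from this[of "Poly_Mapping.keys m \<union> Poly_Mapping.keys n"] show ?thesis
    using keys_add[of m n]
    by (simp add: mval_superset[of "Poly_Mapping.keys m \<union> Poly_Mapping.keys n"] f_def)
qed

lemma scal_eq: "scal x A = (\<Sum>m\<in>Poly_Mapping.keys A. cst (Poly_Mapping.lookup A m) * mval x m)"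
  by (simp add: scal_def mval_def)

lemma central_scal [simp]: "central (scal x A)"
  by (simp add: scal_eq central_sum central_mult)

lemma scal_add: "scal x (A + B) = scal x A + scal x B"
  unfolding scal_eq by (rule setsum_keys_plus_distrib) (auto simp: cst_add distrib_right)

lemma scal_single: "scal x (Poly_Mapping.single m c) = cst c * mval x m"
  by (simp add: scal_eq)

lemma scal_0 [simp]: "scal x 0 = 0"
  by (simp add: scal_eq)

lemma scal_sum: "scal x (sum f I) = (\<Sum>i\<in>I. scal x (f i))"
  by (induction I rule: infinite_finite_induct) (auto simp: scal_add)

lemma scal_mult: "scal x (A * B) = scal x A * scal x B"
proof (induction A rule: poly_mapping_add_induct)
  case (single m c)
  show ?case
  proof (induction B rule: poly_mapping_add_induct)
    case (single n d)
    show ?case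
      by (simp add: scal_single mult_single cst_mult mval_add mult.assoc central_left_commute[OF central_cst[of d], of "mval x m"])
  qed (simp add: distrib_left scal_add)
qed (simp add: distrib_right scal_add)

lemma mval_0 [simp]: "mval x 0 = 1"
  by (simp add: mval_def)

lemma scal_pconst [simp]: "scal x (pconst c) = cst c"
  by (simp add: pconst_def scal_single)

lemma scal_pvar [simp]: "scal x (pvar u) = sval x u"
  using fold_sval_insert[of "{}" u x "Poly_Mapping.lookup (Poly_Mapping.single u 1)"]
  by (simp add: pvar_def scal_single mval_def)

lemma scal_1 [simp]: "scal x 1 = 1"
  using scal_pconst[of x 1] by (simp add: pconst_def)

lemma scal_uminus: "scal x (- A) = - scal x A"
  using scal_add[of x A "- A"] by (simp add: eq_neg_iff_add_eq_0 add.commute)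

section \<open>The Clifford action on alternating functions\<close>

text \<open>The formal value of \<open>anticomm (rgen u) (rgen v)\<close>; note that the square of \<open>x\<close>, not its double, is
  a variable.\<close>

definition bil :: "'v \<Rightarrow> 'v \<Rightarrow> 'v \<Rightarrow> 'v spoly" where
  "bil x u v = (if u = x \<and> v = x then pconst 2 * pvar R_var else if u = x then pvar (S_var v)
     else if v = x then pvar (S_var u) else pvar (C_var (Upair u v)))"

lemma bil_commute: "bil x u v = bil x v u"
proof -
  have "Upair u v = Upair v u" by simp
  then show ?thesis by (simp only: bil_def) auto
qed

text \<open>Exterior multiplication of a multilinear form \<open>f\<close> by the covector \<open>\<theta>\<close>, evaluated at a list.\<close>

primrec covm :: "'v list \<Rightarrow> ('v \<Rightarrow> 'v spoly) \<Rightarrow> ('v list \<Rightarrow> 'v spoly) \<Rightarrow> 'v spoly" where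
  "covm [] \<theta> f = 0"
| "covm (v # l) \<theta> f = \<theta> v * f l - covm l \<theta> (\<lambda>k. f (v # k))"

text \<open>The arguments are letters, which stand for basis vectors. Any function of lists is thus
  a multilinear form of mixed degree, and only the behaviour under adjacent swaps has to be
  required.\<close>

definition alternating :: "('v list \<Rightarrow> 'v spoly) \<Rightarrow> bool" where
  "alternating f \<longleftrightarrow> (\<forall>a u v b. f (a @ u # v # b) = - f (a @ v # u # b))"

lemma alternatingD: "alternating f \<Longrightarrow> f (a @ u # v # b) = - f (a @ v # u # b)"
  unfolding alternating_def by blast

lemma alternating_Cons: "alternating f \<Longrightarrow> alternating (\<lambda>k. f (v # k))"
  unfolding alternating_def by (metis append_Cons)

lemma alternating_add:
  assumes "alternating f" "alternating g"
  shows "alternating (\<lambda>l. f l + g l)"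
  unfolding alternating_def
proof (intro allI)
  fix a u v b
  show "f (a @ u # v # b) + g (a @ u # v # b) = - (f (a @ v # u # b) + g (a @ v # u # b))"
    using assms[THEN alternatingD, of a u v b] by simp
qed

lemma alternating_cmult:
  assumes "alternating f"
  shows "alternating (\<lambda>l. c * f l)"
  unfolding alternating_def
proof (intro allI)
  fix a u v b
  show "c * f (a @ u # v # b) = - (c * f (a @ v # u # b))"
    using alternatingD[OF assms, of a u v b] by simp
qed

lemma covm_add: "covm l \<theta> (\<lambda>k. f k + g k) = covm l \<theta> f + covm l \<theta> g"
  by (induction l arbitrary: f g) (simp_all add: algebra_simps)

lemma covm_cmult: "covm l \<theta> (\<lambda>k. c * f k) = c * covm l \<theta> f"
  by (induction l arbitrary: f) (simp_all add: algebra_simps)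

lemma covm_uminus: "covm l \<theta> (\<lambda>k. - f k) = - covm l \<theta> f"
  by (induction l arbitrary: f) (simp_all add: algebra_simps)

lemma covm_diff: "covm l \<theta> (\<lambda>k. f k - g k) = covm l \<theta> f - covm l \<theta> g"
  using covm_add[of l \<theta> f "\<lambda>k. - g k"] by (simp add: covm_uminus)

lemma covm_anticommute: "covm l \<theta> (\<lambda>k. covm k \<eta> f) = - covm l \<eta> (\<lambda>k. covm k \<theta> f)"
proof (induction l arbitrary: f)
  case (Cons v l)
  show ?case using Cons.IH[of "\<lambda>k. f (v # k)"] by (simp add: covm_diff covm_cmult)
qed simp

text \<open>Every summand of the expanded product takes one entry for the covector and leaves the
  others in order. Only this much about the support is used, both for degrees and for dual
  forms.\<close>

lemma covm_nonzero:
  "covm l \<theta> f \<noteq> 0 \<Longrightarrow> \<exists>a v b. l = a @ v # b \<and> \<theta> v \<noteq> 0 \<and> f (a @ b) \<noteq> 0"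
proof (induction l arbitrary: f)
  case (Cons w l)
  show ?case
  proof (cases "\<theta> w * f l = 0")
    case True
    then have "covm l \<theta> (\<lambda>k. f (w # k)) \<noteq> 0" using Cons.prems by simp
    then obtain a v b where "l = a @ v # b" "\<theta> v \<noteq> 0" "f (w # a @ b) \<noteq> 0" using Cons.IH by blast
    then have "w # l = (w # a) @ v # b \<and> \<theta> v \<noteq> 0 \<and> f ((w # a) @ b) \<noteq> 0" by simp
    then show ?thesis by blast
  next
    case False
    then have "w # l = [] @ w # l \<and> \<theta> w \<noteq> 0 \<and> f ([] @ l) \<noteq> 0" by auto
    then show ?thesis by blast
  qed
qed simp

lemma alternating_covm: "alternating f \<Longrightarrow> alternating (\<lambda>l. covm l \<theta> f)"
proof -
  have *: "alternating f \<Longrightarrow> covm (a @ u # v # b) \<theta> f = - covm (a @ v # u # b) \<theta> f" for a u v b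
  proof (induction a arbitrary: f)
    case Nil
    have "(\<lambda>k. f (u # v # k)) = (\<lambda>k. - f (v # u # k))"
      using alternatingD[OF Nil, of "[]" u v] by (simp add: fun_eq_iff)
    then show ?case by (simp add: covm_uminus)
  next
    case (Cons t a)
    show ?case
      using Cons.IH[OF alternating_Cons[OF Cons.prems]] alternatingD[OF Cons.prems, of a u v b] by simp
  qed
  show "alternating f \<Longrightarrow> alternating (\<lambda>l. covm l \<theta> f)"
    unfolding alternating_def[of "\<lambda>l. covm l \<theta> f"] using * by blast
qed

text \<open>The Clifford action by an interior product plus half of an exterior product. The mixed
  products of the actions of \<open>u\<close> and \<open>v\<close> give half of the form twice, so
  the factor 1/2 makes the anticommutator equal to \<open>bil x u v\<close>.\<close>

definition gact :: "'v \<Rightarrow> 'v \<Rightarrow> ('v list \<Rightarrow> 'v spoly) \<Rightarrow> 'v list \<Rightarrow> 'v spoly" where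
  "gact x v f l = f (v # l) + pconst (1 / 2) * covm l (bil x v) f"

lemma alternating_gact: "alternating f \<Longrightarrow> alternating (gact x v f)"
  unfolding gact_def[abs_def]
  by (intro alternating_add alternating_Cons alternating_cmult alternating_covm)

lemma gact_add: "gact x v (\<lambda>l. f l + g l) = (\<lambda>l. gact x v f l + gact x v g l)"
  by (simp add: gact_def fun_eq_iff covm_add algebra_simps)

lemma gact_cmult: "gact x v (\<lambda>l. c * f l) = (\<lambda>l. c * gact x v f l)"
  by (simp add: gact_def fun_eq_iff covm_cmult algebra_simps)

lemma pconst_add: "pconst (a + b) = pconst a + pconst b"
  by (simp add: pconst_def single_add)

lemma pconst_1 [simp]: "pconst 1 = 1"
  by (simp add: pconst_def)

lemma pconst_mult: "pconst (a * b) = pconst a * pconst b"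
  by (simp add: pconst_def mult_single)

lemma pconst_half: "pconst (1 / 2) * a + pconst (1 / 2) * a = a"
proof -
  have "pconst (1 / 2) * a + pconst (1 / 2) * a = pconst (1 / 2 + 1 / 2) * a"
    by (simp only: pconst_add distrib_right)
  then show ?thesis by simp
qed

text \<open>The two insertions cancel because \<open>f\<close> is alternating, the two exterior
  multiplications cancel by \<open>covm_anticommute\<close>, and the mixed terms add up by the
  symmetry of \<open>bil\<close>.\<close>

lemma gact_anticommutator:
  assumes "alternating f"
  shows "gact x u (gact x v f) l + gact x v (gact x u f) l = bil x u v * f l"
proof -
  let ?h = "pconst (1 / 2)"
  have expand: "gact x u (gact x v f) l = f (v # u # l)
      + (?h * (bil x v u * f l) - ?h * covm l (bil x v) (\<lambda>k. f (u # k)))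
      + (?h * covm l (bil x u) (\<lambda>k. f (v # k)) + ?h * (?h * covm l (bil x u) (\<lambda>k. covm k (bil x v) f)))" for u v
    by (simp add: gact_def[abs_def] covm_add covm_cmult distrib_left right_diff_distrib)
  have "f (v # u # l) = - f (u # v # l)"
    using alternatingD[OF assms, of "[]" v u l] by simp
  then show ?thesis
    unfolding expand[of u v] expand[of v u]
    using covm_anticommute[of l "bil x u" "bil x v" f] pconst_half[of "bil x u v * f l"]
    by (simp add: bil_commute[of x v u])
qed

section \<open>Action of words, of the free algebra and of the radial algebra\<close>

primrec letters :: "'v vword \<Rightarrow> 'v list" where
  "letters (VWord us) = us"

lemma letters_add: "letters (v + w) = letters v @ letters w"
  by (cases v; cases w) simp

definition wact :: "'v \<Rightarrow> 'v list \<Rightarrow> ('v list \<Rightarrow> 'v spoly) \<Rightarrow> 'v list \<Rightarrow> 'v spoly" where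
  "wact x us = foldr (gact x) us"

lemma wact_simps [simp]: "wact x [] f = f" "wact x (v # us) f = gact x v (wact x us f)"
  "wact x (us @ vs) f = wact x us (wact x vs f)"
  by (simp_all add: wact_def)

lemma wact_add: "wact x us (\<lambda>l. f l + g l) = (\<lambda>l. wact x us f l + wact x us g l)"
  by (induction us) (simp_all add: gact_add)

lemma wact_cmult: "wact x us (\<lambda>l. c * f l) = (\<lambda>l. c * wact x us f l)"
  by (induction us) (simp_all add: gact_cmult)

lemma alternating_wact: "alternating f \<Longrightarrow> alternating (wact x us f)"
  by (induction us) (simp_all add: alternating_gact)

definition pact :: "'v \<Rightarrow> ('v, qfield) freealg \<Rightarrow> ('v list \<Rightarrow> 'v spoly) \<Rightarrow> 'v list \<Rightarrow> 'v spoly" where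
  "pact x p f l = (\<Sum>w\<in>Poly_Mapping.keys p. pconst (Poly_Mapping.lookup p w) * wact x (letters w) f l)"

lemma pact_single: "pact x (Poly_Mapping.single w c) f = (\<lambda>l. pconst c * wact x (letters w) f l)"
  by (simp add: pact_def fun_eq_iff pconst_def)

lemma pact_add: "pact x (p + p') f = (\<lambda>l. pact x p f l + pact x p' f l)"
  unfolding pact_def fun_eq_iff
  by (intro allI setsum_keys_plus_distrib) (auto simp: pconst_add distrib_right, simp add: pconst_def)

lemma pact_0: "pact x 0 f l = 0"
  by (simp add: pact_def)

lemma pact_minus: "pact x (- p) f l = - pact x p f l"
  using fun_cong[OF pact_add[of x p "- p" f], of l] by (simp add: pact_0 eq_neg_iff_add_eq_0 add.commute)

lemma pact_cmult: "pact x p (\<lambda>l. c * f l) = (\<lambda>l. c * pact x p f l)"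
  by (induction p rule: poly_mapping_add_induct)
     (simp_all add: pact_single pact_add wact_cmult fun_eq_iff algebra_simps)

lemma alternating_pact: "alternating f \<Longrightarrow> alternating (pact x p f)"
  by (induction p rule: poly_mapping_add_induct)
     (simp_all add: pact_single pact_add alternating_add alternating_cmult alternating_wact)

lemma pact_mult: "pact x (p * p') f = pact x p (pact x p' f)"
proof (induction p rule: poly_mapping_add_induct)
  case (single w c)
  show ?case
    by (induction p' rule: poly_mapping_add_induct)
       (simp_all add: mult_single pact_single letters_add pconst_mult wact_cmult distrib_left pact_add wact_add
         mult.assoc)
next
  case (add p q)
  then show ?case by (simp add: distrib_right pact_add)
qed

lemma pact_fgen: "pact x (fgen v) f = gact x v f"
  by (simp add: fgen_def pact_single)

text \<open>The anticommutator of two generators acts as multiplication by a polynomial, and the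
  action is linear over polynomials, so the commutator with a third generator acts as zero.\<close>

lemma pact_radial_ideal:
  assumes "p \<in> radial_ideal" "alternating f"
  shows "pact x p f l = 0"
  using assms(1)
proof (induction arbitrary: l)
  case zero
  show ?case by (rule pact_0)
next
  case (gen a u v w b)
  define g where "g = pact x b f"
  have g: "alternating g" unfolding g_def by (rule alternating_pact[OF assms(2)])
  have anti: "pact x (anticomm (fgen u) (fgen v)) h = (\<lambda>l. bil x u v * h l)" if "alternating h" for h
    using gact_anticommutator[OF that] by (simp add: anticomm_def pact_add pact_mult pact_fgen)
  have "pact x (comm (anticomm (fgen u) (fgen v)) (fgen w)) g l = 0" for l
    using anti[OF g] anti[OF alternating_gact[OF g]]
    by (simp add: comm_def diff_conv_add_uminus pact_add pact_minus pact_mult pact_fgen gact_cmult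
        del: add_uminus_conv_diff)
  \<comment> \<open>The zero function is written as a multiple of \<open>g\<close>, so that
    \<open>pact_cmult\<close> pulls the zero through the action of \<open>a\<close>.\<close>
  then have "pact x (comm (anticomm (fgen u) (fgen v)) (fgen w)) g = (\<lambda>l. 0 * g l)"
    by (simp add: fun_eq_iff)
  then have "pact x (a * comm (anticomm (fgen u) (fgen v)) (fgen w) * b) f = pact x a (\<lambda>l. 0 * g l)"
    by (simp only: pact_mult g_def)
  then show ?case unfolding pact_cmult by simp
next
  case (add p p')
  then show ?case by (simp add: pact_add)
qed

text \<open>A representative is chosen. The choice is immaterial on alternating functions, which is
  why the homomorphism rules below carry that hypothesis.\<close>

definition ract :: "'v \<Rightarrow> 'v ralg \<Rightarrow> ('v list \<Rightarrow> 'v spoly) \<Rightarrow> 'v list \<Rightarrow> 'v spoly" where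
  "ract x z = pact x (rep_radial z)"

lemma ract_abs:
  assumes "alternating f"
  shows "ract x (abs_radial p) f = pact x p f"
proof -
  have "radial_rel (rep_radial (abs_radial p)) p"
    by (metis Quotient_radial Quotient_abs_rep radial.abs_eq_iff)
  then have "pact x (rep_radial (abs_radial p) - p) f l = 0" for l
    using pact_radial_ideal[OF _ assms] by (simp add: radial_rel_def)
  then have "ract x (abs_radial p) f l = pact x p f l" for l
    using fun_cong[OF pact_add[of x "rep_radial (abs_radial p) - p" p f], of l] by (simp add: ract_def)
  then show ?thesis by (rule ext)
qed

lemma alternating_ract: "alternating f \<Longrightarrow> alternating (ract x z f)"
  unfolding ract_def by (rule alternating_pact)

lemma radial_abs_cases:
  obtains p where "z = abs_radial p"
  by (metis Quotient_radial Quotient_abs_rep)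

lemma ract_add: "alternating f \<Longrightarrow> ract x (a + b) f l = ract x a f l + ract x b f l"
  by (cases a rule: radial_abs_cases; cases b rule: radial_abs_cases)
     (simp add: plus_radial.abs_eq ract_abs pact_add)

lemma ract_mult: "alternating f \<Longrightarrow> ract x (a * b) f = ract x a (ract x b f)"
  by (cases a rule: radial_abs_cases; cases b rule: radial_abs_cases)
     (simp add: times_radial.abs_eq ract_abs pact_mult alternating_pact)

lemma ract_cst: "alternating f \<Longrightarrow> ract x (cst c) f l = pconst c * f l"
  by (simp add: cst.abs_eq ract_abs pact_single zero_vword_def)

lemma ract_rgen: "alternating f \<Longrightarrow> ract x (rgen v) f = gact x v f"
  by (simp add: rgen.abs_eq ract_abs pact_fgen)

lemma ract_0: "alternating f \<Longrightarrow> ract x 0 f l = 0"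
  using ract_add[of f x 0 0 l] by simp

lemma ract_1: "alternating f \<Longrightarrow> ract x 1 f l = f l"
  using ract_cst[of f x 1 l] by simp

lemma ract_uminus: "alternating f \<Longrightarrow> ract x (- a) f l = - ract x a f l"
  using ract_add[of f x a "- a" l] by (simp add: ract_0 eq_neg_iff_add_eq_0 add.commute)

lemma ract_diff: "alternating f \<Longrightarrow> ract x (a - b) f l = ract x a f l - ract x b f l"
  using ract_add[of f x a "- b" l] by (simp add: ract_uminus)

lemma ract_sum: "alternating f \<Longrightarrow> ract x (sum h I) f l = (\<Sum>i\<in>I. ract x (h i) f l)"
  by (induction I rule: infinite_finite_induct) (simp_all add: ract_0 ract_add)

lemma ract_cmult: "ract x z (\<lambda>l. c * f l) = (\<lambda>l. c * ract x z f l)"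
  by (simp add: ract_def pact_cmult)

lemma ract_anticomm:
  "alternating f \<Longrightarrow> ract x (anticomm (rgen u) (rgen v)) f l = bil x u v * f l"
  using gact_anticommutator[of f x u v l]
  by (simp add: anticomm_def ract_add ract_mult ract_rgen alternating_gact)

lemma spolys_induct [consumes 1, case_names pconst pvar add mult]:
  assumes "A \<in> spolys K Y"
    and pconst: "\<And>c. c \<in> K \<or> c = 0 \<or> c = 1 \<Longrightarrow> P (pconst c)" and pvar: "\<And>u. u \<in> svars Y \<Longrightarrow> P (pvar u)"
    and add: "\<And>A B. P A \<Longrightarrow> P B \<Longrightarrow> P (A + B)" and mult: "\<And>A B. P A \<Longrightarrow> P B \<Longrightarrow> P (A * B)"
  shows "P A"
proof -
  have mono: "Poly_Mapping.keys m \<subseteq> svars Y \<Longrightarrow> P (Poly_Mapping.single m 1)" for m :: "'a svar \<Rightarrow>\<^sub>0 nat"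
  proof (induction m rule: poly_mapping_add_induct)
    case (single u n)
    show ?case using single
    proof (induction n)
      case 0
      then show ?case using pconst[of 1] by (simp add: pconst_def)
    next
      case (Suc n)
      have "Poly_Mapping.single (Poly_Mapping.single u (Suc n)) 1 =
          pvar u * Poly_Mapping.single (Poly_Mapping.single u n) 1"
        by (simp add: pvar_def mult_single flip: single_add)
      moreover have "P (Poly_Mapping.single (Poly_Mapping.single u n) 1)"
        using Suc by (cases n) (auto)
      ultimately show ?case using mult pvar Suc.prems by simp
    qed
  next
    case (add m n)
    have "Poly_Mapping.keys m \<subseteq> Poly_Mapping.keys (m + n)" "Poly_Mapping.keys n \<subseteq> Poly_Mapping.keys (m + n)"
      by (auto simp: in_keys_iff lookup_add)
    then have "P (Poly_Mapping.single m 1 * Poly_Mapping.single n 1)"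
      using add by (intro mult) auto
    then show ?case by (simp add: mult_single)
  qed
  have "P (\<Sum>m\<in>F. Poly_Mapping.single m (Poly_Mapping.lookup A m))" if "F \<subseteq> Poly_Mapping.keys A" for F
    using finite_subset[OF that finite_keys] that
  proof (induction F rule: finite_induct)
    case empty
    then show ?case using pconst[of 0] by (simp add: pconst_def)
  next
    case (insert m F)
    have "Poly_Mapping.single m (Poly_Mapping.lookup A m) = pconst (Poly_Mapping.lookup A m) * Poly_Mapping.single m 1"
      by (simp add: pconst_def mult_single)
    moreover have "P (pconst (Poly_Mapping.lookup A m))" "P (Poly_Mapping.single m 1)"
      using insert.prems assms(1) by (auto simp: spolys_def intro!: pconst mono)
    ultimately have "P (Poly_Mapping.single m (Poly_Mapping.lookup A m))" using mult by simp
    then show ?case using insert add by simp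
  qed
  from this[of "Poly_Mapping.keys A"] show ?thesis by (simp flip: poly_mapping_sum_single)
qed

text \<open>The action recovers the formal polynomial from its value, so the evaluated scalars are
  algebraically independent. Variables \<open>S_var\<close> and \<open>C_var\<close> with argument
  \<open>x\<close> are excluded: \<open>bil\<close> expresses their values through
  \<open>R_var\<close> and \<open>S_var\<close>.\<close>

lemma ract_scal:
  assumes "A \<in> spolys UNIV (- {x})" "alternating f"
  shows "ract x (scal x A) f l = A * f l"
  using assms
proof (induction arbitrary: f l rule: spolys_induct)
  case (pconst c)
  then show ?case by (simp add: ract_cst)
next
  case (pvar u)
  show ?case
  proof (cases u)
    case R_var
    have "rgen x ^ 2 = cst (1 / 2) * anticomm (rgen x) (rgen x :: 'a ralg)"
      by (rule half_eqI[symmetric]) (simp add: anticomm_def power2_eq_square)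
    then have "ract x (rgen x ^ 2) f l = pconst (1 / 2) * (bil x x x * f l)"
      using pvar by (simp add: ract_mult ract_cst ract_anticomm alternating_ract)
    also have "\<dots> = pconst (1 / 2) * pconst 2 * (pvar R_var * f l)"
      by (simp add: bil_def mult.assoc)
    finally show ?thesis using R_var by (simp flip: pconst_mult)
  next
    case (S_var v)
    then show ?thesis using pvar by (auto simp: ract_anticomm bil_def svars_def)
  next
    case (C_var p)
    then obtain v w where "p = Upair v w" "v \<noteq> x" "w \<noteq> x" using pvar(1) by (auto simp: svars_def)
    then show ?thesis using pvar C_var by (simp add: ract_anticomm bil_def)
  qed
next
  case (add A B)
  then show ?case by (simp add: scal_add ract_add distrib_right)
next
  case (mult A B)
  have "ract x (scal x B) f = (\<lambda>l. B * f l)" using mult by (simp add: fun_eq_iff)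
  then show ?case using mult by (simp add: scal_mult ract_mult ract_cmult mult.assoc)
qed

text \<open>On forms of degree at least \<open>k\<close>, a wedge of length \<open>k\<close> acts by contraction up to terms that
  vanish at short lists.\<close>

lemma ract_wdg:
  assumes "alternating f" "\<And>l. length l < k \<Longrightarrow> f l = 0"
  shows "length us + length l < k \<Longrightarrow> ract x (wdg us) f l = 0"
    and "length us + length l = k \<Longrightarrow> ract x (wdg us) f l = f (rev us @ l)"
proof -
  have "(length us + length l < k \<longrightarrow> ract x (wdg us) f l = 0) \<and>
      (length us + length l = k \<longrightarrow> ract x (wdg us) f l = f (rev us @ l))"
  \<comment> \<open>Structural induction is too weak: the contraction part leads to lists with one
    inner entry deleted, which are shorter but not tails.\<close>
  proof (induction us arbitrary: l rule: length_induct)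
    case (1 us)
    show ?case
    proof (cases us)
      case Nil
      then show ?thesis using assms by (simp add: ract_1)
    next
      case (Cons v vs)
      show ?thesis
      proof (cases "length us + length l \<le> k")
        case True
        have "ext (length vs) v (wdg vs) = rgen v * wdg vs - cst (1 / 2) * ctr (length vs) v (wdg vs)"
          using left_mult_ext_ctr[of v "wdg vs" "length vs"] by simp
        then have "ract x (wdg us) f l = gact x v (ract x (wdg vs) f) l -
            pconst (1 / 2) * ract x (ctr (length vs) v (wdg vs)) f l"
          using assms(1) by (simp add: Cons ract_diff ract_mult ract_rgen ract_cst alternating_ract)
        also have "ract x (ctr (length vs) v (wdg vs)) f l = 0"
        proof -
          have "ract x (wdg (take k vs @ drop (Suc k) vs)) f l = 0" if "k < length vs" for k
            using 1[rule_format, of "take k vs @ drop (Suc k) vs" l] that True Cons by auto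
          then have "ract x ((- 1) ^ k * (anticomm (rgen (vs ! k)) (rgen v) *
              wdg (take k vs @ drop (Suc k) vs))) f l = 0" if "k < length vs" for k
            using that assms(1)
            by (simp add: ract_mult ract_anticomm alternating_ract ract_cst flip: cst_neg1_power)
          then show ?thesis unfolding ctr_wdg using assms(1) by (simp add: ract_sum)
        qed
        \<comment> \<open>Each term of the exterior part removes an entry of \<open>l\<close>, so
          the total length drops below \<open>k\<close> and the induction hypothesis gives zero.
          Only the insertion of \<open>v\<close> survives.\<close>
        also have "covm l (bil x v) (ract x (wdg vs) f) = 0"
        proof (rule ccontr)
          assume "covm l (bil x v) (ract x (wdg vs) f) \<noteq> 0"
          from covm_nonzero[OF this] obtain a w b where l: "l = a @ w # b" and "ract x (wdg vs) f (a @ b) \<noteq> 0"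
            by blast
          then show False
            using 1[rule_format, of vs "a @ b"] True Cons by simp
        qed
        then have "gact x v (ract x (wdg vs) f) l = ract x (wdg vs) f (v # l)"
          by (simp add: gact_def)
        finally have "ract x (wdg us) f l = ract x (wdg vs) f (v # l)" by simp
        then show ?thesis
          using 1[rule_format, of vs "v # l"] Cons by auto
      qed simp
    qed
  qed
  then show "length us + length l < k \<Longrightarrow> ract x (wdg us) f l = 0"
    "length us + length l = k \<Longrightarrow> ract x (wdg us) f l = f (rev us @ l)" by auto
qed

text \<open>The wedge of the coordinate covectors along a list.\<close>

primrec dual_form :: "'v list \<Rightarrow> 'v list \<Rightarrow> 'v spoly" where
  "dual_form [] = (\<lambda>l. if l = [] then 1 else 0)"
| "dual_form (j # js) = (\<lambda>l. covm l (\<lambda>v. if v = j then 1 else 0) (dual_form js))"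

lemma alternating_dual_form: "alternating (dual_form js)"
  by (induction js) (simp_all add: alternating_covm, simp add: alternating_def)

lemma dual_form_nonzero: "dual_form js l \<noteq> 0 \<Longrightarrow> mset l = mset js"
proof (induction js arbitrary: l)
  case (Cons j js)
  then obtain a v b where "l = a @ v # b" "v = j" "dual_form js (a @ b) \<noteq> 0"
    using covm_nonzero[of l "\<lambda>v. if v = j then 1 else 0" "dual_form js"] by (auto split: if_splits)
  then show ?case using Cons.IH[of "a @ b"] by simp
qed (simp split: if_splits)

lemma dual_form_self: "distinct js \<Longrightarrow> dual_form js js = 1"
proof (induction js)
  case (Cons j js)
  have "covm js (\<lambda>v. if v = j then 1 else 0) (\<lambda>k. dual_form js (j # k)) = 0"
  proof (rule ccontr)
    assume "\<not> ?thesis"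
    from covm_nonzero[OF this] have "j \<in> set js" by (auto split: if_splits)
    then show False using Cons.prems by simp
  qed
  then show ?case using Cons by simp
qed simp

text \<open>Among the lists with nonzero coefficient take a longest one, \<open>js\<close>, and
  apply the relation to its dual form at the empty list. Shorter wedges give zero by degree, and
  other wedges of the same length give zero because their underlying sets differ.\<close>

lemma wdg_independent:
  assumes "finite D" "inj_on set D" "\<And>us. us \<in> D \<Longrightarrow> distinct us"
    and A: "\<And>us. us \<in> D \<Longrightarrow> A us \<in> spolys UNIV (- {x})"
    and sum: "(\<Sum>us\<in>D. wdg us * scal x (A us)) = 0"
    and "us \<in> D"
  shows "A us = 0"
proof (rule ccontr)
  assume "A us \<noteq> 0"
  define E where "E = {vs \<in> D. A vs \<noteq> 0}"
  have "finite E" "E \<noteq> {}" using assms(1,6) \<open>A us \<noteq> 0\<close> by (auto simp: E_def)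
  define k where "k = Max (length ` E)"
  have "k \<in> length ` E" unfolding k_def using \<open>finite E\<close> \<open>E \<noteq> {}\<close> by simp
  then obtain js where js: "js \<in> D" "A js \<noteq> 0" "length js = k" by (auto simp: E_def)
  have le: "length vs \<le> k" if "vs \<in> D" "A vs \<noteq> 0" for vs
    unfolding k_def using that \<open>finite E\<close> by (auto simp: E_def)
  \<comment> \<open>Successive insertions reach the form in reverse order, hence
    \<open>rev\<close>.\<close>
  define f where "f = dual_form (rev js)"
  have alt: "alternating f" unfolding f_def by (rule alternating_dual_form)
  have low: "f l = 0" if "length l < k" for l
  proof (rule ccontr)
    assume "f l \<noteq> 0"
    then have "mset l = mset (rev js)" unfolding f_def by (rule dual_form_nonzero)
    then have "length l = length js" by (metis length_rev mset_eq_length)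
    then show False using that js by simp
  qed
  have "ract x (wdg vs * scal x (A vs)) f [] = (if vs = js then A vs else 0)" if vs: "vs \<in> D" for vs
  proof -
    have "wdg vs * scal x (A vs) = scal x (A vs) * wdg vs" by (rule centralD) simp
    then have *: "ract x (wdg vs * scal x (A vs)) f [] = A vs * ract x (wdg vs) f []"
      using alt A[OF vs] by (simp add: ract_mult ract_scal alternating_ract)
    show ?thesis
    proof (cases "A vs = 0")
      case False
      from le[OF vs this] consider "length vs < k" | "length vs = k" by linarith
      then show ?thesis
      proof cases
        case 1
        then show ?thesis using * ract_wdg(1)[OF alt low, where us = vs and l = "[]"] js by auto
      next
        case 2
        then have "ract x (wdg vs) f [] = f (rev vs)" using ract_wdg(2)[OF alt low, where us = vs and l = "[]"] by simp
        moreover have "f (rev vs) = 0" if "vs \<noteq> js"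
        proof (rule ccontr)
          assume "f (rev vs) \<noteq> 0"
          then have "mset (rev vs) = mset (rev js)" unfolding f_def by (rule dual_form_nonzero)
          then have "set vs = set js" by (metis mset_eq_setD set_rev)
          then show False using that vs js(1) assms(2) by (auto dest: inj_onD)
        qed
        moreover have "f (rev js) = 1" unfolding f_def using assms(3) js(1) by (simp add: dual_form_self)
        ultimately show ?thesis using * by auto
      qed
    qed (auto simp: ract_0 alt)
  qed
  then have "(\<Sum>vs\<in>D. ract x (wdg vs * scal x (A vs)) f []) = (\<Sum>vs\<in>D. if vs = js then A vs else 0)"
    by (intro sum.cong) auto
  also have "\<dots> = A js" using assms(1) js(1) by simp
  finally have "ract x (\<Sum>us\<in>D. wdg us * scal x (A us)) f [] = A js"
    using alt by (simp add: ract_sum)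
  then show False using sum alt js(2) by (simp add: ract_0)
qed

section \<open>The free basis of wedge products\<close>

lemma subalg_mono: "K \<subseteq> L \<Longrightarrow> V \<subseteq> W \<Longrightarrow> subalg K V \<subseteq> subalg L W"
proof
  fix z assume KV: "K \<subseteq> L" "V \<subseteq> W" and "z \<in> subalg K V"
  from this(3) show "z \<in> subalg L W" by induction (use KV in \<open>auto intro: subalg.intros\<close>)
qed

lemma subalg_0: "coeff_ring K \<Longrightarrow> 0 \<in> subalg K V" and subalg_1: "coeff_ring K \<Longrightarrow> 1 \<in> subalg K V"
  using subalg.cst[of 0 K V] subalg.cst[of 1 K V] by (simp_all add: coeff_ring_0 coeff_ring_1)

lemma subalg_sign: "coeff_ring K \<Longrightarrow> (- 1) ^ n \<in> subalg K V"
  using subalg.cst[of "(- 1) ^ n" K V] by (simp add: cst_neg1_power coeff_ring_of_BB BB_sign)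

lemma subalg_sum: "coeff_ring K \<Longrightarrow> (\<And>i. i \<in> I \<Longrightarrow> f i \<in> subalg K V) \<Longrightarrow> sum f I \<in> subalg K V"
  by (induction I rule: infinite_finite_induct) (auto simp: subalg_0 subalg.add)

lemma subalg_wdg:
  assumes "coeff_ring K"
  shows "set us \<subseteq> V \<Longrightarrow> wdg us \<in> subalg K V"
proof (induction us)
  case (Cons v us)
  then show ?case
    using assms by (auto simp: ext_def coeff_ring_of_BB BB_half intro!: subalg.intros subalg_sign)
qed (simp add: subalg_1 assms)

lemma subalg_scal:
  assumes "coeff_ring K" "A \<in> spolys K Y"
  shows "scal x A \<in> subalg K (insert x Y)"
  using assms(2)
proof (induction rule: spolys_induct)
  case (pconst c)
  then show ?case using assms(1) by (auto intro!: subalg.cst coeff_ring_0 coeff_ring_1)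
next
  case (pvar u)
  then show ?case
    by (auto simp: svars_def anticomm_def power2_eq_square intro!: subalg.intros)
qed (auto simp: scal_add scal_mult intro: subalg.add subalg.mult)

lemma scal_bil: "scal x (bil x u v) = anticomm (rgen u) (rgen v)"
proof -
  have "cst 2 * rgen x ^ 2 = anticomm (rgen x) (rgen x :: 'a ralg)"
    by (simp add: cst_numeral anticomm_def power2_eq_square mult_2)
  then show ?thesis by (auto simp: bil_def scal_mult anticomm_commute)
qed

locale frame =
  fixes x :: 'v and ys :: "'v list"
  assumes distinct_ys: "distinct ys" and x_notin: "x \<notin> set ys"
begin

lemma isets_finite [simp]: "finite (isets ys)"
  by (simp add: isets_def)

text \<open>Inverse to \<open>nths ys\<close> on index sets. It looks only at the set of entries, so
  it is insensitive to order and to an additional \<open>x\<close>.\<close>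

definition index_set :: "'v list \<Rightarrow> nat set" where
  "index_set us = {i. i < length ys \<and> ys ! i \<in> set us}"

lemma index_set_isets [simp]: "index_set us \<in> isets ys"
  by (auto simp: index_set_def isets_def)

lemma set_nths_iff: "I \<in> isets ys \<Longrightarrow> i < length ys \<Longrightarrow> ys ! i \<in> set (nths ys I) \<longleftrightarrow> i \<in> I"
  using distinct_ys by (auto simp: set_nths isets_def nth_eq_iff_index_eq)

lemma index_set_nths: "I \<in> isets ys \<Longrightarrow> index_set (nths ys I) = I"
  using set_nths_iff[of I] by (auto simp: index_set_def isets_def)

lemma index_set_Cons_x: "index_set (x # us) = index_set us"
  using x_notin by (auto simp: index_set_def)

lemma x_notin_nths [simp]: "x \<notin> set (nths ys I)"
  using x_notin by simp

lemma mset_nths_index_set: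
  assumes "distinct us" "set us \<subseteq> set ys"
  shows "mset us = mset (nths ys (index_set us))"
proof -
  have "set (nths ys (index_set us)) = set us"
    using assms(2) by (auto simp: set_nths index_set_def in_set_conv_nth) (metis in_mono in_set_conv_nth nth_mem)
  then show ?thesis using assms(1) distinct_ys by (metis set_eq_iff_mset_eq_distinct distinct_nthsI)
qed

lemma card_isets: "I \<in> isets ys \<Longrightarrow> length (nths ys I) = card I"
  unfolding length_nths isets_def by (rule arg_cong[where f = card]) auto

definition combine :: "(nat set \<Rightarrow> 'v spoly) \<Rightarrow> (nat set \<Rightarrow> 'v spoly) \<Rightarrow> 'v ralg" where
  "combine A B = (\<Sum>I\<in>isets ys. yw ys I * scal x (A I) + xw x ys I * scal x (B I))"

lemma yw_eq: "yw ys I = wdg (nths ys I)" and xw_eq: "xw x ys I = wdg (x # nths ys I)"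
  by (simp_all only: yw_def xw_def wedge_eq_wdg)

text \<open>Both sectors enter \<open>wdg_independent\<close> at once: sublists of \<open>ys\<close>
  with and without a leading \<open>x\<close> are told apart by whether they contain
  \<open>x\<close>, and their sets determine them.\<close>

lemma combine_eq_0:
  assumes "\<And>I. I \<in> isets ys \<Longrightarrow> A I \<in> spolys UNIV (set ys) \<and> B I \<in> spolys UNIV (set ys)"
    and "combine A B = 0" "I \<in> isets ys"
  shows "A I = 0" "B I = 0"
proof -
  define D1 D2 where "D1 = nths ys ` isets ys" and "D2 = (\<lambda>I. x # nths ys I) ` isets ys"
  define C where "C us = (if x \<in> set us then B (index_set us) else A (index_set us))" for us
  have inj: "inj_on (nths ys) (isets ys)" "inj_on (\<lambda>I. x # nths ys I) (isets ys)"
    by (auto intro!: inj_onI dest: arg_cong[where f = index_set] simp: index_set_nths)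
  have disj: "D1 \<inter> D2 = {}" by (auto simp: D1_def D2_def) (metis x_notin_nths list.set_intros(1))
  have "(\<Sum>us\<in>D1 \<union> D2. wdg us * scal x (C us)) = (\<Sum>us\<in>D1. wdg us * scal x (C us)) + (\<Sum>us\<in>D2. wdg us * scal x (C us))"
    by (rule sum.union_disjoint) (auto simp: D1_def D2_def disj[unfolded D1_def D2_def])
  also have "(\<Sum>us\<in>D1. wdg us * scal x (C us)) = (\<Sum>I\<in>isets ys. yw ys I * scal x (A I))"
    unfolding D1_def sum.reindex[OF inj(1)] by (intro sum.cong) (auto simp: C_def yw_eq index_set_nths)
  also have "(\<Sum>us\<in>D2. wdg us * scal x (C us)) = (\<Sum>I\<in>isets ys. xw x ys I * scal x (B I))"
    unfolding D2_def sum.reindex[OF inj(2)]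
    by (intro sum.cong) (auto simp: C_def xw_eq index_set_nths index_set_Cons_x)
  finally have sum: "(\<Sum>us\<in>D1 \<union> D2. wdg us * scal x (C us)) = 0"
    using assms(2) by (simp add: combine_def sum.distrib)
  have sp: "spolys UNIV (set ys) \<subseteq> spolys UNIV (- {x})"
    using x_notin by (intro spolys_mono) auto
  have *: "C us = 0" if "us \<in> D1 \<union> D2" for us
  proof (rule wdg_independent[OF _ _ _ _ sum that])
    show "finite (D1 \<union> D2)" by (simp add: D1_def D2_def)
    show "inj_on set (D1 \<union> D2)"
    proof (rule inj_onI)
      fix us vs assume "us \<in> D1 \<union> D2" "vs \<in> D1 \<union> D2" "set us = set vs"
      moreover from this(3) have "index_set us = index_set vs" by (simp add: index_set_def)
      ultimately show "us = vs"
        by (auto simp: D1_def D2_def index_set_nths index_set_Cons_x)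
           (metis x_notin_nths insertI1)+
    qed
    show "distinct us" if "us \<in> D1 \<union> D2" for us
      using that distinct_ys by (auto simp: D1_def D2_def)
    show "C us \<in> spolys UNIV (- {x})" if "us \<in> D1 \<union> D2" for us
      using assms(1)[of "index_set us"] sp by (auto simp: C_def)
  qed
  show "A I = 0" using *[of "nths ys I"] assms(3) by (simp add: D1_def C_def index_set_nths)
  show "B I = 0" using *[of "x # nths ys I"] assms(3) by (simp add: D2_def C_def index_set_nths index_set_Cons_x)
qed

lemma combine_diff: "combine A B - combine A' B' = combine (\<lambda>I. A I - A' I) (\<lambda>I. B I - B' I)"
proof -
  have "scal x (f - g) = scal x f - scal x g" for f g
    using scal_add[of x "f - g" g] by (simp add: eq_diff_eq)
  then show ?thesis
    by (simp add: combine_def right_diff_distrib flip: sum_subtractf) (simp add: algebra_simps)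
qed

lemma spolys_diff: "f \<in> spolys UNIV Y \<Longrightarrow> g \<in> spolys UNIV Y \<Longrightarrow> f - g \<in> spolys UNIV Y"
  using spolys_add[OF coeff_ring_UNIV, of f Y "- g"] spolys_uminus[OF coeff_ring_UNIV, of g Y] by simp

text \<open>Independence makes the definite description in \<open>coords\<close> meaningful; the
  value 0 outside \<open>isets ys\<close> is its normalization.\<close>

lemma coords_combine:
  assumes "\<And>I. I \<in> isets ys \<Longrightarrow> A I \<in> spolys UNIV (set ys)" "\<And>I. I \<in> isets ys \<Longrightarrow> B I \<in> spolys UNIV (set ys)"
  shows "coords x ys (combine A B) =
    ((\<lambda>I. if I \<in> isets ys then A I else 0), (\<lambda>I. if I \<in> isets ys then B I else 0))"
  unfolding coords_def
proof (rule the_equality, goal_cases)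
  case 1
  have "combine A B = combine (\<lambda>I. if I \<in> isets ys then A I else 0) (\<lambda>I. if I \<in> isets ys then B I else 0)"
    by (simp add: combine_def)
  then show ?case using assms by (simp add: combine_def[symmetric])
next
  case (2 p)
  obtain A' B' where p: "p = (A', B')" by (cases p)
  with 2 have sp: "\<And>I. A' I \<in> spolys UNIV (set ys)" "\<And>I. B' I \<in> spolys UNIV (set ys)"
    and 0: "\<And>I. I \<notin> isets ys \<Longrightarrow> A' I = 0 \<and> B' I = 0" and "combine A B = combine A' B'"
    by (simp_all add: combine_def)
  then have "combine (\<lambda>I. A I - A' I) (\<lambda>I. B I - B' I) = 0" by (simp flip: combine_diff)
  from combine_eq_0[OF _ this] assms sp have "A I - A' I = 0 \<and> B I - B' I = 0" if "I \<in> isets ys" for I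
    using that by (simp add: spolys_diff)
  then show ?case using 0 by (auto simp: p fun_eq_iff)
qed

lemma sector_op_combine:
  assumes "\<And>I. I \<in> isets ys \<Longrightarrow> A I \<in> spolys UNIV (set ys)" "\<And>I. I \<in> isets ys \<Longrightarrow> B I \<in> spolys UNIV (set ys)"
  shows "sector_op x ys f g (combine A B) = (\<Sum>I\<in>isets ys. f I (A I) + g I (B I))"
  using coords_combine[OF assms] by (simp add: sector_op_def)

lemma combine_add: "combine A B + combine A' B' = combine (\<lambda>I. A I + A' I) (\<lambda>I. B I + B' I)"
  by (simp add: combine_def scal_add distrib_left algebra_simps flip: sum.distrib)

section \<open>Spans of the two sectors over a coefficient ring\<close>

definition spanY :: "qfield set \<Rightarrow> 'v ralg set" where
  "spanY K = {combine A (\<lambda>_. 0) |A. \<forall>I. A I \<in> spolys K (set ys)}"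

definition spanX :: "qfield set \<Rightarrow> 'v ralg set" where
  "spanX K = {combine (\<lambda>_. 0) B |B. \<forall>I. B I \<in> spolys K (set ys)}"

lemma combine_restrict:
  "combine A B = combine (\<lambda>I. if I \<in> isets ys then A I else 0) (\<lambda>I. if I \<in> isets ys then B I else 0)"
  by (simp add: combine_def)

lemma spanYI: "(\<And>I. I \<in> isets ys \<Longrightarrow> A I \<in> spolys K (set ys)) \<Longrightarrow> combine A (\<lambda>_. 0) \<in> spanY K"
  and spanXI: "(\<And>I. I \<in> isets ys \<Longrightarrow> A I \<in> spolys K (set ys)) \<Longrightarrow> combine (\<lambda>_. 0) A \<in> spanX K"
  by (subst combine_restrict, auto simp: spanY_def spanX_def)+

lemma spanYE:
  assumes "z \<in> spanY K"
  obtains A where "z = combine A (\<lambda>_. 0)" "\<And>I. A I \<in> spolys K (set ys)"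
  using assms by (auto simp: spanY_def)

lemma spanXE:
  assumes "z \<in> spanX K"
  obtains B where "z = combine (\<lambda>_. 0) B" "\<And>I. B I \<in> spolys K (set ys)"
  using assms by (auto simp: spanX_def)

lemma spanX_add:
  assumes "coeff_ring K" "u \<in> spanX K" "v \<in> spanX K"
  shows "u + v \<in> spanX K"
  using assms(2,3) by (elim spanXE) (simp add: combine_add spanXI spolys_add assms(1))

lemma spanY_0: "0 \<in> spanY K" and spanX_0: "0 \<in> spanX K"
  by (auto simp: spanY_def spanX_def combine_def intro!: exI[of _ "\<lambda>_. 0"])

lemma spanX_sum: "coeff_ring K \<Longrightarrow> (\<And>i. i \<in> I \<Longrightarrow> f i \<in> spanX K) \<Longrightarrow> sum f I \<in> spanX K"
  by (induction I rule: infinite_finite_induct) (auto simp: spanX_0 spanX_add)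

lemma yw_in_spanY:
  assumes "I \<in> isets ys" "A \<in> spolys K (set ys)"
  shows "yw ys I * scal x A \<in> spanY K"
proof -
  have "combine (\<lambda>J. if J = I then A else 0) (\<lambda>_. 0) = (\<Sum>J\<in>isets ys. if J = I then yw ys I * scal x A else 0)"
    unfolding combine_def by (rule sum.cong) auto
  also have "\<dots> = yw ys I * scal x A" using assms(1) by simp
  finally show ?thesis using assms(2) by (auto simp: spanY_def intro!: exI[of _ "\<lambda>J. if J = I then A else 0"])
qed

lemma xw_in_spanX:
  assumes "I \<in> isets ys" "A \<in> spolys K (set ys)"
  shows "xw x ys I * scal x A \<in> spanX K"
proof -
  have "combine (\<lambda>_. 0) (\<lambda>J. if J = I then A else 0) = (\<Sum>J\<in>isets ys. if J = I then xw x ys I * scal x A else 0)"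
    unfolding combine_def by (rule sum.cong) auto
  also have "\<dots> = xw x ys I * scal x A" using assms(1) by simp
  finally show ?thesis using assms(2) by (auto simp: spanX_def intro!: exI[of _ "\<lambda>J. if J = I then A else 0"])
qed

text \<open>Sorting the list into the order of \<open>ys\<close> costs a sign, which by
  \<open>wdg_perm\<close> is the same with and without \<open>x\<close> in front.\<close>

lemma wdg_basis:
  assumes "distinct us" "set us \<subseteq> set ys"
  obtains I where "I \<in> isets ys" "card I = length us" "wdg us = yw ys I" "wdg (x # us) = xw x ys I"
  | I where "I \<in> isets ys" "card I = length us" "wdg us = - yw ys I" "wdg (x # us) = - xw x ys I"
proof -
  have m: "mset us = mset (nths ys (index_set us))" by (rule mset_nths_index_set[OF assms])
  then have "card (index_set us) = length us" using card_isets[of "index_set us"] by (metis index_set_isets mset_eq_length)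
  then show ?thesis
    using wdg_perm[OF m] that[of "index_set us"] unfolding yw_eq xw_eq by (metis index_set_isets)
qed

lemma wdg_in_spanY:
  assumes "coeff_ring K" "set us \<subseteq> set ys" "A \<in> spolys K (set ys)"
  shows "wdg us * scal x A \<in> spanY K"
proof (cases "distinct us")
  case True
  have "wdg us * scal x A = yw ys I * scal x A \<or> wdg us * scal x A = yw ys I * scal x (- A)"
    if "wdg us = yw ys I \<or> wdg us = - yw ys I" for I
    using that by (auto simp: scal_uminus)
  then show ?thesis
    using wdg_basis[OF True assms(2)] yw_in_spanY[OF _ assms(3)] yw_in_spanY[OF _ spolys_uminus[OF assms(1,3)]]
    by metis
qed (simp add: wdg_not_distinct spanY_0)

lemma wdg_Cons_in_spanX:
  assumes "coeff_ring K" "set us \<subseteq> set ys" "A \<in> spolys K (set ys)"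
  shows "wdg (x # us) * scal x A \<in> spanX K"
proof (cases "distinct us")
  case True
  have "wdg (x # us) * scal x A = xw x ys I * scal x A \<or> wdg (x # us) * scal x A = xw x ys I * scal x (- A)"
    if "wdg (x # us) = xw x ys I \<or> wdg (x # us) = - xw x ys I" for I
    using that by (auto simp only: scal_uminus mult_minus_left mult_minus_right)
  then show ?thesis
    using wdg_basis[OF True assms(2)] xw_in_spanX[OF _ assms(3)] xw_in_spanX[OF _ spolys_uminus[OF assms(1,3)]]
    by metis
qed (simp add: wdg_not_distinct spanX_0)

lemma wdg_in_spanX:
  assumes "coeff_ring K" "x \<in> set us" "set us \<subseteq> insert x (set ys)" "A \<in> spolys K (set ys)"
  shows "wdg us * scal x A \<in> spanX K"
proof (cases "distinct us")
  case True
  obtain as bs where us: "us = as @ x # bs" using assms(2) by (auto dest: split_list)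
  with True assms(3) have sub: "set (as @ bs) \<subseteq> set ys" by auto
  have "wdg us * scal x A = wdg (x # as @ bs) * scal x A \<or> wdg us * scal x A = wdg (x # as @ bs) * scal x (- A)"
    unfolding us wdg_middle by (cases "even (length as)") (auto simp: scal_uminus simp del: wdg.simps)
  then show ?thesis
    using wdg_Cons_in_spanX[OF assms(1) sub assms(4)]
      wdg_Cons_in_spanX[OF assms(1) sub spolys_uminus[OF assms(1,4)]] by metis
qed (simp add: wdg_not_distinct spanX_0)

definition span :: "qfield set \<Rightarrow> 'v ralg set" where
  "span K = {combine A B |A B. \<forall>I. A I \<in> spolys K (set ys) \<and> B I \<in> spolys K (set ys)}"

lemma combine_split: "combine A B = combine A (\<lambda>_. 0) + combine (\<lambda>_. 0) B"
  by (simp add: combine_add)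

lemma spanI:
  assumes "\<And>I. I \<in> isets ys \<Longrightarrow> A I \<in> spolys K (set ys)" "\<And>I. I \<in> isets ys \<Longrightarrow> B I \<in> spolys K (set ys)"
  shows "combine A B \<in> span K"
proof -
  have "combine (\<lambda>I. if I \<in> isets ys then A I else 0) (\<lambda>I. if I \<in> isets ys then B I else 0) \<in> span K"
    unfolding span_def using assms by (intro CollectI exI conjI allI refl) auto
  then show ?thesis by (simp flip: combine_restrict)
qed

lemma spanE:
  assumes "z \<in> span K"
  obtains A B where "z = combine A B" "\<And>I. A I \<in> spolys K (set ys)" "\<And>I. B I \<in> spolys K (set ys)"
  using assms by (auto simp: span_def)

lemma span_add:
  assumes "coeff_ring K" "u \<in> span K" "v \<in> span K"
  shows "u + v \<in> span K"
  using assms(2,3) by (elim spanE) (simp add: combine_add spanI spolys_add assms(1))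

lemma spanY_subset: "spanY K \<subseteq> span K" and spanX_subset: "spanX K \<subseteq> span K"
  by (auto simp: spanY_def spanX_def span_def; metis spolys_0)+

lemma span_sum: "coeff_ring K \<Longrightarrow> (\<And>i. i \<in> I \<Longrightarrow> f i \<in> span K) \<Longrightarrow> sum f I \<in> span K"
  using spanX_0 spanX_subset by (induction I rule: infinite_finite_induct) (auto simp: span_add)

lemma wdg_in_span:
  assumes "coeff_ring K" "set us \<subseteq> insert x (set ys)" "A \<in> spolys K (set ys)"
  shows "wdg us * scal x A \<in> span K"
proof (cases "x \<in> set us")
  case True
  then show ?thesis using wdg_in_spanX[OF assms(1) _ assms(2,3)] spanX_subset by blast
next
  case False
  then show ?thesis using wdg_in_spanY[OF assms(1) _ assms(3)] assms(2) spanY_subset by blast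
qed

lemma bil_spolys:
  "coeff_ring K \<Longrightarrow> u \<in> insert x (set ys) \<Longrightarrow> v \<in> insert x (set ys) \<Longrightarrow> bil x u v \<in> spolys K (set ys)"
proof -
  assume K: "coeff_ring K" and "u \<in> insert x (set ys)" "v \<in> insert x (set ys)"
  then have uv: "u = x \<or> u \<in> set ys" "v = x \<or> v \<in> set ys" by auto
  have "2 \<in> K" using coeff_ring_add[OF K coeff_ring_1[OF K] coeff_ring_1[OF K]] by simp
  moreover have "C_var (Upair u v) \<in> svars (set ys)" if "u \<noteq> x" "v \<noteq> x"
    using uv that unfolding svars_def by blast
  moreover have "S_var w \<in> svars (set ys)" if "w \<in> set ys" for w
    using that unfolding svars_def by blast
  moreover have "R_var \<in> svars (set ys)" unfolding svars_def by blast
  ultimately show ?thesis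
    using K uv by (auto simp: bil_def intro!: spolys_mult spolys_pvar spolys_pconst)
qed

lemma set_nths_ys: "set (nths ys I) \<subseteq> set ys"
  by (rule set_nths_subset)

lemma span_image:
  assumes "coeff_ring K" "\<And>a b. T (a + b) = T a + T b"
    and "\<And>us A. set us \<subseteq> insert x (set ys) \<Longrightarrow> A \<in> spolys K (set ys) \<Longrightarrow> T (wdg us * scal x A) \<in> span K"
    and "z \<in> span K"
  shows "T z \<in> span K"
proof -
  have "T 0 = 0" using assms(2)[of 0 0] by simp
  then have T_sum: "T (sum f I) = (\<Sum>i\<in>I. T (f i))" for f and I :: "nat set set"
    by (induction I rule: infinite_finite_induct) (auto simp: assms(2))
  obtain A B where z: "z = combine A B" and "\<And>I. A I \<in> spolys K (set ys)" "\<And>I. B I \<in> spolys K (set ys)"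
    using assms(4) by (auto simp: span_def)
  then show ?thesis
    unfolding z combine_def T_sum assms(2) yw_eq xw_eq
    using set_nths_ys assms(1) by (intro span_sum span_add assms(3)) fastforce+
qed

text \<open>The span contains 1 and is stable under left multiplication by generators:
  \<open>left_mult_ext_ctr\<close> turns a vector times a wedge into a longer wedge plus wedges with
  one entry deleted, whose coefficients are values of \<open>bil\<close>.\<close>

lemma subalg_eq_span:
  assumes "coeff_ring K"
  shows "subalg K (insert x (set ys)) = span K"
proof
  show "span K \<subseteq> subalg K (insert x (set ys))"
    using set_nths_ys
    by (auto simp: span_def combine_def yw_eq xw_eq simp del: wdg.simps
        intro!: subalg_sum subalg.add subalg.mult subalg_wdg subalg_scal assms; blast)
  have "\<forall>z\<in>span K. a * z \<in> span K" if "a \<in> subalg K (insert x (set ys))" for a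
    using that
  proof induction
    case (cst c)
    show ?case
    proof
      fix z assume "z \<in> span K"
      then show "cst c * z \<in> span K"
      proof (rule span_image[where T = "\<lambda>z. cst c * z", OF assms, rotated 2])
        fix us A assume *: "set us \<subseteq> insert x (set ys)" "A \<in> spolys K (set ys)"
        have "cst c * (wdg us * scal x A) = wdg us * scal x (pconst c * A)"
          by (simp add: scal_mult central_left_commute[OF central_cst[of c], of "wdg us"])
        then show "cst c * (wdg us * scal x A) \<in> span K"
          using * cst assms by (simp only:) (intro wdg_in_span spolys_mult spolys_pconst)
      qed (simp add: distrib_left)
    qed
  next
    case (gen v)
    show ?case
    proof
      fix z assume "z \<in> span K"
      then show "rgen v * z \<in> span K"
      proof (rule span_image[where T = "\<lambda>z. rgen v * z", OF assms, rotated 2])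
        fix us A assume *: "set us \<subseteq> insert x (set ys)" "A \<in> spolys K (set ys)"
        have "rgen v * (wdg us * scal x A) =
            (ext (length us) v (wdg us) + cst (1 / 2) * ctr (length us) v (wdg us)) * scal x A"
          by (simp only: mult.assoc left_mult_ext_ctr[of v "wdg us" "length us", symmetric])
        also have "\<dots> = wdg (v # us) * scal x A
            + (\<Sum>k<length us. wdg (take k us @ drop (Suc k) us) *
                scal x (pconst (1 / 2) * (pconst ((- 1) ^ k) * (bil x (us ! k) v * A))))"
          unfolding ctr_wdg distrib_right
            sum_distrib_left sum_distrib_right wdg.simps
        proof (intro arg_cong2[where f = "(+)"] sum.cong refl)
          fix k
          let ?w = "wdg (take k us @ drop (Suc k) us)" and ?b = "anticomm (rgen (us ! k)) (rgen v)"
          define c :: "'v ralg" where "c = cst (1 / 2) * ((- 1) ^ k * ?b)"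
          have "central c" unfolding c_def
            by (intro central_mult central_cst central_anticomm) (metis central_cst cst_neg1_power)
          have "cst (1 / 2) * ((- 1) ^ k * (?b * ?w)) * scal x A = c * ?w * scal x A"
            by (simp add: c_def mult.assoc)
          also have "\<dots> = ?w * (c * scal x A)"
            using \<open>central c\<close> by (simp add: centralD[OF \<open>central c\<close>, of ?w, symmetric] mult.assoc)
          finally show "cst (1 / 2) * ((- 1) ^ k * (?b * ?w)) * scal x A =
              ?w * scal x (pconst (1 / 2) * (pconst ((- 1) ^ k) * (bil x (us ! k) v * A)))"
            by (simp add: c_def scal_mult scal_bil cst_neg1_power mult.assoc)
        qed
        also have "\<dots> \<in> span K"
        proof (intro span_add assms wdg_in_span span_sum)
          fix k assume "k \<in> {..<length us}"
          then have "us ! k \<in> set us" by simp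
          then show "pconst (1 / 2) * (pconst ((- 1) ^ k) * (bil x (us ! k) v * A)) \<in> spolys K (set ys)"
            using * gen assms
            by (intro spolys_mult spolys_pconst bil_spolys coeff_ring_of_BB[OF assms BB_half]
                coeff_ring_of_BB[OF assms BB_sign]) auto
          show "set (take k us @ drop (Suc k) us) \<subseteq> insert x (set ys)"
            using *(1) set_take_subset[of k us] set_drop_subset[of "Suc k" us] by auto
        qed (use * gen in auto)
        finally show "rgen v * (wdg us * scal x A) \<in> span K" .
      qed (simp add: distrib_left)
    qed
  next
    case (add a b)
    then show ?case by (simp add: distrib_right span_add assms)
  next
    case (mult a b)
    then show ?case by (simp add: mult.assoc)
  qed
  moreover have "1 \<in> span K"
    using wdg_in_span[OF assms, of "[]" 1] spolys_pconst[OF coeff_ring_1[OF assms], of "set ys"] by simp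
  ultimately show "subalg K (insert x (set ys)) \<subseteq> span K" by force
qed

section \<open>Operators given sector by sector\<close>

definition additive_family :: "(nat set \<Rightarrow> 'v spoly \<Rightarrow> 'v ralg) \<Rightarrow> bool" where
  "additive_family f \<longleftrightarrow>
     (\<forall>I. \<forall>A\<in>spolys UNIV (set ys). \<forall>B\<in>spolys UNIV (set ys). f I (A + B) = f I A + f I B)"

lemma additive_familyD:
  assumes "additive_family f"
  shows "A \<in> spolys UNIV (set ys) \<Longrightarrow> B \<in> spolys UNIV (set ys) \<Longrightarrow> f I (A + B) = f I A + f I B"
    and "f I 0 = 0" and "A \<in> spolys UNIV (set ys) \<Longrightarrow> f I (- A) = - f I A"
proof -
  show *: "A \<in> spolys UNIV (set ys) \<Longrightarrow> B \<in> spolys UNIV (set ys) \<Longrightarrow> f I (A + B) = f I A + f I B" for A B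
    using assms by (simp add: additive_family_def)
  show **: "f I 0 = 0" using *[of 0 0] by simp
  show "A \<in> spolys UNIV (set ys) \<Longrightarrow> f I (- A) = - f I A"
    using *[of A "- A"] ** by (simp add: eq_neg_iff_add_eq_0 add.commute spolys_uminus coeff_ring_UNIV)
qed

lemma sector_op_add:
  assumes "additive_family f" "additive_family g" "u \<in> span UNIV" "v \<in> span UNIV"
  shows "sector_op x ys f g (u + v) = sector_op x ys f g u + sector_op x ys f g v"
proof -
  obtain A B A' B' where "u = combine A B" "v = combine A' B'"
    and "\<And>I. A I \<in> spolys UNIV (set ys)" "\<And>I. B I \<in> spolys UNIV (set ys)"
      "\<And>I. A' I \<in> spolys UNIV (set ys)" "\<And>I. B' I \<in> spolys UNIV (set ys)"
    using assms(3,4) by (auto simp: span_def)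
  then show ?thesis
    by (simp add: combine_add sector_op_combine spolys_add coeff_ring_UNIV
        additive_familyD[OF assms(1)] additive_familyD[OF assms(2)] algebra_simps flip: sum.distrib)
qed

lemma sector_op_yw:
  assumes "additive_family f" "additive_family g" "I \<in> isets ys" "A \<in> spolys UNIV (set ys)"
  shows "sector_op x ys f g (yw ys I * scal x A) = f I A"
proof -
  have "yw ys I * scal x A = combine (\<lambda>J. if J = I then A else 0) (\<lambda>_. 0)"
    using assms(3) by (simp add: combine_def if_distrib[of "scal x"] if_distrib[of "times _"] cong: if_cong)
  moreover have "f J (if J = I then A else 0) = (if J = I then f I A else 0)" for J
    by (simp add: additive_familyD[OF assms(1)] additive_familyD[OF assms(2)])
  then have "sector_op x ys f g (combine (\<lambda>J. if J = I then A else 0) (\<lambda>_. 0)) = (\<Sum>J\<in>isets ys. if J = I then f I A else 0)"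
    using assms by (subst sector_op_combine)
      (auto simp: additive_familyD[OF assms(1)] additive_familyD[OF assms(2)])
  ultimately show ?thesis using assms(3) by simp
qed

lemma sector_op_xw:
  assumes "additive_family f" "additive_family g" "I \<in> isets ys" "A \<in> spolys UNIV (set ys)"
  shows "sector_op x ys f g (xw x ys I * scal x A) = g I A"
proof -
  have "xw x ys I * scal x A = combine (\<lambda>_. 0) (\<lambda>J. if J = I then A else 0)"
    using assms(3) by (simp add: combine_def if_distrib[of "scal x"] if_distrib[of "times _"] cong: if_cong)
  moreover have "g J (if J = I then A else 0) = (if J = I then g I A else 0)" for J
    by (simp add: additive_familyD[OF assms(1)] additive_familyD[OF assms(2)])
  then have "sector_op x ys f g (combine (\<lambda>_. 0) (\<lambda>J. if J = I then A else 0)) = (\<Sum>J\<in>isets ys. if J = I then g I A else 0)"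
    using assms by (subst sector_op_combine)
      (auto simp: additive_familyD[OF assms(1)] additive_familyD[OF assms(2)])
  ultimately show ?thesis using assms(3) by simp
qed

text \<open>If the value on a basis element is one expression \<open>F\<close> in \<open>y_I\<close>
  and \<open>x \<and> y_I\<close>, odd in both together, the same expression is valid for the wedge
  of any distinct list. The ordering of \<open>ys\<close> thereby disappears, which is what
  enlargement needs.\<close>

lemma sector_op_wdg:
  assumes "additive_family f" "additive_family g" "distinct us" "set us \<subseteq> set ys" "A \<in> spolys UNIV (set ys)"
    and f: "\<And>I. I \<in> isets ys \<Longrightarrow> card I = length us \<Longrightarrow> f I A = F (yw ys I) (xw x ys I)"
    and F: "\<And>a b. F (- a) (- b) = - F a b"
  shows "sector_op x ys f g (wdg us * scal x A) = F (wdg us) (wdg (x # us))"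
  using assms(3,4)
proof (cases rule: wdg_basis)
  case (1 I)
  then show ?thesis using sector_op_yw[OF assms(1,2) _ assms(5)] f by (simp del: wdg.simps)
next
  case (2 I)
  then have "wdg us * scal x A = yw ys I * scal x (- A)" by (simp add: scal_uminus)
  then show ?thesis
    using 2 sector_op_yw[OF assms(1,2) 2(1) spolys_uminus[OF coeff_ring_UNIV assms(5)]] f
    by (simp add: additive_familyD[OF assms(1)] F assms(5) del: wdg.simps)
qed

lemma sector_op_wdg_Cons:
  assumes "additive_family f" "additive_family g" "distinct us" "set us \<subseteq> set ys" "A \<in> spolys UNIV (set ys)"
    and g: "\<And>I. I \<in> isets ys \<Longrightarrow> card I = length us \<Longrightarrow> g I A = F (yw ys I) (xw x ys I)"
    and F: "\<And>a b. F (- a) (- b) = - F a b"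
  shows "sector_op x ys f g (wdg (x # us) * scal x A) = F (wdg us) (wdg (x # us))"
  using assms(3,4)
proof (cases rule: wdg_basis)
  case (1 I)
  then show ?thesis using sector_op_xw[OF assms(1,2) _ assms(5)] g by (simp del: wdg.simps)
next
  case (2 I)
  then have "wdg (x # us) * scal x A = xw x ys I * scal x (- A)" by (simp only: scal_uminus mult_minus_left mult_minus_right)
  then show ?thesis
    using 2 sector_op_xw[OF assms(1,2) 2(1) spolys_uminus[OF coeff_ring_UNIV assms(5)]] g
    by (simp add: additive_familyD[OF assms(2)] F assms(5) del: wdg.simps)
qed

end

section \<open>The operators on the free basis\<close>

lemma qsubst_0 [simp]: "qsubst u P 0 = 0"
  by (rule poly_mapping_eqI) (simp add: lookup_qsubst)

lemma qsubst_sum: "qsubst u P (sum f I) = (\<Sum>i\<in>I. qsubst u P (f i))"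
  by (induction I rule: infinite_finite_induct) (simp_all add: qsubst_add)

lemma qsubst_pvar_mult:
  assumes "u \<noteq> w"
  shows "qsubst u P (pvar w * B) = pvar w * qsubst u P B"
proof (rule poly_mapping_eqI)
  fix l :: "'a svar \<Rightarrow>\<^sub>0 nat"
  let ?e = "Poly_Mapping.single w (1::nat)"
  show "Poly_Mapping.lookup (qsubst u P (pvar w * B)) l = Poly_Mapping.lookup (pvar w * qsubst u P B) l"
  proof (cases "\<exists>k. l = ?e + k")
    case True
    then obtain k where l: "l = ?e + k" by blast
    have "Poly_Mapping.lookup l u = Poly_Mapping.lookup k u"
      using assms by (simp add: l lookup_add lookup_single when_def)
    moreover have "Poly_Mapping.lookup (pvar w * C) l = Poly_Mapping.lookup C k" for C :: "'a spoly"
      unfolding l pvar_def lookup_single_mult by simp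
    ultimately show ?thesis by (simp add: lookup_qsubst)
  next
    case False
    then show ?thesis by (simp add: lookup_qsubst pvar_def lookup_single_mult_eq_0)
  qed
qed

lemma dsc_add: "dsc x ys (A + B) = dsc x ys A + dsc x ys B"
  by (simp add: dsc_def jackson_add qsubst_add scal_add distrib_left sum.distrib algebra_simps)

lemma subalg_dsc:
  assumes "coeff_ring K" "A \<in> spolys K (set ys)"
  shows "dsc x ys A \<in> subalg K (insert x (set ys))"
proof -
  have "1 + qq \<in> K" "2 \<in> K"
    using assms(1) coeff_ring_add[of K 1 1] by (simp_all add: coeff_ring_add coeff_ring_1 qq_in_coeff_ring)
  then show ?thesis
    unfolding dsc_def cst_numeral[symmetric] using assms
    by (intro subalg.add subalg.mult subalg.cst subalg.gen subalg_sum subalg_scal spolys_jackson spolys_qsubst)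
       (auto simp: qq_in_coeff_ring)
qed

text \<open>In comparison with \<open>dsc\<close>, each vector factor is replaced by half of its
  anticommutator with \<open>x\<close>, which is exactly what contraction against \<open>x\<close>
  produces.\<close>

lemma scal_Esc:
  "scal x (Esc ys A) = cst (1 + qq) * rgen x ^ 2 * scal x (jackson R_var (qq ^ 2) A)
     + (\<Sum>v\<in>set ys. anticomm (rgen x) (rgen v) * scal x (qsubst R_var (qq ^ 2) (jackson (S_var v) qq A)))"
  by (simp add: Esc_def scal_add scal_mult qsubst_sum qsubst_pvar_mult scal_sum)

text \<open>The additional summands carry a Jackson derivative in a variable that does not occur in
  \<open>A\<close>.\<close>

lemma dsc_enlarge:
  assumes "A \<in> spolys K (set ys)" "set ys \<subseteq> set zs"
  shows "dsc x zs A = dsc x ys A"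
proof -
  have "(\<Sum>v\<in>set zs. rgen v * scal x (qsubst R_var (qq ^ 2) (jackson (S_var v) qq A))) =
      (\<Sum>v\<in>set ys. rgen v * scal x (qsubst R_var (qq ^ 2) (jackson (S_var v) qq A)))"
  proof (rule sum.mono_neutral_right)
    show "\<forall>v\<in>set zs - set ys. rgen v * scal x (qsubst R_var (qq ^ 2) (jackson (S_var v) qq A)) = 0"
    proof
      fix v assume "v \<in> set zs - set ys"
      then have "jackson (S_var v) qq A = 0" by (intro jackson_eq_0[OF qq_neq_1 assms(1)]) (auto simp: svars_def)
      then show "rgen v * scal x (qsubst R_var (qq ^ 2) (jackson (S_var v) qq A)) = 0" by simp
    qed
  qed (use assms(2) in auto)
  then show ?thesis by (simp add: dsc_def)
qed

context frame
begin

lemma combine_scal: "combine A B * scal x C = combine (\<lambda>I. A I * C) (\<lambda>I. B I * C)"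
  by (simp add: combine_def sum_distrib_right distrib_right scal_mult mult.assoc)

lemma combine_cst: "cst c * combine A B = combine (\<lambda>I. pconst c * A I) (\<lambda>I. pconst c * B I)"
proof -
  have "cst c * combine A B = combine A B * scal x (pconst c)" by (simp add: cst_central)
  then show ?thesis by (simp only: combine_scal mult.commute[of "pconst c"])
qed

lemma spanX_scal:
  assumes "coeff_ring K" "z \<in> spanX K" "C \<in> spolys K (set ys)"
  shows "z * scal x C \<in> spanX K"
  using assms(2) by (elim spanXE) (simp add: combine_scal spanXI spolys_mult assms)

lemma spanX_cst: "coeff_ring K \<Longrightarrow> z \<in> spanX K \<Longrightarrow> c \<in> K \<Longrightarrow> cst c * z \<in> spanX K"
  using spanX_scal[of K z "pconst c"] by (simp add: spolys_pconst cst_central)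

lemma spanX_mono: "K \<subseteq> L \<Longrightarrow> spanX K \<subseteq> spanX L"
  using spolys_mono[of K L "set ys" "set ys"] by (auto elim!: spanXE intro!: spanXI)

lemma spolys_UNIV: "A \<in> spolys K (set ys) \<Longrightarrow> A \<in> spolys UNIV (set ys)"
  using spolys_mono[of K UNIV "set ys" "set ys"] by auto

text \<open>The only part without \<open>x\<close> arises when \<open>w\<close> is contracted
  against the leading \<open>x\<close>. The remainder consists of the longer wedge and of
  contractions against entries of \<open>us\<close>; by \<open>ext_ctr_wdg\<close> the latter put
  \<open>x\<close> in place of the contracted entry.\<close>

lemma wdg_Cons_right_mult:
  assumes "set us \<subseteq> set ys" "w \<in> insert x (set ys)"
  obtains R where "R \<in> spanX BB"
    "wdg (x # us) * rgen w = cst ((- 1) ^ length us / 2) * (anticomm (rgen x) (rgen w) * wdg us) + R"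
proof -
  define n where "n = length us"
  define Z where "Z = (\<Sum>k<n. anticomm (rgen (us ! k)) (rgen w) * wdg (us[k := x]))"
  define R where "R = cst ((- 1) ^ Suc n) * (wdg (w # x # us) + cst (1 / 2) * Z)"
  have "wdg (x # us) * rgen w = (- 1) ^ Suc n * (wdg (w # x # us)
      - cst (1 / 2) * (anticomm (rgen x) (rgen w) * wdg us - Z))"
    unfolding right_mult_ext_ctr[of _ _ "Suc n"] wdg.simps ctr_ext[of "length us"] length_Cons n_def Z_def
      ext_ctr_wdg ..
  also have "\<dots> = cst ((- 1) ^ n / 2) * (anticomm (rgen x) (rgen w) * wdg us) + R"
  proof -
    have "cst ((- 1) ^ n / 2) = cst ((- 1) ^ n) * cst (1 / 2 :: qfield)"
      by (simp flip: cst_mult)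
    then show ?thesis
      by (cases n rule: neg1_power_cases[where 'a = "'v ralg"])
         (simp_all add: R_def cst_neg1_power cst_uminus algebra_simps)
  qed
  finally have eq: "wdg (x # us) * rgen w = cst ((- 1) ^ n / 2) * (anticomm (rgen x) (rgen w) * wdg us) + R" .
  have 1: "wdg (w # x # us) \<in> spanX BB"
    using wdg_in_spanX[OF coeff_ring_BB, of "w # x # us" 1] assms subset_insertI2[OF assms(1), of x] spolys_pconst[OF BB_1, of "set ys"]
    by (simp del: wdg.simps)
  have "anticomm (rgen (us ! k)) (rgen w) * wdg (us[k := x]) \<in> spanX BB" if "k < n" for k
  proof -
    have "anticomm (rgen (us ! k)) (rgen w) * wdg (us[k := x]) = wdg (us[k := x]) * scal x (bil x (us ! k) w)"
      unfolding scal_bil by (rule centralD[symmetric]) simp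
    moreover have "x \<in> set (us[k := x])" using that by (auto simp: n_def intro: set_update_memI)
    moreover have "set (us[k := x]) \<subseteq> insert x (set ys)" using assms(1) set_update_subset_insert[of us k x] by blast
    moreover have "us ! k \<in> insert x (set ys)" using that assms(1) nth_mem[of k us] unfolding n_def by blast
    ultimately show ?thesis using assms(2) by (simp add: wdg_in_spanX coeff_ring_BB bil_spolys)
  qed
  then have "Z \<in> spanX BB" unfolding Z_def by (intro spanX_sum[OF coeff_ring_BB]) auto
  then have "R \<in> spanX BB"
    unfolding R_def by (intro spanX_cst spanX_add coeff_ring_BB 1 BB_half BB_sign)
  then show ?thesis using that eq unfolding n_def by blast
qed

text \<open>Multiply out by \<open>wdg_Cons_right_mult\<close>. The 1/2 in its leading coefficient
  is absorbed by the 2 before the sum in \<open>dsc\<close> and, for the vector \<open>x\<close>, by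
  the 2 in \<open>anticomm (rgen x) (rgen x)\<close>; the result has the shape of
  \<open>scal_Esc\<close>.\<close>

lemma xw_dsc:
  assumes K: "coeff_ring K" and A: "A \<in> spolys K (set ys)"
  shows "xw x ys I * dsc x ys A - cst ((- 1) ^ length (nths ys I)) * yw ys I * scal x (Esc ys A) \<in> spanX K"
proof -
  define us where "us = nths ys I"
  define e :: qfield where "e = (- 1) ^ length us"
  define W U where "W = wdg (x # us)" and "U = wdg us"
  define S0 S where "S0 = jackson R_var (qq ^ 2) A" and "S v = qsubst R_var (qq ^ 2) (jackson (S_var v) qq A)" for v
  have S: "S0 \<in> spolys K (set ys)" "S v \<in> spolys K (set ys)" for v
    unfolding S0_def S_def using K A by (auto intro!: spolys_jackson spolys_qsubst simp: qq_in_coeff_ring)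
  have "\<exists>R. R \<in> spanX BB \<and> W * rgen w = cst (e / 2) * (anticomm (rgen x) (rgen w) * U) + R"
    if "w \<in> insert x (set ys)" for w
    using wdg_Cons_right_mult[OF _ that, of us] set_nths_ys unfolding us_def e_def W_def U_def by metis
  then obtain R where R: "\<And>w. w \<in> insert x (set ys) \<Longrightarrow> R w \<in> spanX BB"
    and WR: "\<And>w. w \<in> insert x (set ys) \<Longrightarrow> W * rgen w = cst (e / 2) * (anticomm (rgen x) (rgen w) * U) + R w"
    by metis
  have 2: "2 * cst (e / 2) = (cst e :: 'v ralg)"
    by (simp flip: cst_numeral cst_mult)
  have Wx: "W * (cst (1 + qq) * rgen x * scal x S0) =
      cst e * U * (cst (1 + qq) * rgen x ^ 2 * scal x S0) + cst (1 + qq) * R x * scal x S0"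
  proof -
    have "anticomm (rgen x) (rgen x) = 2 * (rgen x ^ 2 :: 'v ralg)"
      by (simp add: anticomm_def power2_eq_square mult_2)
    then have "cst (e / 2) * (anticomm (rgen x) (rgen x) * U) = cst (e / 2) * 2 * rgen x ^ 2 * U"
      by (simp add: mult.assoc)
    also have "cst (e / 2) * 2 = (cst e :: 'v ralg)" using 2 by (simp add: mult_2 mult_2_right)
    finally have *: "W * rgen x = cst e * (rgen x ^ 2 * U) + R x" using WR[of x] by (simp add: mult.assoc)
    have "central (rgen x ^ 2 :: 'v ralg)" using central_sval[of x R_var] by simp
    then have **: "rgen x ^ 2 * U = U * rgen x ^ 2" by (simp add: central_def)
    have "W * (cst (1 + qq) * rgen x * scal x S0) = cst (1 + qq) * (W * rgen x) * scal x S0"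
      by (simp add: mult.assoc central_left_commute[OF central_cst, of W])
    also have "\<dots> = cst (1 + qq) * (cst e * (U * rgen x ^ 2)) * scal x S0 + cst (1 + qq) * R x * scal x S0"
      unfolding * ** by (simp add: distrib_left distrib_right)
    also have "cst (1 + qq) * (cst e * (U * rgen x ^ 2)) * scal x S0 =
        cst e * U * (cst (1 + qq) * rgen x ^ 2 * scal x S0)"
    proof -
      have "cst (1 + qq) * (cst e * (U * rgen x ^ 2)) = cst e * (U * (cst (1 + qq) * rgen x ^ 2))"
        by (simp only: central_left_commute[OF central_cst[of "1 + qq"], of U]
            central_left_commute[OF central_cst[of "1 + qq"], of "cst e"])
      then show ?thesis by (simp add: mult.assoc)
    qed
    finally show ?thesis .
  qed
  have Wv: "W * (2 * (rgen v * scal x (S v))) =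
      cst e * U * (anticomm (rgen x) (rgen v) * scal x (S v)) + cst 2 * R v * scal x (S v)"
    if "v \<in> set ys" for v
  proof -
    let ?a = "anticomm (rgen x) (rgen v) :: 'v ralg"
    have "W * (2 * (rgen v * scal x (S v))) = 2 * (W * rgen v) * scal x (S v)"
      by (simp add: mult_2 mult_2_right distrib_left distrib_right mult.assoc)
    also have "\<dots> = (2 * cst (e / 2)) * (?a * U) * scal x (S v) + 2 * R v * scal x (S v)"
      using WR[of v] that by (simp add: distrib_left distrib_right mult.assoc)
    also have "?a * U = U * ?a" by (rule centralD[symmetric]) simp
    finally show ?thesis unfolding 2 by (simp add: mult.assoc cst_numeral)
  qed
  have "W * dsc x ys A = W * (cst (1 + qq) * rgen x * scal x S0) + (\<Sum>v\<in>set ys. W * (2 * (rgen v * scal x (S v))))"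
    unfolding dsc_def S0_def S_def distrib_left sum_distrib_left ..
  also have "\<dots> = cst e * U * scal x (Esc ys A)
      + (cst (1 + qq) * R x * scal x S0 + (\<Sum>v\<in>set ys. cst 2 * R v * scal x (S v)))"
    unfolding Wx scal_Esc S0_def[symmetric] S_def[symmetric]
    by (simp add: Wv sum.distrib distrib_left sum_distrib_left)
  finally have "W * dsc x ys A - cst e * U * scal x (Esc ys A) =
      cst (1 + qq) * R x * scal x S0 + (\<Sum>v\<in>set ys. cst 2 * R v * scal x (S v))"
    by simp
  also have "\<dots> \<in> spanX K"
  proof -
    have "spanX BB \<subseteq> spanX K" using K by (intro spanX_mono) (auto simp: coeff_ring_def)
    moreover have "1 + qq \<in> K" "2 \<in> K"
      using K coeff_ring_add[of K 1 1] by (simp_all add: coeff_ring_add coeff_ring_1 qq_in_coeff_ring)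
    ultimately show ?thesis
      using K S R by (intro spanX_add spanX_sum spanX_scal spanX_cst) auto
  qed
  finally show ?thesis by (simp add: W_def U_def e_def us_def xw_eq yw_eq del: wdg.simps)
qed

lemma yw_dsc_span: "coeff_ring K \<Longrightarrow> A \<in> spolys K (set ys) \<Longrightarrow> yw ys I * dsc x ys A \<in> span K"
  and xw_dsc_span: "coeff_ring K \<Longrightarrow> A \<in> spolys K (set ys) \<Longrightarrow> xw x ys I * dsc x ys A \<in> span K"
  using set_nths_ys[of I]
  by (auto simp: yw_eq xw_eq simp del: wdg.simps simp flip: subalg_eq_span
      intro!: subalg.mult subalg_dsc subalg_wdg)

lemma span_cst: "coeff_ring K \<Longrightarrow> c \<in> K \<Longrightarrow> z \<in> span K \<Longrightarrow> cst c * z \<in> span K"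
  by (simp add: subalg.mult subalg.cst flip: subalg_eq_span)

lemma yw_span: "I \<in> isets ys \<Longrightarrow> A \<in> spolys K (set ys) \<Longrightarrow> yw ys I * scal x A \<in> span K"
  and xw_span: "I \<in> isets ys \<Longrightarrow> A \<in> spolys K (set ys) \<Longrightarrow> xw x ys I * scal x A \<in> span K"
  using yw_in_spanY spanY_subset xw_in_spanX spanX_subset by blast+

section \<open>Creation, derivative and their anticommutator in coordinates\<close>

lemma creation_combine:
  assumes "\<And>I. I \<in> isets ys \<Longrightarrow> A I \<in> spolys UNIV (set ys)" "\<And>I. I \<in> isets ys \<Longrightarrow> B I \<in> spolys UNIV (set ys)"
  shows "creation x ys (combine A B) = combine (\<lambda>_. 0) A"
  using sector_op_combine[OF assms] by (simp add: creation_def combine_def)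

lemma creation_add:
  "u \<in> span UNIV \<Longrightarrow> v \<in> span UNIV \<Longrightarrow> creation x ys (u + v) = creation x ys u + creation x ys v"
  by (elim spanE) (simp add: combine_add creation_combine spolys_add coeff_ring_UNIV)

lemma creation_spanX: "z \<in> span K \<Longrightarrow> creation x ys z \<in> spanX K"
  by (elim spanE) (simp add: creation_combine spolys_UNIV[of _ K] spanXI)

lemma creation_of_spanX: "z \<in> spanX UNIV \<Longrightarrow> creation x ys z = 0"
  by (elim spanXE) (simp add: creation_combine, simp add: combine_def)

lemma creation_yw:
  "I \<in> isets ys \<Longrightarrow> A \<in> spolys UNIV (set ys) \<Longrightarrow> creation x ys (yw ys I * scal x A) = xw x ys I * scal x A"
  unfolding creation_def
  by (rule sector_op_yw) (auto simp: additive_family_def scal_add distrib_left)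

definition vder_yw :: "nat set \<Rightarrow> 'v spoly \<Rightarrow> 'v ralg" where
  "vder_yw I A = yw ys I * dsc x ys A"

definition vder_xw :: "nat set \<Rightarrow> 'v spoly \<Rightarrow> 'v ralg" where
  "vder_xw I B = cst ((- 1) ^ card I * qmint (- int (card I))) * yw ys I * scal x B
          + cst (qmpow (- int (card I))) * xw x ys I * dsc x ys B"

lemma vder_eq: "vder x ys = sector_op x ys vder_yw vder_xw"
  by (simp add: vder_def vder_yw_def[abs_def] vder_xw_def[abs_def])

lemma additive_vder: "additive_family vder_yw" "additive_family vder_xw"
  by (auto simp: additive_family_def vder_yw_def vder_xw_def dsc_add scal_add distrib_left algebra_simps)

lemma vder_yw_scal: "I \<in> isets ys \<Longrightarrow> A \<in> spolys UNIV (set ys) \<Longrightarrow> vder x ys (yw ys I * scal x A) = vder_yw I A"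
  and vder_xw_scal: "I \<in> isets ys \<Longrightarrow> A \<in> spolys UNIV (set ys) \<Longrightarrow> vder x ys (xw x ys I * scal x A) = vder_xw I A"
  unfolding vder_eq by (intro sector_op_yw sector_op_xw additive_vder; assumption)+

lemma vder_add: "u \<in> span UNIV \<Longrightarrow> v \<in> span UNIV \<Longrightarrow> vder x ys (u + v) = vder x ys u + vder x ys v"
  unfolding vder_eq by (rule sector_op_add[OF additive_vder])

lemma vder_xw_span: "coeff_ring K \<Longrightarrow> I \<in> isets ys \<Longrightarrow> A \<in> spolys K (set ys) \<Longrightarrow> vder_xw I A \<in> span K"
  unfolding vder_xw_def mult.assoc
  by (intro span_add span_cst yw_span xw_dsc_span) (auto intro!: coeff_ring_of_BB[of K] BB.mult BB_sign BB_qmint BB_qmpow)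

lemma vder_span: "coeff_ring K \<Longrightarrow> z \<in> span K \<Longrightarrow> vder x ys z \<in> span K"
proof (elim spanE)
  fix A B assume K: "coeff_ring K" and z: "z = combine A B"
    and "\<And>I. A I \<in> spolys K (set ys)" "\<And>I. B I \<in> spolys K (set ys)"
  then show "vder x ys z \<in> span K"
    unfolding z vder_eq
    by (subst sector_op_combine) (auto simp: spolys_UNIV[of _ K] vder_yw_def intro!: span_sum span_add vder_xw_span yw_dsc_span)
qed

definition Nop_yw :: "nat set \<Rightarrow> 'v spoly \<Rightarrow> 'v ralg" where
  "Nop_yw I A = cst (qmpow (- int (card I))) * xw x ys I * dsc x ys A
          + creation x ys (yw ys I * dsc x ys A)
          - cst ((- 1) ^ card I * qmpow (- int (card I))) * yw ys I * scal x (Esc ys A)"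

text \<open>The bracket is the remainder in \<open>xw_dsc\<close>, and \<open>creation\<close> has
  values in the \<open>\<X>\<close>-sector; hence so does the off-diagonal part.\<close>

lemma Nop_yw_eq:
  "Nop_yw I A = cst (qmpow (- int (card I))) * (xw x ys I * dsc x ys A - cst ((- 1) ^ card I) * yw ys I * scal x (Esc ys A))
     + creation x ys (yw ys I * dsc x ys A)"
  by (simp add: Nop_yw_def cst_mult cst_central[of "(- 1) ^ card I"] algebra_simps)

lemma Nop_yw_spanX: "coeff_ring K \<Longrightarrow> I \<in> isets ys \<Longrightarrow> A \<in> spolys K (set ys) \<Longrightarrow> Nop_yw I A \<in> spanX K"
  unfolding Nop_yw_eq
  using xw_dsc[of K A I]
  by (intro spanX_add spanX_cst creation_spanX yw_dsc_span) (auto simp: card_isets intro!: coeff_ring_of_BB[of K] BB_qmpow)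

lemma Nop_eq: "Nop x ys = sector_op x ys Nop_yw (\<lambda>_ _. 0)"
  by (simp add: Nop_def Nop_yw_def[abs_def])

lemma Nop_combine:
  assumes "\<And>I. I \<in> isets ys \<Longrightarrow> A I \<in> spolys UNIV (set ys)" "\<And>I. I \<in> isets ys \<Longrightarrow> B I \<in> spolys UNIV (set ys)"
  shows "Nop x ys (combine A B) = (\<Sum>I\<in>isets ys. Nop_yw I (A I))"
  unfolding Nop_eq by (subst sector_op_combine[OF assms]) auto

lemma Nop_spanX:
  assumes "coeff_ring K" "\<And>I. I \<in> isets ys \<Longrightarrow> A I \<in> spolys K (set ys)" "\<And>I. I \<in> isets ys \<Longrightarrow> B I \<in> spolys K (set ys)"
  shows "Nop x ys (combine A B) \<in> spanX K"
  using assms by (subst Nop_combine) (auto simp: spolys_UNIV[of _ K] intro!: spanX_sum Nop_yw_spanX)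

lemma Hop_add: "u \<in> span UNIV \<Longrightarrow> v \<in> span UNIV \<Longrightarrow> Hop x ys (u + v) = Hop x ys u + Hop x ys v"
  using creation_spanX spanX_subset vder_span[OF coeff_ring_UNIV]
  by (simp add: Hop_def creation_add vder_add subset_iff)

text \<open>The term with \<open>Esc\<close> that \<open>Nop_yw\<close> subtracts is the one that
  \<open>diag_poly\<close> adds; the splitting is thus by sectors.\<close>

lemma Hop_yw:
  assumes "I \<in> isets ys" "A \<in> spolys UNIV (set ys)"
  shows "Hop x ys (yw ys I * scal x A) = yw ys I * scal x (diag_poly ys (card I) A) + Nop_yw I A"
proof -
  have c: "yw ys I * (cst c * a) = cst c * (yw ys I * a)" for c a
    by (rule central_left_commute) simp
  have "Hop x ys (yw ys I * scal x A) = vder_xw I A + creation x ys (yw ys I * dsc x ys A)"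
    by (simp add: Hop_def creation_yw vder_yw_scal vder_xw_scal assms vder_yw_def)
  then show ?thesis
    by (simp add: vder_xw_def Nop_yw_def diag_poly_def scal_add scal_mult distrib_left c mult.assoc)
qed

text \<open>Since \<open>creation\<close> annihilates the \<open>\<X>\<close>-sector, only creation
  after the derivative contributes, and it sees just the component along \<open>y_I\<close>. That
  component is again \<open>diag_poly\<close>, so both sectors have the same eigenvalues.\<close>

lemma Hop_xw:
  assumes "I \<in> isets ys" "A \<in> spolys UNIV (set ys)"
  shows "Hop x ys (xw x ys I * scal x A) = xw x ys I * scal x (diag_poly ys (card I) A)"
proof -
  define p where "p = card I"
  define n where "n = xw x ys I * dsc x ys A - cst ((- 1) ^ p) * yw ys I * scal x (Esc ys A)"
  have n: "n \<in> spanX UNIV"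
    using xw_dsc[OF coeff_ring_UNIV assms(2), of I] assms(1) by (simp add: n_def p_def card_isets)
  have c: "yw ys I * (cst c * a) = cst c * (yw ys I * a)" for c a
    by (rule central_left_commute) simp
  have "xw x ys I * dsc x ys A = cst ((- 1) ^ p) * yw ys I * scal x (Esc ys A) + n"
    by (simp add: n_def)
  then have "vder_xw I A = cst ((- 1) ^ p * qmint (- int p)) * (yw ys I * scal x A)
      + cst (qmpow (- int p)) * (cst ((- 1) ^ p) * (yw ys I * scal x (Esc ys A)) + n)"
    by (simp only: vder_xw_def p_def[symmetric] mult.assoc)
  also have "\<dots> = yw ys I * scal x (diag_poly ys p A) + cst (qmpow (- int p)) * n"
    by (simp add: diag_poly_def scal_add scal_mult distrib_left c cst_mult cst_central[of "(- 1) ^ p"] mult.assoc)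
  finally have v: "vder_xw I A = yw ys I * scal x (diag_poly ys p A) + cst (qmpow (- int p)) * n" .
  have D: "diag_poly ys p A \<in> spolys UNIV (set ys)" by (rule spolys_diag_poly[OF coeff_ring_UNIV assms(2)])
  have n': "cst (qmpow (- int p)) * n \<in> spanX UNIV" by (intro spanX_cst coeff_ring_UNIV n) simp
  have "creation x ys (vder_xw I A) = xw x ys I * scal x (diag_poly ys p A)"
    unfolding v using n' spanX_subset
    by (subst creation_add) (auto simp: creation_yw creation_of_spanX assms D intro!: yw_span)
  moreover have "xw x ys I * scal x A \<in> spanX UNIV" by (rule xw_in_spanX[OF assms])
  moreover have "vder x ys 0 = 0"
    using vder_add[of 0 0] spanX_0 spanX_subset by auto
  ultimately show ?thesis
    by (simp add: Hop_def creation_of_spanX vder_xw_scal assms p_def)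
qed

lemma additive_on_sum:
  fixes T :: "'v ralg \<Rightarrow> 'v ralg"
  assumes add: "\<And>u v. u \<in> span UNIV \<Longrightarrow> v \<in> span UNIV \<Longrightarrow> T (u + v) = T u + T v"
    and "\<And>I. I \<in> S \<Longrightarrow> f I \<in> span UNIV"
  shows "T (sum f S) = (\<Sum>I\<in>S. T (f I))"
proof -
  have "(0 :: 'v ralg) \<in> span UNIV" using spanX_0 spanX_subset by blast
  then have "T 0 = 0" using add[of 0 0] by simp
  then show ?thesis using assms(2)
    by (induction S rule: infinite_finite_induct) (auto simp: add span_sum coeff_ring_UNIV)
qed

lemma Hop_combine:
  assumes "\<And>I. I \<in> isets ys \<Longrightarrow> A I \<in> spolys UNIV (set ys)" "\<And>I. I \<in> isets ys \<Longrightarrow> B I \<in> spolys UNIV (set ys)"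
  shows "Hop x ys (combine A B) =
    combine (\<lambda>I. diag_poly ys (card I) (A I)) (\<lambda>I. diag_poly ys (card I) (B I)) + Nop x ys (combine A (\<lambda>_. 0))"
proof -
  have "Hop x ys (combine A B) = (\<Sum>I\<in>isets ys. Hop x ys (yw ys I * scal x (A I) + xw x ys I * scal x (B I)))"
    unfolding combine_def
    by (intro additive_on_sum Hop_add span_add coeff_ring_UNIV yw_span xw_span assms)
  also have "\<dots> = (\<Sum>I\<in>isets ys. (yw ys I * scal x (diag_poly ys (card I) (A I)) + Nop_yw I (A I))
      + xw x ys I * scal x (diag_poly ys (card I) (B I)))"
    by (intro sum.cong refl) (simp add: Hop_add yw_span xw_span assms Hop_yw Hop_xw)
  finally show ?thesis
    by (simp add: combine_def[of "\<lambda>I. diag_poly ys (card I) (A I)"] Nop_combine assms sum.distrib algebra_simps)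
qed

lemma card_isets_le: "I \<in> isets ys \<Longrightarrow> card I \<le> length ys"
  using card_mono[of "{..<length ys}" I] by (simp add: isets_def)

lemma Ggr_combine:
  assumes "\<And>I. I \<in> isets ys \<Longrightarrow> A I \<in> spolys UNIV (set ys)" "\<And>I. I \<in> isets ys \<Longrightarrow> B I \<in> spolys UNIV (set ys)"
  shows "Ggr x ys (combine A B) = combine (\<lambda>I. green_poly ys (card I) (A I)) (\<lambda>I. green_poly ys (card I) (B I))"
  unfolding Ggr_def by (subst sector_op_combine[OF assms]) (auto simp: combine_def)

lemma proj_combine:
  assumes "\<And>I. I \<in> isets ys \<Longrightarrow> A I \<in> spolys UNIV (set ys)" "\<And>I. I \<in> isets ys \<Longrightarrow> B I \<in> spolys UNIV (set ys)"
  shows "projY x ys (combine A B) = combine A (\<lambda>_. 0)" "projX x ys (combine A B) = combine (\<lambda>_. 0) B"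
  unfolding projY_def projX_def by (subst sector_op_combine[OF assms]; auto simp: combine_def)+

lemma Gop_combine:
  assumes "\<And>I. I \<in> isets ys \<Longrightarrow> A I \<in> spolys UNIV (set ys)" "\<And>I. I \<in> isets ys \<Longrightarrow> B I \<in> spolys UNIV (set ys)"
  shows "Gop x ys (combine A B) =
    combine (\<lambda>I. green_poly ys (card I) (A I)) (\<lambda>I. green_poly ys (card I) (B I))
    - Ggr x ys (Nop x ys (combine (\<lambda>I. green_poly ys (card I) (A I)) (\<lambda>_. 0)))"
  using combine_split[of "\<lambda>I. green_poly ys (card I) (A I)" "\<lambda>I. green_poly ys (card I) (B I)"]
  by (simp add: Gop_def block_op_def proj_combine assms Let_def Ggr_combine green_poly_0)

lemma green_poly_diff: "green_poly ys p (A - B) = green_poly ys p A - green_poly ys p B"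
  using green_poly_add[of ys p "A - B" B] by (simp add: eq_diff_eq)

text \<open>With \<open>n\<close> for the coordinates of the off-diagonal part, \<open>Hop\<close>
  is (A, B) to (d A, d B + n A) and \<open>Gop\<close> is (A, B) to (g A, g (B - n (g A))), where
  \<open>d\<close> and \<open>g\<close> are inverse and additive. The hypothesis
  \<open>green\<close> is where the inverted diagonal factors enter.\<close>

lemma Gop_inverse:
  assumes K: "coeff_ring K"
    and green: "\<And>p A. p \<le> length ys \<Longrightarrow> A \<in> spolys K (set ys) \<Longrightarrow> green_poly ys p A \<in> spolys K (set ys)"
    and z: "z \<in> span K"
  shows "Hop x ys z \<in> span K" "Gop x ys z \<in> span K" "Hop x ys (Gop x ys z) = z" "Gop x ys (Hop x ys z) = z"
proof -
  define d g where "d A I = diag_poly ys (card I) (A I)" and "g A I = green_poly ys (card I) (A I)"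
    for A :: "nat set \<Rightarrow> 'v spoly" and I
  have dg: "d (g A) = A" "g (d A) = A" for A
    by (simp_all add: d_def g_def fun_eq_iff diag_green_poly green_diag_poly)
  have d: "d A I \<in> spolys K (set ys)" if "A I \<in> spolys K (set ys)" for A I
    using that K by (simp add: d_def spolys_diag_poly)
  have g: "g A I \<in> spolys K (set ys)" if "I \<in> isets ys" "A I \<in> spolys K (set ys)" for A I
    using that by (simp add: g_def green card_isets_le)
  obtain A B where z: "z = combine A B" and A: "\<And>I. A I \<in> spolys K (set ys)" and B: "\<And>I. B I \<in> spolys K (set ys)"
    using z by (rule spanE) blast
  have U: "C \<in> spolys UNIV (set ys)" if "C \<in> spolys K (set ys)" for C
    using that by (rule spolys_UNIV)
  have dK: "\<And>I. d A I \<in> spolys K (set ys)" "\<And>I. d B I \<in> spolys K (set ys)"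
    and gK: "\<And>I. I \<in> isets ys \<Longrightarrow> g A I \<in> spolys K (set ys)" "\<And>I. I \<in> isets ys \<Longrightarrow> g B I \<in> spolys K (set ys)"
    using A B d g by simp_all
  obtain M where M: "Nop x ys (combine A (\<lambda>_. 0)) = combine (\<lambda>_. 0) M" "\<And>I. M I \<in> spolys K (set ys)"
    using Nop_spanX[OF K, of A "\<lambda>_. 0"] A by (auto elim: spanXE)
  \<comment> \<open>In \<open>Gop\<close> the off-diagonal part acts after the Green operator, so it
    is taken at \<open>g A\<close>; in \<open>Hop\<close> it is taken at \<open>A\<close>
    itself.\<close>
  obtain N where N: "Nop x ys (combine (g A) (\<lambda>_. 0)) = combine (\<lambda>_. 0) N" "\<And>I. N I \<in> spolys K (set ys)"
    using Nop_spanX[OF K, of "g A" "\<lambda>_. 0"] gK by (auto elim: spanXE)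
  have Hz: "Hop x ys z = combine (d A) (\<lambda>I. d B I + M I)"
    using Hop_combine[of A B] A B M by (simp add: z U d_def[abs_def] combine_add)
  have gg: "Ggr x ys (combine (\<lambda>_. 0) C) = combine (\<lambda>_. 0) (g C)" if "\<And>I. C I \<in> spolys K (set ys)" for C
    using Ggr_combine[of "\<lambda>_. 0" C] that by (simp add: U g_def[abs_def] green_poly_0)
  have Gz: "Gop x ys z = combine (g A) (g (\<lambda>I. B I - N I))"
    using Gop_combine[of A B] A B N(1) gg[OF N(2)]
    by (simp add: z U g_def[abs_def] combine_diff green_poly_diff)
  have BN: "B I - N I \<in> spolys K (set ys)" for I
    using spolys_add[OF K B spolys_uminus[OF K N(2)]] by simp
  have dBM: "d B I + M I \<in> spolys K (set ys)" for I
    using spolys_add[OF K dK(2) M(2)] .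
  show "Hop x ys z \<in> span K" unfolding Hz by (intro spanI dK dBM)
  have gBN: "g (\<lambda>I. B I - N I) I \<in> spolys K (set ys)" if "I \<in> isets ys" for I
    using g[OF that, of "\<lambda>I. B I - N I"] BN by simp
  show "Gop x ys z \<in> span K" unfolding Gz by (intro spanI gK gBN)
  have "Hop x ys (Gop x ys z) = combine (d (g A)) (d (g (\<lambda>I. B I - N I))) + combine (\<lambda>_. 0) N"
    unfolding Gz using Hop_combine[of "g A" "g (\<lambda>I. B I - N I)"] gK gBN N(1) by (simp add: U d_def[abs_def])
  then show "Hop x ys (Gop x ys z) = z" by (simp add: dg z combine_add)
  have "Gop x ys (Hop x ys z) = combine (g (d A)) (g (\<lambda>I. d B I + M I)) - Ggr x ys (Nop x ys (combine (g (d A)) (\<lambda>_. 0)))"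
    unfolding Hz using Gop_combine[of "d A" "\<lambda>I. d B I + M I"] dK dBM by (simp add: U g_def[abs_def])
  also have "\<dots> = combine A (\<lambda>I. g (\<lambda>I. d B I + M I) I - g M I)"
    unfolding dg M(1) gg[OF M(2)] by (simp add: combine_diff)
  also have "(\<lambda>I. g (\<lambda>I. d B I + M I) I - g M I) = g (d B)"
    by (simp add: g_def fun_eq_iff green_poly_add)
  finally show "Gop x ys (Hop x ys z) = z" by (simp add: dg z)
qed

end

section \<open>Localization\<close>

definition denominators :: "qfield set \<Rightarrow> bool" where
  "denominators \<Omega> \<longleftrightarrow> 1 \<in> \<Omega> \<and> 0 \<notin> \<Omega> \<and> \<Omega> \<subseteq> BB \<and> (\<forall>a\<in>\<Omega>. \<forall>b\<in>\<Omega>. a * b \<in> \<Omega>)"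

definition loc_ring :: "qfield set \<Rightarrow> qfield set" where
  "loc_ring \<Omega> = {b * inverse \<omega> |b \<omega>. b \<in> BB \<and> \<omega> \<in> \<Omega>}"

lemma loc_ringI: "b \<in> BB \<Longrightarrow> \<omega> \<in> \<Omega> \<Longrightarrow> b * inverse \<omega> \<in> loc_ring \<Omega>"
  by (auto simp: loc_ring_def)

lemma denominators_mult_set:
  assumes "F \<subseteq> BB" "0 \<notin> F"
  shows "denominators (mult_set F)"
proof -
  have "c \<in> mult_set F \<Longrightarrow> c \<in> BB \<and> c \<noteq> 0" for c
    by (induction rule: mult_set.induct) (use assms BB_1 BB.mult in auto)
  then show ?thesis by (auto simp: denominators_def mult_set.one mult_set.mult)
qed

lemma coeff_ring_loc_ring:
  assumes "denominators \<Omega>"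
  shows "coeff_ring (loc_ring \<Omega>)"
  unfolding coeff_ring_def
proof (intro conjI ballI subsetI)
  fix b assume "b \<in> BB"
  then show "b \<in> loc_ring \<Omega>" using loc_ringI[of b 1 \<Omega>] assms by (simp add: denominators_def)
next
  fix u v assume "u \<in> loc_ring \<Omega>" "v \<in> loc_ring \<Omega>"
  then obtain b \<omega> c \<eta> where *: "u = b * inverse \<omega>" "v = c * inverse \<eta>" "b \<in> BB" "c \<in> BB" "\<omega> \<in> \<Omega>" "\<eta> \<in> \<Omega>"
    by (auto simp: loc_ring_def)
  then have nz: "\<omega> \<noteq> 0" "\<eta> \<noteq> 0" and BB: "\<omega> \<in> BB" "\<eta> \<in> BB" and mult: "\<omega> * \<eta> \<in> \<Omega>"
    using assms by (auto simp: denominators_def)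
  have "u + v = (b * \<eta> + c * \<omega>) * inverse (\<omega> * \<eta>)" using nz by (simp add: * field_simps)
  also have "\<dots> \<in> loc_ring \<Omega>" using * BB mult by (intro loc_ringI BB.add BB.mult)
  finally show "u + v \<in> loc_ring \<Omega>" .
  have "u * v = (b * c) * inverse (\<omega> * \<eta>)" by (simp add: *)
  also have "\<dots> \<in> loc_ring \<Omega>" using * BB mult by (intro loc_ringI BB.mult)
  finally show "u * v \<in> loc_ring \<Omega>" .
qed

text \<open>Bringing sums and products to a common denominator replaces fractions of algebra
  elements by an algebra over a larger coefficient ring, to which the results on spans
  apply.\<close>

lemma localize_subalg:
  assumes "denominators \<Omega>"
  shows "localize \<Omega> (subalg BB V) = subalg (loc_ring \<Omega>) V"
proof
  have K: "coeff_ring (loc_ring \<Omega>)" by (rule coeff_ring_loc_ring[OF assms])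
  have inv: "inverse \<omega> \<in> loc_ring \<Omega>" if "\<omega> \<in> \<Omega>" for \<omega> using loc_ringI[OF BB_1 that] by simp
  show "localize \<Omega> (subalg BB V) \<subseteq> subalg (loc_ring \<Omega>) V"
    using subalg_mono[of BB "loc_ring \<Omega>" V V] coeff_ring_of_BB[OF K] inv
    by (auto simp: localize_def intro!: subalg.mult subalg.cst)
  show "subalg (loc_ring \<Omega>) V \<subseteq> localize \<Omega> (subalg BB V)"
  proof
    fix z assume "z \<in> subalg (loc_ring \<Omega>) V"
    then have "\<exists>\<omega>\<in>\<Omega>. \<exists>w\<in>subalg BB V. z = cst (inverse \<omega>) * w"
    proof induction
      case (cst c)
      then obtain b \<omega> where "c = b * inverse \<omega>" "b \<in> BB" "\<omega> \<in> \<Omega>" by (auto simp: loc_ring_def)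
      then show ?case
        by (intro bexI[of _ \<omega>] bexI[of _ "cst b"]) (auto simp: mult.commute intro: subalg.cst simp flip: cst_mult)
    next
      case (gen v)
      then show ?case
        using assms by (intro bexI[of _ 1] bexI[of _ "rgen v"]) (auto simp: denominators_def intro: subalg.gen)
    next
      case (add a b)
      then obtain \<omega> \<eta> u v where *: "\<omega> \<in> \<Omega>" "\<eta> \<in> \<Omega>" "u \<in> subalg BB V" "v \<in> subalg BB V"
        and ab: "a = cst (inverse \<omega>) * u" "b = cst (inverse \<eta>) * v" by blast
      have nz: "\<omega> \<noteq> 0" "\<eta> \<noteq> 0" using * assms by (auto simp: denominators_def)
      have "cst (inverse (\<omega> * \<eta>)) * (cst \<eta> * u + cst \<omega> * v) = cst (inverse (\<omega> * \<eta>) * \<eta>) * u + cst (inverse (\<omega> * \<eta>) * \<omega>) * v"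
        by (simp only: distrib_left cst_mult mult.assoc)
      also have "inverse (\<omega> * \<eta>) * \<eta> = inverse \<omega>" using nz by (simp add: field_simps)
      also have "inverse (\<omega> * \<eta>) * \<omega> = inverse \<eta>" using nz by (simp add: field_simps)
      also have "cst (inverse \<omega>) * u + cst (inverse \<eta>) * v = a + b" by (simp only: ab)
      finally have "a + b = cst (inverse (\<omega> * \<eta>)) * (cst \<eta> * u + cst \<omega> * v)" ..
      moreover have "\<omega> * \<eta> \<in> \<Omega>" "\<omega> \<in> BB" "\<eta> \<in> BB" using * assms by (auto simp: denominators_def)
      ultimately show ?case using * by (blast intro: subalg.add subalg.mult subalg.cst)
    next
      case (mult a b)
      then obtain \<omega> \<eta> u v where *: "\<omega> \<in> \<Omega>" "\<eta> \<in> \<Omega>" "u \<in> subalg BB V" "v \<in> subalg BB V"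
        and ab: "a = cst (inverse \<omega>) * u" "b = cst (inverse \<eta>) * v" by blast
      have "a * b = cst (inverse (\<omega> * \<eta>)) * (u * v)"
        unfolding ab inverse_mult_distrib cst_mult
        by (simp add: mult.assoc central_left_commute[OF central_cst[of "inverse \<eta>"], of u])
      moreover have "\<omega> * \<eta> \<in> \<Omega>" using * assms by (auto simp: denominators_def)
      ultimately show ?case using * by (blast intro: subalg.mult)
    qed
    then show "z \<in> localize \<Omega> (subalg BB V)" by (auto simp: localize_def)
  qed
qed

text \<open>Denominators of the parts are multiplied; a further factor from \<open>\<Omega>\<close>
  does no harm because \<open>\<Omega>\<close> lies in \<open>BB\<close>.\<close>

lemma spolys_common_denominator:
  assumes "denominators \<Omega>" "finite F" "\<And>I. I \<in> F \<Longrightarrow> A I \<in> spolys (loc_ring \<Omega>) Y"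
  shows "\<exists>\<omega>\<in>\<Omega>. \<forall>I\<in>F. pconst \<omega> * A I \<in> spolys BB Y"
proof -
  have \<Omega>: "1 \<in> \<Omega>" "\<And>a b. a \<in> \<Omega> \<Longrightarrow> b \<in> \<Omega> \<Longrightarrow> a * b \<in> \<Omega>" "\<And>a. a \<in> \<Omega> \<Longrightarrow> a \<in> BB \<and> a \<noteq> 0"
    using assms(1) by (auto simp: denominators_def)
  have scale: "pconst (\<omega> * \<eta>) * B \<in> spolys BB Y" "pconst (\<eta> * \<omega>) * B \<in> spolys BB Y"
    if "pconst \<omega> * B \<in> spolys BB Y" "\<eta> \<in> \<Omega>" for B \<omega> \<eta>
    using spolys_mult[OF coeff_ring_BB spolys_pconst that(1), of \<eta>] \<Omega>(3)[OF that(2)]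
    by (simp_all add: pconst_mult mult_ac)
  have single: "\<exists>\<omega>\<in>\<Omega>. pconst \<omega> * B \<in> spolys BB Y" if "B \<in> spolys (loc_ring \<Omega>) Y" for B
    using that
  proof (induction rule: spolys_induct)
    case (pconst c)
    then have "c \<in> loc_ring \<Omega>"
      using coeff_ring_0[OF coeff_ring_loc_ring[OF assms(1)]] coeff_ring_1[OF coeff_ring_loc_ring[OF assms(1)]] by auto
    then obtain b \<omega> where "c = b * inverse \<omega>" "b \<in> BB" "\<omega> \<in> \<Omega>" by (auto simp: loc_ring_def)
    then have "\<omega> * c \<in> BB" using \<Omega>(3)[of \<omega>] by (simp add: field_simps)
    then have "pconst \<omega> * pconst c \<in> spolys BB Y" by (simp add: spolys_pconst flip: pconst_mult)
    then show ?case using \<open>\<omega> \<in> \<Omega>\<close> by blast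
  next
    case (pvar u)
    then show ?case using \<Omega>(1) spolys_pvar[OF coeff_ring_BB] by (intro bexI[of _ 1]) auto
  next
    case (add B C)
    then obtain \<omega> \<eta> where "\<omega> \<in> \<Omega>" "\<eta> \<in> \<Omega>" "pconst \<omega> * B \<in> spolys BB Y" "pconst \<eta> * C \<in> spolys BB Y" by blast
    then show ?case
      by (intro bexI[of _ "\<omega> * \<eta>"]) (simp_all add: distrib_left spolys_add coeff_ring_BB scale \<Omega>(2))
  next
    case (mult B C)
    then obtain \<omega> \<eta> where *: "\<omega> \<in> \<Omega>" "\<eta> \<in> \<Omega>" "pconst \<omega> * B \<in> spolys BB Y" "pconst \<eta> * C \<in> spolys BB Y" by blast
    have "pconst (\<omega> * \<eta>) * (B * C) = (pconst \<omega> * B) * (pconst \<eta> * C)" by (simp add: pconst_mult mult_ac)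
    then show ?case using * by (intro bexI[of _ "\<omega> * \<eta>"]) (simp_all add: spolys_mult coeff_ring_BB \<Omega>(2))
  qed
  show ?thesis
    using assms(2,3)
  proof (induction F rule: finite_induct)
    case empty
    then show ?case using \<Omega>(1) by auto
  next
    case (insert I F)
    then obtain \<omega> \<eta> where *: "\<omega> \<in> \<Omega>" "\<eta> \<in> \<Omega>" "\<forall>I\<in>F. pconst \<omega> * A I \<in> spolys BB Y" "pconst \<eta> * A I \<in> spolys BB Y"
      using single[of "A I"] by auto
    then show ?case by (intro bexI[of _ "\<omega> * \<eta>"]) (auto simp: scale \<Omega>(2))
  qed
qed

lemma denominators_Omega: "denominators (Omega ys)"
  unfolding Omega_def by (rule denominators_mult_set) (auto simp: lam_factors_def BB_lam)

lemma Rloc_eq: "Rloc x ys = subalg (loc_ring (Omega ys)) (insert x (set ys))"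
  unfolding Rloc_def RB_def by (rule localize_subalg[OF denominators_Omega])

text \<open>The bound on \<open>p\<close> is the one in \<open>lam_factors\<close>, so
  \<open>lam\<close> is among the generators of \<open>Omega ys\<close>; the sign in
  \<open>mu\<close> is its own inverse and lies in \<open>BB\<close>.\<close>

lemma spolys_green_poly:
  assumes "p \<le> length ys" "A \<in> spolys (loc_ring (Omega ys)) Y"
  shows "green_poly ys p A \<in> spolys (loc_ring (Omega ys)) Y"
proof (rule spolysI)
  let ?K = "loc_ring (Omega ys)"
  fix m assume "Poly_Mapping.lookup (green_poly ys p A) m \<noteq> 0"
  then have "Poly_Mapping.lookup A m \<noteq> 0" by (auto simp: lookup_green_poly)
  moreover have "inverse (mu ys p a \<beta>) \<in> ?K" for a \<beta>
  proof -
    have "lam ys p a \<beta> \<in> Omega ys"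
      unfolding Omega_def lam_factors_def using assms(1) lam_neq_0 by (intro mult_set.gen) blast
    then have "(- 1) ^ p * inverse (lam ys p a \<beta>) \<in> ?K" by (intro loc_ringI BB_sign)
    then show ?thesis by (cases "even p") (simp_all add: mu_def)
  qed
  ultimately show "Poly_Mapping.lookup (green_poly ys p A) m \<in> ?K \<and> Poly_Mapping.keys m \<subseteq> svars Y"
    unfolding lookup_green_poly using spolysD[OF assms(2)]
    by (intro conjI coeff_ring_mult[OF coeff_ring_loc_ring[OF denominators_Omega]])
qed

context frame
begin

text \<open>The alternative \<open>{0}\<close> for either family of coefficients lets one argument
  serve the \<open>\<Y>\<close>-sector and the \<open>\<X>\<close>-sector.\<close>

lemma localize_combine:
  fixes P R :: "qfield set \<Rightarrow> 'v spoly set"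
  assumes \<Omega>: "denominators \<Omega>"
    and P: "P = (\<lambda>K. spolys K (set ys)) \<or> P = (\<lambda>_. {0})"
    and R: "R = (\<lambda>K. spolys K (set ys)) \<or> R = (\<lambda>_. {0})"
  shows "localize \<Omega> {combine A B |A B. \<forall>I. A I \<in> P BB \<and> B I \<in> R BB} =
    {combine A B |A B. \<forall>I. A I \<in> P (loc_ring \<Omega>) \<and> B I \<in> R (loc_ring \<Omega>)}"
proof -
  note K = coeff_ring_loc_ring[OF \<Omega>]
  have up: "pconst (inverse \<omega>) * A \<in> T (loc_ring \<Omega>)"
    if "\<omega> \<in> \<Omega>" "A \<in> T BB" "T = (\<lambda>K. spolys K (set ys)) \<or> T = (\<lambda>_. {0})" for \<omega> A and T :: "qfield set \<Rightarrow> 'v spoly set"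
    using that loc_ringI[OF BB_1 that(1)] coeff_ring_of_BB[OF K] spolys_mono[of BB "loc_ring \<Omega>" "set ys" "set ys"]
    by (auto intro!: spolys_mult K spolys_pconst)
  have down: "\<exists>\<omega>\<in>\<Omega>. \<forall>I\<in>isets ys. pconst \<omega> * A I \<in> T BB"
    if "\<And>I. A I \<in> T (loc_ring \<Omega>)" "T = (\<lambda>K. spolys K (set ys)) \<or> T = (\<lambda>_. {0})" for A and T :: "qfield set \<Rightarrow> 'v spoly set"
    using that spolys_common_denominator[OF \<Omega> isets_finite, of A "set ys"] \<Omega> by (auto simp: denominators_def)
  have scale: "pconst \<eta> * (pconst \<omega> * A) \<in> T BB"
    if "\<eta> \<in> \<Omega>" "pconst \<omega> * A \<in> T BB" "T = (\<lambda>K. spolys K (set ys)) \<or> T = (\<lambda>_. {0})" for \<omega> \<eta> A and T :: "qfield set \<Rightarrow> 'v spoly set"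
    using that \<Omega> by (auto simp: denominators_def intro!: spolys_mult coeff_ring_BB spolys_pconst)
  have 0: "0 \<in> P BB" "0 \<in> R BB" using P R by auto
  show ?thesis
  proof (intro equalityI subsetI)
    fix z assume "z \<in> localize \<Omega> {combine A B |A B. \<forall>I. A I \<in> P BB \<and> B I \<in> R BB}"
    then obtain \<omega> A B where *: "\<omega> \<in> \<Omega>" "z = cst (inverse \<omega>) * combine A B" "\<forall>I. A I \<in> P BB \<and> B I \<in> R BB"
      by (auto simp: localize_def)
    have "pconst (inverse \<omega>) * A I \<in> P (loc_ring \<Omega>)" "pconst (inverse \<omega>) * B I \<in> R (loc_ring \<Omega>)" for I
      using up[OF *(1) _ P] up[OF *(1) _ R] *(3) by simp_all
    then show "z \<in> {combine A B |A B. \<forall>I. A I \<in> P (loc_ring \<Omega>) \<and> B I \<in> R (loc_ring \<Omega>)}"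
      unfolding *(2) combine_cst by blast
  next
    fix z assume "z \<in> {combine A B |A B. \<forall>I. A I \<in> P (loc_ring \<Omega>) \<and> B I \<in> R (loc_ring \<Omega>)}"
    then obtain A B where z: "z = combine A B" and AB: "\<And>I. A I \<in> P (loc_ring \<Omega>)" "\<And>I. B I \<in> R (loc_ring \<Omega>)"
      by blast
    obtain \<omega> where \<omega>: "\<omega> \<in> \<Omega>" "\<forall>I\<in>isets ys. pconst \<omega> * A I \<in> P BB" using down[of A P] AB(1) P by blast
    obtain \<eta> where \<eta>: "\<eta> \<in> \<Omega>" "\<forall>I\<in>isets ys. pconst \<eta> * B I \<in> R BB" using down[of B R] AB(2) R by blast
    \<comment> \<open>Both families are scaled by both denominators, so that the product is a
      denominator for the whole element.\<close>
    define A' B' where "A' I = (if I \<in> isets ys then pconst \<eta> * (pconst \<omega> * A I) else 0)"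
      and "B' I = (if I \<in> isets ys then pconst \<omega> * (pconst \<eta> * B I) else 0)" for I
    have "A' I \<in> P BB \<and> B' I \<in> R BB" for I
      using 0 scale[OF \<eta>(1) _ P] scale[OF \<omega>(1) _ R] \<omega>(2) \<eta>(2) by (auto simp: A'_def B'_def)
    moreover have "z = cst (inverse (\<omega> * \<eta>)) * combine A' B'"
    proof -
      have nz: "\<omega> \<noteq> 0" "\<eta> \<noteq> 0" and "\<omega> * \<eta> \<in> \<Omega>" using \<omega>(1) \<eta>(1) \<Omega> by (auto simp: denominators_def)
      have "combine A' B' = combine (\<lambda>I. pconst (\<omega> * \<eta>) * A I) (\<lambda>I. pconst (\<omega> * \<eta>) * B I)"
        by (subst (2) combine_restrict) (simp add: A'_def[abs_def] B'_def[abs_def] pconst_mult mult_ac cong: if_cong)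
      also have "\<dots> = cst (\<omega> * \<eta>) * z" by (simp add: z combine_cst)
      also have "cst (inverse (\<omega> * \<eta>)) * \<dots> = cst (inverse (\<omega> * \<eta>) * (\<omega> * \<eta>)) * z"
        by (simp only: cst_mult mult.assoc)
      also have "inverse (\<omega> * \<eta>) * (\<omega> * \<eta>) = 1" using nz by (intro left_inverse) simp
      finally show ?thesis by simp
    qed
    moreover have "\<omega> * \<eta> \<in> \<Omega>" using \<omega>(1) \<eta>(1) \<Omega> by (auto simp: denominators_def)
    ultimately show "z \<in> localize \<Omega> {combine A B |A B. \<forall>I. A I \<in> P BB \<and> B I \<in> R BB}"
      unfolding localize_def by blast
  qed
qed

lemma Yloc_eq: "Yloc x ys = spanY (loc_ring (Omega ys))"
proof -
  have *: "spanY K = {combine A B |A B. \<forall>I. A I \<in> spolys K (set ys) \<and> B I \<in> {0}}" for K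
    unfolding spanY_def by (auto, metis ext)
  have "sectorY x ys = spanY BB" by (simp add: sectorY_def spanY_def combine_def)
  then show ?thesis
    unfolding Yloc_def * using localize_combine[OF denominators_Omega, of "\<lambda>K. spolys K (set ys)" "\<lambda>_. {0}"] by simp
qed

lemma Xloc_eq: "Xloc x ys = spanX (loc_ring (Omega ys))"
proof -
  have *: "spanX K = {combine A B |A B. \<forall>I. A I \<in> {0} \<and> B I \<in> spolys K (set ys)}" for K
    unfolding spanX_def by (auto, metis ext)
  have "sectorX x ys = spanX BB" by (simp add: sectorX_def spanX_def combine_def)
  then show ?thesis
    unfolding Xloc_def * using localize_combine[OF denominators_Omega, of "\<lambda>_. {0}" "\<lambda>K. spolys K (set ys)"] by simp
qed

lemma coeff_ring_Omega: "coeff_ring (loc_ring (Omega ys))"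
  by (rule coeff_ring_loc_ring[OF denominators_Omega])

lemma Rloc_eq_span: "Rloc x ys = span (loc_ring (Omega ys))"
  unfolding Rloc_eq by (rule subalg_eq_span[OF coeff_ring_Omega])

lemma inverse_on_Rloc: "inverse_on (Rloc x ys) (Hop x ys) (Gop x ys)"
  using Gop_inverse[OF coeff_ring_Omega spolys_green_poly]
  by (auto simp: inverse_on_def Rloc_eq_span)

lemma Ggr_Yloc: "Ggr x ys ` Yloc x ys \<subseteq> Yloc x ys"
  unfolding Yloc_eq
proof (intro image_subsetI, elim spanYE)
  fix z A assume "z = combine A (\<lambda>_. 0)" and A: "\<And>I. A I \<in> spolys (loc_ring (Omega ys)) (set ys)"
  then show "Ggr x ys z \<in> spanY (loc_ring (Omega ys))"
    by (auto simp: Ggr_combine spolys_UNIV[OF A] green_poly_0 intro!: spanYI spolys_green_poly card_isets_le)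
qed

lemma Ggr_Xloc: "Ggr x ys ` Xloc x ys \<subseteq> Xloc x ys"
  unfolding Xloc_eq
proof (intro image_subsetI, elim spanXE)
  fix z A assume "z = combine (\<lambda>_. 0) A" and A: "\<And>I. A I \<in> spolys (loc_ring (Omega ys)) (set ys)"
  then show "Ggr x ys z \<in> spanX (loc_ring (Omega ys))"
    by (auto simp: Ggr_combine spolys_UNIV[OF A] green_poly_0 intro!: spanXI spolys_green_poly card_isets_le)
qed

lemma Nop_Yloc: "Nop x ys ` Yloc x ys \<subseteq> Xloc x ys"
  unfolding Xloc_eq Yloc_eq using coeff_ring_Omega by (auto elim!: spanYE intro!: Nop_spanX)

end

section \<open>Enlargement of the set of variables\<close>

text \<open>A basis element for \<open>ys\<close> is the wedge of a list in \<open>zs\<close>,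
  perhaps in another order; \<open>sector_op_wdg\<close> and \<open>sector_op_wdg_Cons\<close>
  evaluate the operators for \<open>zs\<close> on it by the same formula. Coefficients from the
  whole field cover every localization.\<close>

lemma vder_creation_enlarge:
  assumes "frame x ys" "frame x zs" "set ys \<subseteq> set zs" "z \<in> subalg UNIV (insert x (set ys))"
  shows "vder x zs z = vder x ys z" "creation x zs z = creation x ys z"
proof -
  interpret Y: frame x ys by fact
  interpret Z: frame x zs by fact
  obtain A B where z: "z = Y.combine A B" and A: "\<And>I. A I \<in> spolys UNIV (set ys)" and B: "\<And>I. B I \<in> spolys UNIV (set ys)"
    using assms(4) unfolding Y.subalg_eq_span[OF coeff_ring_UNIV] by (rule Y.spanE) blast
  have AZ: "A I \<in> spolys UNIV (set zs)" "B I \<in> spolys UNIV (set zs)" for I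
    using A[of I] B[of I] spolys_mono[of UNIV UNIV "set ys" "set zs"] assms(3) by auto
  have us: "distinct (nths ys I)" "set (nths ys I) \<subseteq> set zs" for I
    using Y.distinct_ys Y.set_nths_ys[of I] assms(3) by auto
  have memY: "yw ys I * scal x (A I) \<in> Z.span UNIV" and memX: "xw x ys I * scal x (B I) \<in> Z.span UNIV" for I
    unfolding Y.yw_eq Y.xw_eq using us(2)[of I] AZ
    by (auto simp del: wdg.simps intro!: Z.wdg_in_span coeff_ring_UNIV)
  have vY: "vder x zs (yw ys I * scal x (A I)) = Y.vder_yw I (A I)" if "I \<in> isets ys" for I
    unfolding Y.yw_eq Z.vder_eq Y.vder_yw_def dsc_enlarge[OF A assms(3), symmetric]
    by (rule Z.sector_op_wdg[where F = "\<lambda>a b. a * dsc x zs (A I)"])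
       (auto simp: Z.additive_vder us AZ Z.vder_yw_def)
  have vX: "vder x zs (xw x ys I * scal x (B I)) = Y.vder_xw I (B I)" if "I \<in> isets ys" for I
    unfolding Y.xw_eq Y.yw_eq Z.vder_eq Y.vder_xw_def dsc_enlarge[OF B assms(3), symmetric]
    by (rule Z.sector_op_wdg_Cons[where F = "\<lambda>a b. cst ((- 1) ^ card I * qmint (- int (card I))) * a * scal x (B I)
          + cst (qmpow (- int (card I))) * b * dsc x zs (B I)"])
       (auto simp: Z.additive_vder us AZ Z.vder_xw_def Y.card_isets[OF that] simp del: wdg.simps)
  have "vder x zs z = (\<Sum>I\<in>isets ys. vder x zs (yw ys I * scal x (A I) + xw x ys I * scal x (B I)))"
    unfolding z Y.combine_def
    by (intro Z.additive_on_sum Z.vder_add Z.span_add coeff_ring_UNIV memX memY)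
  also have "\<dots> = vder x ys z"
    unfolding z Y.vder_eq using A B
    by (subst Y.sector_op_combine) (auto simp: Z.vder_add memX memY vX vY intro!: sum.cong)
  finally show "vder x zs z = vder x ys z" .
  have af: "Z.additive_family (\<lambda>I A. xw x zs I * scal x A)" "Z.additive_family (\<lambda>I B. 0)"
    by (simp_all add: Z.additive_family_def scal_add distrib_left)
  have cY: "creation x zs (yw ys I * scal x (A I)) = xw x ys I * scal x (A I)" for I
    unfolding Y.yw_eq Y.xw_eq creation_def
    by (rule Z.sector_op_wdg[where F = "\<lambda>a b. b * scal x (A I)"]) (auto simp: af us AZ simp del: wdg.simps)
  have cX: "creation x zs (xw x ys I * scal x (B I)) = 0" for I
    unfolding Y.xw_eq creation_def
    by (rule Z.sector_op_wdg_Cons[where F = "\<lambda>a b. 0"]) (auto simp: af us AZ)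
  have "creation x zs z = (\<Sum>I\<in>isets ys. creation x zs (yw ys I * scal x (A I) + xw x ys I * scal x (B I)))"
    unfolding z Y.combine_def
    by (intro Z.additive_on_sum Z.creation_add Z.span_add coeff_ring_UNIV memX memY)
  also have "\<dots> = creation x ys z"
    unfolding z Y.creation_combine[OF A B] by (simp add: Z.creation_add memX memY cX cY Y.combine_def)
  finally show "creation x zs z = creation x ys z" .
qed

lemma (in frame) operators_subalg_UNIV:
  assumes "z \<in> subalg UNIV (insert x (set ys))"
  shows "vder x ys z \<in> subalg UNIV (insert x (set ys))" "creation x ys z \<in> subalg UNIV (insert x (set ys))"
  using assms vder_span[OF coeff_ring_UNIV] creation_spanX spanX_subset
  unfolding subalg_eq_span[OF coeff_ring_UNIV] by blast+

lemma Hop_enlarge: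
  assumes "frame x ys" "frame x zs" "set ys \<subseteq> set zs" "z \<in> subalg UNIV (insert x (set ys))"
  shows "Hop x zs z = Hop x ys z"
  using vder_creation_enlarge[OF assms(1-3)] frame.operators_subalg_UNIV[OF assms(1)] assms(4)
  by (simp add: Hop_def)

text \<open>Exponents are extended by 0, and the \<open>qq\<close>-integer of 0 vanishes; each
  factor for \<open>ys\<close> is thus a factor for \<open>zs\<close>.\<close>

lemma lam_enlarge:
  assumes "set ys \<subseteq> set zs"
  shows "lam ys p a \<beta> = lam zs p a (\<lambda>v. if v \<in> set ys then \<beta> v else 0)"
proof -
  have "(\<Sum>v\<in>set zs. qint (int (if v \<in> set ys then \<beta> v else 0))) = (\<Sum>v\<in>set ys. qint (int (\<beta> v)))"
    using assms by (intro sum.mono_neutral_cong_right) (auto simp: qint_def)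
  then show ?thesis by (simp add: lam_def)
qed

lemma mult_set_mono: "F \<subseteq> G \<Longrightarrow> mult_set F \<subseteq> mult_set G"
proof
  fix c assume "F \<subseteq> G" "c \<in> mult_set F"
  from this(2) show "c \<in> mult_set G" by induction (use \<open>F \<subseteq> G\<close> in \<open>auto intro: mult_set.intros\<close>)
qed

lemma lam_factors_mono:
  assumes "distinct ys" "set ys \<subseteq> set zs"
  shows "lam_factors ys \<subseteq> lam_factors zs"
proof -
  have "length ys \<le> length zs"
    using card_mono[OF _ assms(2)] card_length[of zs] distinct_card[OF assms(1)] by simp
  then show ?thesis
    unfolding lam_factors_def using lam_enlarge[OF assms(2)] by (auto dest: le_trans) (metis le_trans)
qed

lemma loc_ring_mono: "\<Omega> \<subseteq> \<Omega>' \<Longrightarrow> loc_ring \<Omega> \<subseteq> loc_ring \<Omega>'"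
  by (auto simp: loc_ring_def)

lemma Rloc_mono: "distinct ys \<Longrightarrow> set ys \<subseteq> set zs \<Longrightarrow> Rloc x ys \<subseteq> Rloc x zs"
  unfolding Rloc_eq Omega_def by (intro subalg_mono loc_ring_mono mult_set_mono lam_factors_mono) auto

lemma Rloc_subset_UNIV: "Rloc x ys \<subseteq> subalg UNIV (insert x (set ys))"
  unfolding Rloc_eq by (rule subalg_mono) auto

text \<open>Compatibility of the inverses is inherited from the compatibility of \<open>Hop\<close>.\<close>

lemma Gop_enlarge:
  assumes "frame x ys" "frame x zs" "set ys \<subseteq> set zs" "z \<in> Rloc x ys"
  shows "Gop x zs z = Gop x ys z"
proof -
  have Y: "inverse_on (Rloc x ys) (Hop x ys) (Gop x ys)" and Z: "inverse_on (Rloc x zs) (Hop x zs) (Gop x zs)"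
    using assms(1,2) by (auto intro: frame.inverse_on_Rloc)
  have g: "Gop x ys z \<in> Rloc x ys" using Y assms(4) by (auto simp: inverse_on_def)
  have "Hop x zs (Gop x ys z) = Hop x ys (Gop x ys z)"
    by (rule Hop_enlarge[OF assms(1-3) subsetD[OF Rloc_subset_UNIV g]])
  then have "Hop x zs (Gop x ys z) = z"
    using Y assms(4) by (auto simp: inverse_on_def)
  moreover have "Gop x ys z \<in> Rloc x zs"
    using g Rloc_mono[OF frame.distinct_ys[OF assms(1)] assms(3)] by blast
  ultimately show ?thesis using Z by (metis inverse_on_def)
qed

section \<open>The direct limit\<close>

lemma enumerates_frame: "enumerates S x ys \<Longrightarrow> frame x ys"
  by (auto simp: enumerates_def frame_def)

lemma enumerates_union:
  assumes "enumerates S x ys" "enumerates S x zs"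
  obtains ws where "enumerates S x ws" "set ys \<subseteq> set ws" "set zs \<subseteq> set ws"
proof -
  obtain ws where "set ws = set ys \<union> set zs" "distinct ws"
    using finite_distinct_list[of "set ys \<union> set zs"] by auto
  then show ?thesis using assms that[of ws] by (auto simp: enumerates_def)
qed

text \<open>Any two stages are compared on a common enlargement, so the definite description does
  not depend on the stage.\<close>

lemma limit_op_eq:
  assumes "\<And>ys zs z. enumerates S x ys \<Longrightarrow> enumerates S x zs \<Longrightarrow> set ys \<subseteq> set zs \<Longrightarrow> z \<in> D ys \<Longrightarrow> T zs z = T ys z"
    and "enumerates S x ys" "z \<in> D ys"
  shows "limit_op S x D T z = T ys z"
  unfolding limit_op_def
proof (rule the_equality)
  fix w assume "\<exists>ys. enumerates S x ys \<and> z \<in> D ys \<and> w = T ys z"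
  then obtain zs where zs: "enumerates S x zs" "z \<in> D zs" "w = T zs z" by blast
  obtain ws where "enumerates S x ws" "set ys \<subseteq> set ws" "set zs \<subseteq> set ws"
    using enumerates_union[OF assms(2) zs(1)] .
  then have "T ws z = T ys z" "T ws z = T zs z" using assms zs by blast+
  then show "w = T ys z" using zs(3) by simp
qed (use assms in blast)

lemma Gop_lim_eq: "enumerates S x ys \<Longrightarrow> z \<in> Rloc x ys \<Longrightarrow> Gop_lim S x z = Gop x ys z"
  unfolding Gop_lim_def by (rule limit_op_eq) (auto intro: Gop_enlarge enumerates_frame)

lemma Hop_lim_eq:
  assumes "enumerates S x ys" "z \<in> subalg UNIV (insert x (set ys))"
  shows "Hop_lim S x z = Hop x ys z"
proof -
  have *: "vder_lim S x w = vder x ys w" "creation_lim S x w = creation x ys w"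
    if "w \<in> subalg UNIV (insert x (set ys))" for w
    unfolding vder_lim_def creation_lim_def using that assms(1)
    by (auto intro!: limit_op_eq[where D = "\<lambda>ys. subalg UNIV (insert x (set ys))"] vder_creation_enlarge enumerates_frame)
  show ?thesis
    using * frame.operators_subalg_UNIV[OF enumerates_frame[OF assms(1)] assms(2)] assms(2)
    by (simp add: Hop_lim_def Hop_def)
qed

lemma subalg_finite_support:
  assumes "z \<in> subalg K S" "x \<in> S"
  shows "\<exists>ys. enumerates S x ys \<and> z \<in> subalg K (insert x (set ys))"
  using assms(1)
proof induction
  case (cst c)
  have "enumerates S x []" by (simp add: enumerates_def)
  then show ?case using cst by (blast intro: subalg.cst)
next
  case (gen v)
  \<comment> \<open>The generator \<open>x\<close> belongs to every stage and must not be
    enumerated.\<close>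
  have "enumerates S x (if v = x then [] else [v])" using gen by (simp add: enumerates_def)
  moreover have "v \<in> insert x (set (if v = x then [] else [v]))" by simp
  ultimately show ?case by (blast intro: subalg.gen)
next
  case (add a b)
  then obtain ys zs where *: "enumerates S x ys" "a \<in> subalg K (insert x (set ys))"
    "enumerates S x zs" "b \<in> subalg K (insert x (set zs))" by blast
  obtain ws where "enumerates S x ws" "set ys \<subseteq> set ws" "set zs \<subseteq> set ws"
    using enumerates_union[OF *(1,3)] .
  moreover from this have "a \<in> subalg K (insert x (set ws))" "b \<in> subalg K (insert x (set ws))"
    using *(2,4) by (auto elim!: subsetD[OF subalg_mono[OF subset_refl insert_mono], rotated])
  ultimately show ?case by (blast intro: subalg.add)
next
  case (mult a b)
  then obtain ys zs where *: "enumerates S x ys" "a \<in> subalg K (insert x (set ys))"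
    "enumerates S x zs" "b \<in> subalg K (insert x (set zs))" by blast
  obtain ws where "enumerates S x ws" "set ys \<subseteq> set ws" "set zs \<subseteq> set ws"
    using enumerates_union[OF *(1,3)] .
  moreover from this have "a \<in> subalg K (insert x (set ws))" "b \<in> subalg K (insert x (set ws))"
    using *(2,4) by (auto elim!: subsetD[OF subalg_mono[OF subset_refl insert_mono], rotated])
  ultimately show ?case by (blast intro: subalg.mult)
qed

text \<open>A product has finitely many factors, and the factor sets grow with the variables, so one
  stage contains them all.\<close>

lemma Omega_lim_finite: "\<omega> \<in> Omega_lim S x \<Longrightarrow> \<exists>ys. enumerates S x ys \<and> \<omega> \<in> Omega ys"
  unfolding Omega_lim_def
proof (induction rule: mult_set.induct)
  case one
  have "enumerates S x []" by (simp add: enumerates_def)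
  then show ?case unfolding Omega_def by (blast intro: mult_set.one)
next
  case (gen c)
  then show ?case unfolding Omega_def by (blast intro: mult_set.gen)
next
  case (mult a b)
  then obtain ys zs where *: "enumerates S x ys" "a \<in> Omega ys" "enumerates S x zs" "b \<in> Omega zs" by blast
  obtain ws where ws: "enumerates S x ws" "set ys \<subseteq> set ws" "set zs \<subseteq> set ws"
    using enumerates_union[OF *(1,3)] .
  have "Omega ys \<subseteq> Omega ws" "Omega zs \<subseteq> Omega ws"
    unfolding Omega_def using *(1,3) ws by (intro mult_set_mono lam_factors_mono; simp add: enumerates_def)+
  then show ?case using * ws(1) unfolding Omega_def by (blast intro: mult_set.mult)
qed

text \<open>Numerator and denominator may come from different finite sets of variables; their union
  provides a stage for the fraction.\<close>

lemma Rloc_lim_eq: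
  assumes "x \<in> S"
  shows "Rloc_lim S x = (\<Union>ys\<in>{ys. enumerates S x ys}. Rloc x ys)"
proof (intro equalityI subsetI)
  fix z assume "z \<in> Rloc_lim S x"
  then obtain \<omega> w where z: "z = cst (inverse \<omega>) * w" and \<omega>: "\<omega> \<in> Omega_lim S x" and w: "w \<in> RB S"
    by (auto simp: Rloc_lim_def localize_def)
  obtain ys where ys: "enumerates S x ys" "\<omega> \<in> Omega ys" using Omega_lim_finite[OF \<omega>] by blast
  obtain zs where zs: "enumerates S x zs" "w \<in> subalg BB (insert x (set zs))"
    using subalg_finite_support[OF w[unfolded RB_def] assms] by blast
  obtain ws where ws: "enumerates S x ws" "set ys \<subseteq> set ws" "set zs \<subseteq> set ws"
    using enumerates_union[OF ys(1) zs(1)] .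
  have "Omega ys \<subseteq> Omega ws"
    unfolding Omega_def using ys(1) ws by (intro mult_set_mono lam_factors_mono) (auto simp: enumerates_def)
  moreover have "w \<in> RB (insert x (set ws))"
    using zs(2) subalg_mono[OF subset_refl insert_mono[OF ws(3)]] unfolding RB_def by blast
  ultimately have "z \<in> Rloc x ws" using ys(2) z by (auto simp: Rloc_def localize_def)
  then show "z \<in> (\<Union>ys\<in>{ys. enumerates S x ys}. Rloc x ys)" using ws(1) by blast
next
  fix z assume "z \<in> (\<Union>ys\<in>{ys. enumerates S x ys}. Rloc x ys)"
  then obtain ys \<omega> w where ys: "enumerates S x ys" and "z = cst (inverse \<omega>) * w" "\<omega> \<in> Omega ys"
    "w \<in> RB (insert x (set ys))" by (auto simp: Rloc_def localize_def)
  moreover have "Omega ys \<subseteq> Omega_lim S x"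
    unfolding Omega_def Omega_lim_def using ys by (intro mult_set_mono) auto
  moreover have "RB (insert x (set ys)) \<subseteq> RB S"
    unfolding RB_def using ys assms by (intro subalg_mono) (auto simp: enumerates_def)
  ultimately show "z \<in> Rloc_lim S x" by (auto simp: Rloc_lim_def localize_def)
qed

lemma inverse_on_Rloc_lim:
  assumes "x \<in> S"
  shows "inverse_on (Rloc_lim S x) (Hop_lim S x) (Gop_lim S x)"
proof -
  have *: "Hop_lim S x z \<in> Rloc x ys \<and> Gop_lim S x z \<in> Rloc x ys \<and> Hop_lim S x (Gop_lim S x z) = z \<and>
      Gop_lim S x (Hop_lim S x z) = z" if ys: "enumerates S x ys" and z: "z \<in> Rloc x ys" for ys z
  proof -
    have inv: "inverse_on (Rloc x ys) (Hop x ys) (Gop x ys)"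
      using frame.inverse_on_Rloc[OF enumerates_frame[OF ys]] .
    have "Hop_lim S x w = Hop x ys w" "Gop_lim S x w = Gop x ys w" if "w \<in> Rloc x ys" for w
      by (rule Hop_lim_eq[OF ys subsetD[OF Rloc_subset_UNIV that]]) (rule Gop_lim_eq[OF ys that])
    then show ?thesis using inv z by (auto simp: inverse_on_def image_subset_iff)
  qed
  show ?thesis
    unfolding inverse_on_def Rloc_lim_eq[OF assms] using * by blast
qed

text \<open>The clauses on \<open>Ggr\<close> and \<open>Nop\<close> record that the entries of the
  block matrix map between the sectors as their positions require. Stages are ordered by inclusion
  of sets and not of lists, so independence of the enumeration is a case of compatibility.\<close>

theorem theorem4p5:
  fixes S :: "'v set" and x :: 'v
  assumes "x \<in> S"
  shows "(\<forall>ys. enumerates S x ys \<longrightarrow>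
            inverse_on (Rloc x ys) (Hop x ys) (Gop x ys) \<and>
            Ggr x ys ` Yloc x ys \<subseteq> Yloc x ys \<and>
            Ggr x ys ` Xloc x ys \<subseteq> Xloc x ys \<and>
            Nop x ys ` Yloc x ys \<subseteq> Xloc x ys) \<and>
         (\<forall>ys zs. enumerates S x ys \<and> enumerates S x zs \<and> set ys \<subseteq> set zs \<longrightarrow>
            Rloc x ys \<subseteq> Rloc x zs \<and> (\<forall>z \<in> Rloc x ys. Gop x zs z = Gop x ys z)) \<and>
         Rloc_lim S x = (\<Union>ys \<in> {ys. enumerates S x ys}. Rloc x ys) \<and>
         (\<forall>ys. enumerates S x ys \<longrightarrow> (\<forall>z \<in> Rloc x ys. Gop_lim S x z = Gop x ys z)) \<and>
         inverse_on (Rloc_lim S x) (Hop_lim S x) (Gop_lim S x)"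
proof (intro conjI allI impI ballI)
  fix ys assume "enumerates S x ys"
  then interpret frame x ys by (rule enumerates_frame)
  show "inverse_on (Rloc x ys) (Hop x ys) (Gop x ys)" by (rule inverse_on_Rloc)
  show "Ggr x ys ` Yloc x ys \<subseteq> Yloc x ys" by (rule Ggr_Yloc)
  show "Ggr x ys ` Xloc x ys \<subseteq> Xloc x ys" by (rule Ggr_Xloc)
  show "Nop x ys ` Yloc x ys \<subseteq> Xloc x ys" by (rule Nop_Yloc)
next
  fix ys zs assume *: "enumerates S x ys \<and> enumerates S x zs \<and> set ys \<subseteq> set zs"
  then show "Rloc x ys \<subseteq> Rloc x zs" by (intro Rloc_mono) (simp_all add: enumerates_def)
  show "Gop x zs z = Gop x ys z" if "z \<in> Rloc x ys" for z
    using * that by (auto intro: Gop_enlarge enumerates_frame)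
next
  show "Rloc_lim S x = (\<Union>ys \<in> {ys. enumerates S x ys}. Rloc x ys)" by (rule Rloc_lim_eq[OF assms])
next
  fix ys z assume "enumerates S x ys" "z \<in> Rloc x ys"
  then show "Gop_lim S x z = Gop x ys z" by (rule Gop_lim_eq)
next
  show "inverse_on (Rloc_lim S x) (Hop_lim S x) (Gop_lim S x)" by (rule inverse_on_Rloc_lim[OF assms])
qed

end
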